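(* Let $(a_{i_{1}}\; a_{i_{2}} \dots)$ be a partial cycle in some SR instance $I$. In linear time, we can determine whether this partial cycle has a completion $C=(a_{i_{1}} \; a_{i_{2}} \; a_{i_{3}} \dots a_{i_{2k}})$ to an even cycle of some stable partition of $I$, or report that no such completion exists. If a completion $C$ to a stable even cycle does exist, then $C$ must be unique.
   Context: An SR (Stable Roommates) instance $I=(A,\succ)$ consists of an even number of agents, each with a strict complete preference ranking over the other agents. A stable partition is a permutation $\Pi$ of $A$ such that (T1) every agent weakly prefers its successor to its predecessor, and (T2) no two distinct agents $a_i,a_j$ satisfy $a_j \succ_i \Pi^{-1}(a_i)$ and $a_i \succ_j \Pi^{-1}(a_j)$. An even cycle is a cycle of even length greater than 2. A partial cycle $(a_{i_1}\; a_{i_2}\dots)$ is a cycle of which only some agents and their consecutive positions are known (here: $a_{i_2}$ is the successor of $a_{i_1}$); a completion is a sequence of further agents making it a cycle of some stable partition. Linear time means linear in the instance size, $O(n^2)$ for $n$ agents. *)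

theory Defs
  imports "HOL-Combinatorics.Permutations"
begin

section \<open>Stable roommates instances and stable partitions\<close>

text \<open>\<open>P i\<close> is the preference list of agent \<open>i\<close>, most preferred agent first.\<close>

definition sr_instance :: "'a set \<Rightarrow> ('a \<Rightarrow> 'a list) \<Rightarrow> bool" where
  "sr_instance A P \<longleftrightarrow>
     finite A \<and> even (card A) \<and> (\<forall>i\<in>A. distinct (P i) \<and> set (P i) = A - {i})"

text \<open>
  \<open>prefers P i x y\<close> is the relation \<open>x \<succ>\<^sub>i y\<close>. A fixed point of a partition is its own
  predecessor, so \<open>\<succ>\<^sub>i\<close> must also compare \<open>i\<close> with the other agents: as usual for stable
  partitions, every agent ranks itself last.
\<close>

definition prefers :: "('a \<Rightarrow> 'a list) \<Rightarrow> 'a \<Rightarrow> 'a \<Rightarrow> 'a \<Rightarrow> bool" where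
  "prefers P i x y \<longleftrightarrow>
     (let L = P i @ [i] in \<exists>p q. p < q \<and> q < length L \<and> L ! p = x \<and> L ! q = y)"

definition stable_partition :: "'a set \<Rightarrow> ('a \<Rightarrow> 'a list) \<Rightarrow> ('a \<Rightarrow> 'a) \<Rightarrow> bool" where
  "stable_partition A P \<pi> \<longleftrightarrow>
     \<pi> permutes A \<and>
     (\<forall>i\<in>A. \<pi> i = inv \<pi> i \<or> prefers P i (\<pi> i) (inv \<pi> i)) \<and>
     \<not> (\<exists>i\<in>A. \<exists>j\<in>A. i \<noteq> j \<and> prefers P i j (inv \<pi> i) \<and> prefers P j i (inv \<pi> j))"

definition is_cycle_of :: "('a \<Rightarrow> 'a) \<Rightarrow> 'a list \<Rightarrow> bool" where
  "is_cycle_of \<pi> C \<longleftrightarrow>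
     C \<noteq> [] \<and> distinct C \<and> (\<forall>m < length C. \<pi> (C ! m) = C ! (Suc m mod length C))"

definition stable_even_cycle :: "'a set \<Rightarrow> ('a \<Rightarrow> 'a list) \<Rightarrow> 'a list \<Rightarrow> bool" where
  "stable_even_cycle A P C \<longleftrightarrow>
     set C \<subseteq> A \<and> even (length C) \<and> length C > 2 \<and>
     (\<exists>\<pi>. stable_partition A P \<pi> \<and> is_cycle_of \<pi> C)"

text \<open>
  Cycles are written as lists starting at the first known agent, so a completion is unique as a
  cycle iff it is unique as a list.
\<close>

definition completes :: "'a set \<Rightarrow> ('a \<Rightarrow> 'a list) \<Rightarrow> 'a \<Rightarrow> 'a \<Rightarrow> 'a list \<Rightarrow> bool" where
  "completes A P a b C \<longleftrightarrow> (\<exists>D. C = a # b # D) \<and> stable_even_cycle A P C"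


section \<open>Unit-cost word RAM programs\<close>

text \<open>
  Programs are finite and refer to finitely many scalar registers and arrays, each array being a
  memory bank with indirect addressing. Every operation costs one step. Computations
  get stuck as soon as a value reaches the word bound \<open>W\<close>, so unit cost cannot be
  exploited by operating on long numbers.
\<close>

datatype binop = Add | Sub | Mul | Less | Equal

datatype expr = Const nat | Var string | Cell string expr | Op binop expr expr

datatype prog =
    Skip
  | Assign string expr
  | Store string expr expr
  | Seq prog prog
  | If expr prog prog
  | While expr prog

record state =
  var :: "string \<Rightarrow> nat"
  arr :: "string \<Rightarrow> nat \<Rightarrow> nat"

fun apply_op :: "binop \<Rightarrow> nat \<Rightarrow> nat \<Rightarrow> nat" where
  "apply_op Add x y = x + y"
| "apply_op Sub x y = x - y"
| "apply_op Mul x y = x * y"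
| "apply_op Less x y = of_bool (x < y)"
| "apply_op Equal x y = of_bool (x = y)"

primrec val :: "expr \<Rightarrow> state \<Rightarrow> nat" where
  "val (Const k) s = k"
| "val (Var x) s = var s x"
| "val (Cell x e) s = arr s x (val e s)"
| "val (Op f e1 e2) s = apply_op f (val e1 s) (val e2 s)"

primrec fits :: "nat \<Rightarrow> expr \<Rightarrow> state \<Rightarrow> bool" where
  "fits W (Const k) s \<longleftrightarrow> k < W"
| "fits W (Var x) s \<longleftrightarrow> var s x < W"
| "fits W (Cell x e) s \<longleftrightarrow> fits W e s \<and> arr s x (val e s) < W"
| "fits W (Op f e1 e2) s \<longleftrightarrow>
     fits W e1 s \<and> fits W e2 s \<and> apply_op f (val e1 s) (val e2 s) < W"

primrec cost :: "expr \<Rightarrow> nat" where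
  "cost (Const k) = 1"
| "cost (Var x) = 1"
| "cost (Cell x e) = cost e + 1"
| "cost (Op f e1 e2) = cost e1 + cost e2 + 1"

text \<open>\<open>exec W c s t s'\<close>: started in \<open>s\<close>, program \<open>c\<close> halts in \<open>s'\<close> after \<open>t\<close> steps.\<close>

inductive exec :: "nat \<Rightarrow> prog \<Rightarrow> state \<Rightarrow> nat \<Rightarrow> state \<Rightarrow> bool" for W where
  Skip: "exec W Skip s 1 s"
| Assign: "fits W e s \<Longrightarrow>
    exec W (Assign x e) s (cost e + 1) (s\<lparr>var := (var s)(x := val e s)\<rparr>)"
| Store: "fits W e1 s \<Longrightarrow> fits W e2 s \<Longrightarrow>
    exec W (Store x e1 e2) s (cost e1 + cost e2 + 1)
      (s\<lparr>arr := (arr s)(x := (arr s x)(val e1 s := val e2 s))\<rparr>)"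
| Seq: "exec W c1 s t1 s1 \<Longrightarrow> exec W c2 s1 t2 s2 \<Longrightarrow> exec W (Seq c1 c2) s (t1 + t2) s2"
| IfTrue: "fits W e s \<Longrightarrow> val e s \<noteq> 0 \<Longrightarrow> exec W c1 s t s1 \<Longrightarrow>
    exec W (If e c1 c2) s (cost e + 1 + t) s1"
| IfFalse: "fits W e s \<Longrightarrow> val e s = 0 \<Longrightarrow> exec W c2 s t s1 \<Longrightarrow>
    exec W (If e c1 c2) s (cost e + 1 + t) s1"
| WhileFalse: "fits W e s \<Longrightarrow> val e s = 0 \<Longrightarrow> exec W (While e c) s (cost e + 1) s"
| WhileTrue: "fits W e s \<Longrightarrow> val e s \<noteq> 0 \<Longrightarrow> exec W c s t1 s1 \<Longrightarrow>
    exec W (While e c) s1 t2 s2 \<Longrightarrow> exec W (While e c) s (cost e + 1 + t1 + t2) s2"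

inductive_cases exec_cases:
  "exec W Skip s t s'"
  "exec W (Assign x e) s t s'"
  "exec W (Store x e1 e2) s t s'"
  "exec W (Seq c1 c2) s t s'"
  "exec W (If e c1 c2) s t s'"
  "exec W (While e c) s t s'"

lemma exec_deterministic:
  "exec W c s t s1 \<Longrightarrow> exec W c s t' s2 \<Longrightarrow> t' = t \<and> s2 = s1"
proof (induction arbitrary: t' s2 rule: exec.induct)
  case (Seq c1 s t1 s1 c2 t2 s2)
  from Seq.prems obtain u1 u2 r
    where "t' = u1 + u2" "exec W c1 s u1 r" "exec W c2 r u2 s2"
    by (auto elim: exec_cases(4))
  with Seq.IH show ?case by blast
next
  case (IfTrue e s c1 t s1 c2)
  from IfTrue.prems obtain u where "t' = cost e + 1 + u" "exec W c1 s u s2"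
    using IfTrue.hyps by (auto elim: exec_cases(5))
  with IfTrue.IH show ?case by blast
next
  case (IfFalse e s c2 t s1 c1)
  from IfFalse.prems obtain u where "t' = cost e + 1 + u" "exec W c2 s u s2"
    using IfFalse.hyps by (auto elim: exec_cases(5))
  with IfFalse.IH show ?case by blast
next
  case (WhileTrue e s c t1 s1 t2 s2)
  from WhileTrue.prems obtain u1 u2 r
    where "t' = cost e + 1 + u1 + u2" "exec W c s u1 r" "exec W (While e c) r u2 s2"
    using WhileTrue.hyps by (auto elim: exec_cases(6))
  with WhileTrue.IH show ?case by blast
qed (auto elim: exec_cases)


section \<open>Input and output\<close>

text \<open>
  The agents are numbered \<open>0, \<dots>, n - 1\<close>. Only the preference lists are given, as a row-major
  \<open>n \<times> n\<close> table whose last column is unused; all other memory is zero.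
\<close>

definition input :: "nat \<Rightarrow> (nat \<Rightarrow> nat list) \<Rightarrow> nat \<Rightarrow> nat \<Rightarrow> state" where
  "input n P a b =
     \<lparr>var = (\<lambda>_. 0)(''n'' := n, ''a'' := a, ''b'' := b),
      arr = (\<lambda>_ _. 0)(''pref'' := (\<lambda>m. if m < n * n \<and> m mod n < length (P (m div n))
                                   then P (m div n) ! (m mod n) else 0))\<rparr>"

definition result :: "state \<Rightarrow> nat list option" where
  "result s =
     (if var s ''found'' = 0 then None
      else Some (map (arr s ''cycle'') [0..<var s ''length'']))"

text \<open>
  A linear-time algorithm is a single program, correct on all instances, whose number of steps is
  at most a constant times \<open>n\<^sup>2\<close>, on words of \<open>k * log n\<close> bits for a constant \<open>k\<close>. For \<open>n \<ge> 2\<close>,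
  which two distinct agents force, \<open>n ^ k\<close> exceeds any given constant for suitable \<open>k\<close>.
\<close>

definition linear_time_completion :: "prog \<Rightarrow> bool" where
  "linear_time_completion c \<longleftrightarrow>
     (\<exists>K k. \<forall>n P a b.
        sr_instance {..<n} P \<longrightarrow> a < n \<longrightarrow> b < n \<longrightarrow> a \<noteq> b \<longrightarrow>
        (\<exists>t s. exec (n ^ k) c (input n P a b) t s \<and> t \<le> K * n\<^sup>2 \<and>
           (case result s of
              Some C \<Rightarrow> completes {..<n} P a b C
            | None \<Rightarrow> \<not> (\<exists>C. completes {..<n} P a b C))))"

end

theory Submission
  imports Defs
begin

text \<open>
  Split every agent into a proposer and a receiver. A stable partition \<open>s\<close> then gives two stable
  matchings of this bipartite market, \<open>s\<close> and \<open>inv s\<close>. If \<open>a\<close> gets its successor in \<open>s\<close>, then any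
  stable matching that gives \<open>a\<close> something worse, but nothing worse than its predecessor, must give it
  exactly its predecessor: otherwise the opposition of interests between the two sides fails.
  Applied to \<open>inv t\<close> for another stable partition \<open>t\<close>, this determines a cycle of length greater
  than 2 backwards from one of its edges, which gives uniqueness.

  For the algorithm, run deferred acceptance with \<open>a\<close> forced below \<open>b\<close>. If a completion exists, the
  result pairs \<open>a\<close> and every second agent on its cycle with its predecessor; starting once more from the
  predecessor of \<open>a\<close> gives the others, so the candidate can be read off. A third run tests the candidate:
  it fixes the cycle and rejects all proposals that would leave a pair blocking together with it. If this
  run succeeds, the agents off the cycle have a stable matching in which everybody weakly prefers its
  successor, and eliminating rotations (Irving, Tan) turns it into a stable partition without making any
  predecessor worse.
\<close>

section \<open>Stable matchings of the bipartite market\<close>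

text \<open>No stable partition is known when a run starts. The restrictions put on a run must
  therefore hold for every stable partition with the given edge on a cycle longer than 2: then
  failure refutes a completion, and success returns a matching at least as good for each proposer as
  all the matchings so obtained. The forcing argument passes from an agent to the agent two places
  before it, and on an even cycle these steps miss every second agent, hence the second run and the
  parity bookkeeping. The cycle that is read off has a meaning only if a completion exists, so its
  test must consist of conditions that are necessary for a completion and yet suffice for gluing.
  Off the cycle the test cannot demand (T2), because the run only produces a matching that is stable
  in the bipartite sense; checking the order there as well is what allows rotations to repair it.
  Fixed points need no separate treatment, since an agent that ranks itself last never blocks with
  itself.\<close>

locale preferences =
  fixes A :: "'a set" and r :: "'a \<Rightarrow> 'a \<Rightarrow> nat"
  assumes finite_agents: "finite A"
    and rank_inj: "\<lbrakk>i \<in> A; x \<in> A; y \<in> A; r i x = r i y\<rbrakk> \<Longrightarrow> x = y"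
    and self_last: "\<lbrakk>i \<in> A; x \<in> A\<rbrakk> \<Longrightarrow> r i x \<le> r i i"
begin

text \<open>Proposer \<open>i\<close> is matched to receiver \<open>s i\<close>, and receiver
  \<open>j\<close> to proposer \<open>inv s j\<close>. The two copies of one agent may be matched to
  different agents, or to each other.\<close>

definition bistable :: "('a \<Rightarrow> 'a) \<Rightarrow> bool" where
  "bistable s \<longleftrightarrow> s permutes A \<and> (\<forall>i\<in>A. \<forall>j\<in>A. r i j < r i (s i) \<longrightarrow> r j (inv s j) \<le> r j i)"

definition ordered :: "('a \<Rightarrow> 'a) \<Rightarrow> bool" where
  "ordered s \<longleftrightarrow> (\<forall>i\<in>A. r i (s i) \<le> r i (inv s i))"

definition unblocked :: "('a \<Rightarrow> 'a) \<Rightarrow> bool" where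
  "unblocked s \<longleftrightarrow> (\<forall>i\<in>A. \<forall>j\<in>A. r i j < r i (inv s i) \<longrightarrow> r j (inv s j) \<le> r j i)"

definition stable :: "('a \<Rightarrow> 'a) \<Rightarrow> bool" where
  "stable s \<longleftrightarrow> s permutes A \<and> ordered s \<and> unblocked s"

lemma rank_less: "\<lbrakk>i \<in> A; x \<in> A; y \<in> A; r i x \<le> r i y; x \<noteq> y\<rbrakk> \<Longrightarrow> r i x < r i y"
  using rank_inj by (metis le_neq_implies_less)

lemma stable_imp_bistable: "stable s \<Longrightarrow> bistable s"
  unfolding stable_def bistable_def ordered_def unblocked_def
  by (meson order_less_le_trans)

text \<open>Under \<open>inv s\<close> a proposer gets its predecessor, so its half of the blocking
  condition is that of \<open>unblocked\<close>. A receiver gets its successor, which by the order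
  is no worse than the predecessor that \<open>unblocked\<close> speaks of.\<close>

lemma stable_imp_bistable_inv: "stable s \<Longrightarrow> bistable (inv s)"
  unfolding stable_def bistable_def ordered_def unblocked_def
  by (metis order_trans permutes_inv permutes_inv_inv)

text \<open>A counting argument: \<open>m\<close> maps the proposers \<open>B\<close> that gain
  under \<open>m\<close> into the receivers \<open>F\<close> that gain under \<open>s\<close>, and
  \<open>inv s\<close> maps \<open>F\<close> back into \<open>B\<close>. Both maps are injective and
  the sets finite, so \<open>m\<close> maps \<open>B\<close> onto \<open>F\<close>, and every
  receiver in \<open>F\<close> has its \<open>m\<close>-partner in \<open>B\<close>.\<close>

lemma opposition:
  assumes m: "bistable m" and s: "bistable s"
    and x: "x \<in> A" and z: "r (m x) (inv s (m x)) < r (m x) x"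
  shows "r x (m x) < r x (s x)"
proof -
  have pm: "m permutes A" and ps: "s permutes A"
    using m s by (auto simp: bistable_def)
  note [simp] = permutes_inverses[OF pm] permutes_inverses[OF ps]
    permutes_in_image[OF pm] permutes_in_image[OF ps]
    permutes_in_image[OF permutes_inv[OF pm]] permutes_in_image[OF permutes_inv[OF ps]]
  define B where "B = {x\<in>A. r x (m x) < r x (s x)}"
  define F where "F = {y\<in>A. r y (inv s y) < r y (inv m y)}"
  have fin: "finite B" "finite F" using finite_agents by (auto simp: B_def F_def)
  have mB: "m ` B \<subseteq> F"
  proof (clarsimp simp: B_def F_def)
    fix x assume x: "x \<in> A" "r x (m x) < r x (s x)"
    then have "r (m x) (inv s (m x)) \<le> r (m x) x"
      using s by (auto simp: bistable_def)
    moreover have "inv s (m x) \<noteq> x" using x permutes_inverses(1)[OF ps, of "m x"] by (metis nat_neq_iff)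
    ultimately show "r (m x) (inv s (m x)) < r (m x) x"
      using x by (intro rank_less) auto
  qed
  have "inv s ` F \<subseteq> B"
  proof (clarsimp simp: B_def F_def)
    fix y assume y: "y \<in> A" "r y (inv s y) < r y (inv m y)"
    then have "\<not> r (inv s y) y < r (inv s y) (m (inv s y))"
      using m by (auto simp: bistable_def not_less not_le[symmetric])
    moreover have "m (inv s y) \<noteq> y" using y permutes_inverses(2)[OF pm, of "inv s y"] by (metis nat_neq_iff)
    ultimately show "r (inv s y) (m (inv s y)) < r (inv s y) y"
      using y by (intro rank_less) auto
  qed
  then have "card F \<le> card B"
    using fin card_inj_on_le[of "inv s" F B] permutes_inj[OF permutes_inv[OF ps]]
    by (auto intro: inj_on_subset)
  moreover have "card (m ` B) = card B"
    using permutes_inj[OF pm] by (auto intro!: card_image intro: inj_on_subset)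
  ultimately have "m ` B = F" using mB fin by (metis card_subset_eq card_mono le_antisym)
  moreover have "m x \<in> F" using x z by (auto simp: F_def)
  ultimately obtain x' where "x' \<in> B" "m x' = m x" by auto
  then have "x \<in> B" using permutes_inj[OF pm] by (auto dest: injD)
  then show ?thesis by (auto simp: B_def)
qed

text \<open>If \<open>m x\<close> were strictly better than the predecessor of \<open>x\<close>,
  then by \<open>unblocked\<close> the agent \<open>m x\<close> would prefer its own predecessor in
  \<open>s\<close> to \<open>x\<close>. By \<open>opposition\<close>, \<open>x\<close> would gain
  under \<open>m\<close>, against \<open>below\<close>.\<close>

lemma forced_predecessor:
  assumes s: "stable s" and m: "bistable m" and x: "x \<in> A"
    and below: "r x (s x) < r x (m x)" and above: "r x (m x) \<le> r x (inv s x)"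
  shows "m x = inv s x"
proof (rule ccontr)
  assume neq: "m x \<noteq> inv s x"
  have pm: "m permutes A" and ps: "s permutes A"
    using m s by (auto simp: bistable_def stable_def)
  have mx: "m x \<in> A" "inv s x \<in> A"
    using x pm ps permutes_in_image permutes_inv by metis+
  have "r x (m x) < r x (inv s x)" using rank_less x mx above neq by blast
  then have "r (m x) (inv s (m x)) \<le> r (m x) x"
    using s x mx by (auto simp: stable_def unblocked_def)
  moreover have "inv s (m x) \<noteq> x"
    using below permutes_inverses(1)[OF ps, of "m x"] by auto
  moreover have "inv s (m x) \<in> A" using mx ps permutes_in_image permutes_inv by metis
  ultimately have "r (m x) (inv s (m x)) < r (m x) x" using rank_less x mx by blast
  from opposition[OF m stable_imp_bistable[OF s] x this] below show False by simp
qed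

text \<open>One of the two predecessors is at least as good for \<open>x\<close> as the other. The
  partition with the worse one plays \<open>s\<close> in \<open>forced_predecessor\<close>, the
  inverse of the other plays \<open>m\<close>.\<close>

lemma predecessor_unique:
  assumes s: "stable s" and t: "stable t" and x: "x \<in> A"
    and eq: "s x = t x" and "s x \<noteq> inv s x" "t x \<noteq> inv t x"
  shows "inv s x = inv t x"
proof -
  have ps: "s permutes A" and pt: "t permutes A" using s t by (auto simp: stable_def)
  have mem: "s x \<in> A" "inv s x \<in> A" "t x \<in> A" "inv t x \<in> A"
    using x ps pt permutes_in_image permutes_inv by metis+
  have "r x (s x) < r x (inv s x)" "r x (t x) < r x (inv t x)"
    using s t x mem assms(5,6) rank_less by (auto simp: stable_def ordered_def)
  then show ?thesis
    using forced_predecessor[OF s stable_imp_bistable_inv[OF t] x]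
      forced_predecessor[OF t stable_imp_bistable_inv[OF s] x] eq
    by (metis le_cases)
qed

text \<open>The hypothesis \<open>above\<close> is what proposer-optimality of \<open>m\<close> will
  provide. The loss that \<open>a\<close> suffers under \<open>m\<close> compared with its successor
  is passed on two places back each time, and at each such agent \<open>forced_predecessor\<close>
  applies.\<close>

lemma alternate_predecessors:
  assumes s: "stable s" and m: "bistable m" and a: "a \<in> A"
    and long: "s (s a) \<noteq> a"
    and above: "\<And>x. x \<in> A \<Longrightarrow> r x (m x) \<le> r x (inv s x)"
    and below: "r a (s a) < r a (m a)"
  shows "m ((inv s ^^ (2 * k)) a) = inv s ((inv s ^^ (2 * k)) a)"
proof -
  have pm: "m permutes A" and ps: "s permutes A"
    using m s by (auto simp: bistable_def stable_def)
  note [simp] = permutes_inverses[OF pm] permutes_inverses[OF ps]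
    permutes_in_image[OF pm] permutes_in_image[OF ps]
    permutes_in_image[OF permutes_inv[OF pm]] permutes_in_image[OF permutes_inv[OF ps]]
  define G where "G x \<longleftrightarrow> x \<in> A \<and> s (s x) \<noteq> x \<and> r x (s x) < r x (m x)" for x
  have G: "m x = inv s x" if "G x" for x
    using that forced_predecessor[OF s m] above by (auto simp: G_def)
  have step: "G (inv s (inv s x))" if "G x" for x
  proof -
    define y where "y = inv s x"
    have x: "x \<in> A" "s (s x) \<noteq> x" using that by (auto simp: G_def)
    have y: "y \<in> A" "s y = x" "inv m y = x" "m x = y"
      using x G[OF that] permutes_inverses(2)[OF pm, of x] by (auto simp: y_def)
    have "x \<noteq> inv s y" using x y by (metis permutes_inverses(1)[OF ps])
    then have "r y (inv m y) < r y (inv s y)"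
      using s y x rank_less by (auto simp: stable_def ordered_def)
    \<comment> \<open>As a receiver, \<open>y\<close> holds its successor \<open>x\<close> under
      \<open>m\<close> but only its predecessor under \<open>s\<close>. So
      \<open>opposition\<close>, with the two matchings exchanged, makes the predecessor of
      \<open>y\<close> lose under \<open>m\<close>.\<close>
    then have "r (inv s y) y < r (inv s y) (m (inv s y))"
      using opposition[OF stable_imp_bistable[OF s] m, of "inv s y"] y x by auto
    moreover have "s (s (inv s y)) \<noteq> inv s y" using \<open>x \<noteq> inv s y\<close> y by auto
    ultimately show ?thesis using y by (auto simp: G_def y_def[symmetric])
  qed
  have "G ((inv s ^^ (2 * k)) a)"
    by (induction k) (use a long below step in \<open>auto simp: G_def\<close>)
  then show ?thesis by (rule G)
qed

text \<open>
  One step down the lattice of bistable matchings. The map \<open>f\<close> is the successor function of the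
  classical rotation search, and \<open>K\<close> the rotation that the search from \<open>i\<close> ends in.
  If eliminating \<open>K\<close> destroyed the order, \<open>K\<close> would be an odd cycle of \<open>s\<close> on
  which \<open>nx\<close> is the predecessor, and \<open>i\<close> would have to lie on it.
\<close>

lemma eliminate_rotation:
  assumes s: "bistable s" and ord: "ordered s"
    and i: "i \<in> A" and j: "j \<in> A"
    and ij: "r i j < r i (inv s i)" and ji: "r j i < r j (inv s j)"
  shows "\<exists>s'. bistable s' \<and> ordered s' \<and>
    (\<forall>x\<in>A. r x (inv s' x) \<le> r x (inv s x)) \<and> (\<forall>x\<in>A. r x (s x) \<le> r x (s' x)) \<and>
    (\<exists>x\<in>A. r x (s x) < r x (s' x))"
proof -
  have ps: "s permutes A" using s by (auto simp: bistable_def)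
  define p where "p = inv s"
  have sp [simp]: "s (p x) = x" "p (s x) = x" for x
    using permutes_inverses[OF ps] by (auto simp: p_def)
  have mem [simp]: "s x \<in> A \<longleftrightarrow> x \<in> A" "p x \<in> A \<longleftrightarrow> x \<in> A" for x
    using permutes_in_image[OF ps] permutes_in_image[OF permutes_inv[OF ps]] by (auto simp: p_def)
  have bs: "r y (p y) \<le> r y x" if "x \<in> A" "y \<in> A" "r x y < r x (s x)" for x y
    using s that by (auto simp: bistable_def p_def)
  have le: "r x (s x) \<le> r x (p x)" if "x \<in> A" for x
    using ord that by (auto simp: ordered_def p_def)
  define X where "X = {x\<in>A. s x \<noteq> p x}"
  have less: "r x (s x) < r x (p x)" if "x \<in> X" for x
    using that le rank_less by (auto simp: X_def)
  \<comment> \<open>These are the agents that \<open>x\<close> could win after giving up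
    \<open>s x\<close>: they would drop their predecessor for \<open>x\<close>. The best of them is
    \<open>nx x\<close>.\<close>
  define cand where "cand x y \<longleftrightarrow> y \<in> A \<and> r x (s x) < r x y \<and> r y x < r y (p y)" for x y
  define nx where "nx x = arg_min (r x) (cand x)" for x
  \<comment> \<open>The predecessor is always available as a fallback: it prefers its successor
    \<open>x\<close> to its own predecessor, strictly because \<open>x\<close> is not on a cycle of
    length 2. Hence the search never gets stuck and never passes \<open>p x\<close>; this is where
    \<open>ordered\<close> helps.\<close>
  have cand_p: "cand x (p x)" if "x \<in> X" for x
  proof -
    have x: "x \<in> A" "s x \<noteq> p x" using that by (auto simp: X_def)
    then have "x \<noteq> p (p x)" by (metis sp(1))
    then have "r (p x) x < r (p x) (p (p x))"
      using le[of "p x"] x by (intro rank_less) auto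
    then show ?thesis using x less[OF that] by (auto simp: cand_def)
  qed
  have cand_nx: "cand x (nx x)" if "x \<in> X" for x
    unfolding nx_def using cand_p[OF that] by (rule arg_min_natI)
  have nx_le: "r x (nx x) \<le> r x y" if "cand x y" for x y
    unfolding nx_def using that by (rule arg_min_nat_le)
  have nx_gap: "r y (p y) \<le> r y x"
    if "x \<in> X" "y \<in> A" "r x (s x) < r x y" "r x y < r x (nx x)" for x y
    using nx_le[of x y] that by (force simp: cand_def)
  have nx_p: "r x (nx x) \<le> r x (p x)" if "x \<in> X" for x
    using nx_le cand_p that by blast
  \<comment> \<open>Otherwise \<open>nx x\<close>, taken as a proposer, would prefer
    \<open>x\<close> to its successor; bistability then makes \<open>p x\<close> at least as good
    for \<open>x\<close> as \<open>nx x\<close>. So \<open>nx x = p x\<close>, whose successor is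
    \<open>x\<close> itself.\<close>
  have nx_s: "r (nx x) (s (nx x)) \<le> r (nx x) x" if "x \<in> X" for x
  proof (rule ccontr)
    assume *: "\<not> ?thesis"
    have x: "x \<in> A" "nx x \<in> A" using that cand_nx[OF that] by (auto simp: X_def cand_def)
    then have "r x (p x) \<le> r x (nx x)" using bs[of "nx x" x] * by auto
    then have "nx x = p x" using nx_p[OF that] rank_inj[of x] x by auto
    then show False using * by simp
  qed
  have nx_X: "nx x \<in> X" if "x \<in> X" for x
    using nx_s[OF that] cand_nx[OF that] by (auto simp: X_def cand_def)
  define f where "f x = p (nx x)" for x
  have X_p: "p x \<in> X \<longleftrightarrow> x \<in> X" for x by (auto simp: X_def) (metis sp)+
  have f_X: "f x \<in> X" if "x \<in> X" for x
    using nx_X[OF that] X_p by (auto simp: f_def)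
  have "r i (s i) \<le> r i j" using bs[OF i j] bs[of i j] ji i j by (force simp: p_def)
  then have i_X: "i \<in> X" using ij i by (auto simp: X_def p_def)
  have "j \<noteq> s i" using ji by (auto simp: p_def[symmetric])
  then have "cand i j" using \<open>r i (s i) \<le> r i j\<close> i j ji rank_less
    by (auto simp: cand_def p_def)
  \<comment> \<open>The pair \<open>i\<close>, \<open>j\<close> blocks in the sense of (T2), so the
    search from \<open>i\<close> stops strictly before the predecessor of \<open>i\<close>. The
    proof of \<open>ordered s'\<close> will contradict exactly this.\<close>
  then have nx_i: "nx i \<noteq> p i" using nx_le[of i j] ij by (auto simp: p_def)
  define g where "g k = (f ^^ k) i" for k
  have g_X: "g k \<in> X" for k by (induction k) (auto simp: g_def i_X f_X)
  have g_Suc: "g (Suc k) = f (g k)" for k by (simp add: g_def)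
  have "\<not> inj g"
  proof
    assume "inj g"
    moreover have "range g \<subseteq> A" using g_X by (auto simp: X_def)
    ultimately show False using finite_agents by (meson finite_imageD finite_subset infinite_UNIV_nat)
  qed
  then obtain N M where NM: "N < M" "g N = g M"
    unfolding inj_def by (metis linorder_neqE_nat)
  \<comment> \<open>The search sequence is eventually periodic; \<open>K\<close> is one period, so
    shifting the index by one leaves it unchanged and \<open>f\<close> permutes it.\<close>
  define K where "K = g ` {N..<M}"
  have K_X: "K \<subseteq> X" using g_X by (auto simp: K_def)
  then have K_A: "K \<subseteq> A" by (auto simp: X_def)
  have "f ` K = g ` Suc ` {N..<M}" by (simp only: K_def image_image g_Suc)
  also have "\<dots> = g ` {Suc N..<Suc M}" by (metis image_Suc_atLeastLessThan)
  also have "\<dots> = K"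
  proof -
    have "{N..<M} = insert N {Suc N..<M}" "{Suc N..<Suc M} = insert M {Suc N..<M}"
      using NM by auto
    then show ?thesis by (simp add: K_def NM)
  qed
  finally have fK: "f ` K = K" .
  have "bij_betw f K K"
    using fK finite_surj_inj[of K f] by (simp add: bij_betw_def K_def)
  define \<nu> where "\<nu> x = (if x \<in> K then f x else x)" for x
  have "\<nu> permutes K"
    using \<open>bij_betw f K K\<close>
    by (intro bij_imp_permutes) (auto simp: \<nu>_def cong: bij_betw_cong)
  then have "\<nu> permutes A" using K_A permutes_subset by blast
  define s' where "s' = s \<circ> \<nu>"
  have ps': "s' permutes A" unfolding s'_def by (rule permutes_compose) fact+
  define p' where "p' = inv s'"
  have sp' [simp]: "s' (p' x) = x" "p' (s' x) = x" for x
    using permutes_inverses[OF ps'] by (auto simp: p'_def)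
  have mem' [simp]: "s' x \<in> A \<longleftrightarrow> x \<in> A" "p' x \<in> A \<longleftrightarrow> x \<in> A" for x
    using permutes_in_image[OF ps'] permutes_in_image[OF permutes_inv[OF ps']]
    by (auto simp: p'_def)
  have s': "s' x = (if x \<in> K then nx x else s x)" for x
    by (auto simp: s'_def \<nu>_def f_def)
  have p'_cases: "(\<exists>x\<in>K. y = nx x \<and> p' y = x \<and> p y \<in> K) \<or> p' y = p y \<and> p y \<notin> K" for y
  proof (cases "p y \<in> K")
    case True
    then obtain x where "x \<in> K" "f x = p y" using fK by (metis imageE)
    then have "x \<in> K" "nx x = y" unfolding f_def by (metis sp(1))+
    moreover have "p' y = x" using calculation s'[of x] by (metis sp'(2))
    ultimately show ?thesis using True by blast
  next
    case False
    then have "s' (p y) = y" using s'[of "p y"] by simp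
    then show ?thesis using False by (metis sp'(2))
  qed
  have p'_le: "r y (p' y) \<le> r y (p y)" if "y \<in> A" for y
    using p'_cases[of y] cand_nx K_X unfolding cand_def by (metis less_imp_le order_refl subsetD)
  have s'_gt: "r x (s x) < r x (s' x)" if "x \<in> K" for x
    using cand_nx[of x] that K_X s'[of x] by (auto simp: cand_def)
  then have s'_ge: "r x (s x) \<le> r x (s' x)" for x
    by (cases "x \<in> K") (auto simp: s' intro: less_imp_le)
  \<comment> \<open>Receivers only gain, so a new blocking pair \<open>x\<close>, \<open>y\<close>
    would need \<open>y\<close> strictly between the old and the new partner of \<open>x\<close>. No
    agent there accepts \<open>x\<close>, by \<open>nx_gap\<close>.\<close>
  have bs': "bistable s'"
    unfolding bistable_def p'_def[symmetric]
  proof (intro conjI ballI impI ps')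
    fix x y assume x: "x \<in> A" and y: "y \<in> A" and xy: "r x y < r x (s' x)"
    show "r y (p' y) \<le> r y x"
    proof (rule ccontr)
      assume "\<not> r y (p' y) \<le> r y x"
      then have *: "r y x < r y (p y)" using p'_le[OF y] by linarith
      then have "r x (s x) \<le> r x y" using bs[OF x y] by force
      moreover have "y \<noteq> s x" using * by auto
      ultimately have "r x (s x) < r x y" using rank_less x y by auto
      then have "x \<in> K" "r x y < r x (nx x)" using xy s'[of x] by (auto split: if_splits)
      then show False using nx_gap[of x y] K_X y * \<open>r x (s x) < r x y\<close> by force
    qed
  qed
  have "ordered s'"
  proof (rule ccontr)
    assume "\<not> ordered s'"
    then obtain z where z: "z \<in> A" "r z (p' z) < r z (s' z)"
      by (auto simp: ordered_def p'_def not_le)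
    \<comment> \<open>Only an agent affected by the rotation on both sides can violate the order: if
      its successor is kept, \<open>nx_s\<close> protects it, and if its predecessor is kept,
      \<open>nx_p\<close> does.\<close>
    define bad where "bad z \<longleftrightarrow> z \<in> K \<and> r z (p' z) < r z (s' z) \<and> p z \<in> K" for z
    have bad_z: "bad z"
    proof -
      have "z \<in> K"
      proof (rule ccontr)
        assume "z \<notin> K"
        then have "s' z = s z" by (simp add: s')
        then have "p' z \<noteq> p z" using le z by force
        then obtain x where x: "x \<in> K" "z = nx x" "p' z = x" using p'_cases by metis
        then show False using nx_s[of x] K_X z \<open>s' z = s z\<close> by auto
      qed
      moreover have "p z \<in> K"
      proof (rule ccontr)
        assume "p z \<notin> K"
        then have "p' z = p z" using p'_cases by metis
        then show False using z nx_p[of z] \<open>z \<in> K\<close> K_X s'[of z] by auto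
      qed
      ultimately show ?thesis using z by (simp add: bad_def)
    qed
    \<comment> \<open>By \<open>nx_gap\<close>, the new predecessor of a bad \<open>z\<close> must
      be its old successor \<open>s z\<close>. Thus \<open>s z\<close> has moved down to its own old
      predecessor \<open>z\<close> while its predecessor improved strictly, so it is bad in
      turn.\<close>
    have bad_step: "bad (s z) \<and> nx (s z) = p (s z)" if bad: "bad z" for z
    proof -
      have zK: "z \<in> K" and zX: "z \<in> X" and zA: "z \<in> A"
        using bad K_X K_A by (auto simp: bad_def)
      obtain x where x: "x \<in> K" "z = nx x" "p' z = x"
        using p'_cases[of z] bad[unfolded bad_def] by metis
      have xX: "x \<in> X" and xA: "x \<in> A" using x K_X K_A by auto
      have xlt: "r z x < r z (nx z)" using bad x zK s'[of z] by (auto simp: bad_def)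
      have "x = s z"
      proof (rule ccontr)
        assume ne: "x \<noteq> s z"
        then have "r z (s z) < r z x" using nx_s[OF xX] x rank_less zA xA by auto
        then have "r x (p x) \<le> r x z" using nx_gap[OF zX xA] xlt by blast
        then have "p x = z" using nx_p[OF xX] x rank_inj[OF xA] xA zA by auto
        then show False using ne by auto
      qed
      then have sz: "s z \<in> K" "nx (s z) = z" using x by auto
      have "p' (s z) \<noteq> p (s z)"
      proof -
        have "\<not> (p' (s z) = p (s z) \<and> p (s z) \<notin> K)" using zK by simp
        then obtain x' where x': "x' \<in> K" "s z = nx x'" "p' (s z) = x'"
          using p'_cases[of "s z"] by metis
        then have "r (s z) x' < r (s z) (p (s z))" using cand_nx[of x'] K_X
          by (auto simp: cand_def)
        then show ?thesis using x' by auto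
      qed
      then have "r (s z) (p' (s z)) < r (s z) (p (s z))"
        using p'_le[of "s z"] zA by (intro rank_less) auto
      then show ?thesis using sz zK s'[of "s z"] by (simp add: bad_def)
    qed
    define Z where "Z = range (\<lambda>k. (s ^^ k) z)"
    have bad_pow: "bad ((s ^^ k) z)" for k
      by (induction k) (auto simp: bad_z bad_step)
    have s_Z: "s x \<in> Z" if x: "x \<in> Z" for x
    proof -
      obtain k where "x = (s ^^ k) z" using x by (auto simp: Z_def)
      then have "s x = (s ^^ Suc k) z" by simp
      then show ?thesis unfolding Z_def by blast
    qed
    have Z_K: "Z \<subseteq> K" using bad_pow unfolding Z_def bad_def by blast
    have "finite Z" using finite_subset[OF Z_K] finite_subset[OF K_A finite_agents] by blast
    moreover have "inj_on s Z" by (metis inj_onI sp(2))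
    ultimately have "s ` Z = Z" using s_Z by (intro endo_inj_surj) auto
    have p_Z: "p x \<in> Z \<longleftrightarrow> x \<in> Z" for x
    proof
      assume "p x \<in> Z"
      then show "x \<in> Z" using s_Z[of "p x"] by simp
    next
      assume "x \<in> Z"
      then obtain y where "y \<in> Z" "x = s y" using \<open>s ` Z = Z\<close> by blast
      then show "p x \<in> Z" by simp
    qed
    have nx_Z: "nx x = p x" if x: "x \<in> Z" for x
    proof -
      have "p x \<in> Z" using x p_Z by simp
      then obtain k where "p x = (s ^^ k) z" by (auto simp: Z_def)
      then show ?thesis using bad_step[OF bad_pow[of k]] sp(1)[of x] by simp
    qed
    \<comment> \<open>If \<open>x\<close> outside \<open>Z\<close> entered \<open>Z\<close> through
      \<open>y = nx x\<close>, it would lie strictly between \<open>s y\<close> and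
      \<open>nx y = p y\<close> for \<open>y\<close>. By \<open>nx_gap\<close>, \<open>x\<close>
      then does not prefer \<open>y\<close> to \<open>p x\<close>, so \<open>y = p x\<close> and
      \<open>x = s y\<close> would be in \<open>Z\<close>.\<close>
    have Z_pull: "x \<in> Z" if x: "x \<in> X" and fx: "f x \<in> Z" for x
    proof (rule ccontr)
      assume xZ: "x \<notin> Z"
      define y where "y = nx x"
      have yZ: "y \<in> Z" and yA: "y \<in> A" and xA: "x \<in> A" and yX: "y \<in> X"
        using fx p_Z cand_nx[OF x] x Z_K K_X by (auto simp: f_def y_def cand_def X_def)
      have ne: "x \<noteq> s y" using xZ yZ s_Z by auto
      then have "r y (s y) < r y x" using nx_s[OF x] rank_less yA xA by (auto simp: y_def)
      moreover have "r y x < r y (nx y)"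
        using cand_nx[OF x] nx_Z[OF yZ] by (auto simp: cand_def y_def)
      ultimately have "r x (p x) \<le> r x y" using nx_gap[OF yX xA] by blast
      then have "y = p x" using nx_p[OF x] rank_inj[OF xA] xA yA by (auto simp: y_def)
      then show False using ne by simp
    qed
    have "z \<in> Z" unfolding Z_def by (rule range_eqI[of _ _ 0]) simp
    moreover obtain k where "z = g k" using bad_z by (auto simp: bad_def K_def)
    ultimately have "g k \<in> Z" by simp
    \<comment> \<open>The search is traced back from its period to its start \<open>i\<close>, where
      \<open>nx i = p i\<close> would follow.\<close>
    then have "g 0 \<in> Z"
      by (induction k) (use Z_pull[OF g_X] in \<open>simp_all add: g_Suc\<close>)
    then show False using nx_Z nx_i by (simp add: g_def)
  qed
  moreover have "g N \<in> K" using NM(1) by (auto simp: K_def)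
  ultimately show ?thesis
    using bs' s'_ge s'_gt[of "g N"] p'_le K_A
    by (intro exI[of _ s'] conjI ballI bexI[of _ "g N"]) (auto simp: p_def p'_def)
qed

text \<open>Elimination makes successors worse and never better. Hence a candidate of largest total
  successor rank, among finitely many permutations, admits no elimination, which means that it has
  no pair blocking in the sense of (T2).\<close>

lemma exists_stable_below:
  assumes "bistable s" "ordered s"
  shows "\<exists>t. stable t \<and> (\<forall>x\<in>A. r x (inv t x) \<le> r x (inv s x))"
proof -
  define Q where "Q = {t. bistable t \<and> ordered t \<and> (\<forall>x\<in>A. r x (inv t x) \<le> r x (inv s x))}"
  define w where "w t = (\<Sum>x\<in>A. r x (t x))" for t
  have "Q \<subseteq> {t. t permutes A}" by (auto simp: Q_def bistable_def)
  then have "finite Q" using finite_permutations[OF finite_agents] finite_subset by blast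
  moreover have "s \<in> Q" using assms by (simp add: Q_def)
  ultimately have "Max (w ` Q) \<in> w ` Q" "\<And>u. u \<in> Q \<Longrightarrow> w u \<le> Max (w ` Q)"
    by (intro Max_in Max_ge; auto)+
  then obtain t where t: "t \<in> Q" "\<And>u. u \<in> Q \<Longrightarrow> w u \<le> w t" by auto
  have "unblocked t"
  proof (rule ccontr)
    assume "\<not> unblocked t"
    then obtain i j where "i \<in> A" "j \<in> A" "r i j < r i (inv t i)" "r j i < r j (inv t j)"
      by (auto simp: unblocked_def not_le)
    then obtain u where u: "bistable u" "ordered u"
      "\<forall>x\<in>A. r x (inv u x) \<le> r x (inv t x)" "\<forall>x\<in>A. r x (t x) \<le> r x (u x)"
      "\<exists>x\<in>A. r x (t x) < r x (u x)"
      using eliminate_rotation[of t i j] t(1) by (auto simp: Q_def)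
    then have "u \<in> Q" using t(1) by (force simp: Q_def)
    moreover have "w t < w u"
      unfolding w_def using u finite_agents by (intro sum_strict_mono_ex1) auto
    ultimately show False using t(2) by force
  qed
  then show ?thesis using t(1) by (auto simp: Q_def stable_def bistable_def)
qed

text \<open>The hypotheses compare differently: pairs meeting \<open>S\<close> are judged by
  predecessors, pairs off \<open>S\<close> only by the bipartite condition. Rearranging the agents
  off \<open>S\<close> makes none of their predecessors worse, so it creates no blocking pair that
  meets \<open>S\<close>.\<close>

lemma glue_cycle:
  assumes m: "m permutes A" and S: "S \<subseteq> A" "m ` S = S" and ord: "ordered m"
    and S_unblocked: "\<And>c y. \<lbrakk>c \<in> S; y \<in> A; r c y < r c (inv m c)\<rbrakk> \<Longrightarrow> r y (inv m y) \<le> r y c"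
    and rest: "\<And>i j. \<lbrakk>i \<in> A - S; j \<in> A - S; r i j < r i (m i)\<rbrakk> \<Longrightarrow> r j (inv m j) \<le> r j i"
  shows "\<exists>t. stable t \<and> (\<forall>c\<in>S. t c = m c)"
proof -
  define R where "R = A - S"
  \<comment> \<open>Ranks are only required to be injective and largest at the agent itself, not
    consecutive, so the original ranks serve for the smaller set of agents.\<close>
  interpret R: preferences R r
    using finite_agents rank_inj self_last by unfold_locales (auto simp: R_def)
  note [simp] = permutes_inverses[OF m] permutes_in_image[OF m]
    permutes_in_image[OF permutes_inv[OF m]]
  have m_S [simp]: "m x \<in> S \<longleftrightarrow> x \<in> S" for x
    using S(2) permutes_inj[OF m] by (metis (no_types) imageE imageI injD)
  have inv_S [simp]: "inv m x \<in> S \<longleftrightarrow> x \<in> S" for x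
    using m_S[of "inv m x"] by simp
  define m' where "m' x = (if x \<in> R then m x else x)" for x
  have m': "m' permutes R"
  proof (rule bij_imp_permutes)
    show "bij_betw m' R R"
      by (rule bij_betw_byWitness[where f' = "inv m"]) (auto simp: m'_def R_def)
  qed (simp add: m'_def)
  have inv_m': "inv m' x = inv m x" if "x \<in> R" for x
  proof -
    have "inv m x \<in> R" using that by (auto simp: R_def)
    then show ?thesis
      by (metis m' m'_def permutes_inverses(1)[OF m] permutes_inverses(2))
  qed
  have "R.bistable m'" "R.ordered m'"
    using m' inv_m' rest[folded R_def] ord
    unfolding R.bistable_def R.ordered_def ordered_def by (auto simp: m'_def) (auto simp: R_def)
  from R.exists_stable_below[OF this] obtain t
    where t: "R.stable t" "\<And>x. x \<in> R \<Longrightarrow> r x (inv t x) \<le> r x (inv m x)"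
    using inv_m' by auto
  have pt: "t permutes R" using t(1) by (simp add: R.stable_def)
  note [simp] = permutes_inverses[OF pt] permutes_in_image[OF pt]
    permutes_in_image[OF permutes_inv[OF pt]]
  define u where "u x = (if x \<in> S then m x else t x)" for x
  define v where "v x = (if x \<in> S then inv m x else inv t x)" for x
  have t_S [simp]: "t x \<in> S \<longleftrightarrow> x \<in> S" "inv t x \<in> S \<longleftrightarrow> x \<in> S" for x
    using permutes_not_in[OF pt, of x] permutes_not_in[OF permutes_inv[OF pt], of x]
      permutes_in_image[OF pt, of x] permutes_in_image[OF permutes_inv[OF pt], of x]
    by (metis DiffD2 R_def)+
  have uv: "u (v x) = x" "v (u x) = x" for x by (auto simp: u_def v_def)
  have "inv u = v" by (rule inv_unique_comp) (auto simp: uv)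
  have t_A: "x \<in> A \<Longrightarrow> t x \<in> A" "x \<in> A \<Longrightarrow> inv t x \<in> A" for x
    using permutes_not_in[OF pt, of x] permutes_not_in[OF permutes_inv[OF pt], of x]
      permutes_in_image[OF pt, of x] permutes_in_image[OF permutes_inv[OF pt], of x]
    by (metis DiffD1 R_def)+
  have "u permutes A"
  proof (rule bij_imp_permutes)
    show "bij_betw u A A"
      by (rule bij_betw_byWitness[where f' = v]) (auto simp: uv u_def v_def t_A)
    show "u x = x" if "x \<notin> A" for x
      using that S(1) permutes_not_in[OF pt] by (auto simp: u_def R_def)
  qed
  moreover have "ordered u"
    unfolding ordered_def \<open>inv u = v\<close>
    using ord t(1) unfolding R.stable_def R.ordered_def ordered_def
    by (auto simp: u_def v_def) (auto simp: R_def)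
  moreover have "unblocked u"
    unfolding unblocked_def \<open>inv u = v\<close>
  proof (intro ballI impI)
    \<comment> \<open>The one fact needed for pairs that meet \<open>S\<close>: no agent likes its
      predecessor in \<open>u\<close> less than its predecessor in \<open>m\<close>.\<close>
    have le: "r x (v x) \<le> r x (inv m x)" if "x \<in> A" for x
      using t(2) that by (auto simp: v_def R_def)
    fix i j assume ij: "i \<in> A" "j \<in> A" "r i j < r i (v i)"
    consider "i \<in> S" | "i \<notin> S" "j \<in> S" | "i \<in> R" "j \<in> R" using ij by (auto simp: R_def)
    then show "r j (v j) \<le> r j i"
    proof cases
      case 1
      then show ?thesis using S_unblocked[of i j] le[of j] ij by (auto simp: v_def)
    next
      case 2
      show ?thesis
      proof (rule ccontr)
        assume "\<not> ?thesis"
        then have "r i (inv m i) \<le> r i j" using S_unblocked[of j i] 2 ij by (auto simp: v_def)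
        then show False using le[of i] ij by simp
      qed
    next
      case 3
      then show ?thesis using t(1) ij
        unfolding R.stable_def R.unblocked_def by (auto simp: v_def) (auto simp: R_def)
    qed
  qed
  ultimately have "stable u" by (simp add: stable_def)
  then show ?thesis by (auto simp: u_def)
qed

end

section \<open>Ranks\<close>

definition rank :: "('a \<Rightarrow> 'a list) \<Rightarrow> 'a \<Rightarrow> 'a \<Rightarrow> nat" where
  "rank P i x = length (takeWhile (\<lambda>y. y \<noteq> x) (P i @ [i]))"

lemma full_list:
  assumes "sr_instance A P" "i \<in> A"
  shows "distinct (P i @ [i])" "set (P i @ [i]) = A" "length (P i @ [i]) = card A"
proof -
  show *: "distinct (P i @ [i])" "set (P i @ [i]) = A"
    using assms by (auto simp: sr_instance_def)
  show "length (P i @ [i]) = card A" using distinct_card[OF *(1)] *(2) by simp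
qed

lemma rank_less_card:
  assumes "sr_instance A P" "i \<in> A" "x \<in> A"
  shows "rank P i x < card A"
proof (rule ccontr)
  assume "\<not> rank P i x < card A"
  then have "takeWhile (\<lambda>y. y \<noteq> x) (P i @ [i]) = P i @ [i]"
    using full_list(3)[OF assms(1,2)]
    by (metis rank_def not_less take_all takeWhile_eq_take)
  then show False using full_list(2)[OF assms(1,2)] assms(3) by (simp only: takeWhile_eq_all_conv) blast
qed

lemma nth_rank:
  assumes "sr_instance A P" "i \<in> A" "x \<in> A"
  shows "(P i @ [i]) ! rank P i x = x"
  using rank_less_card[OF assms] full_list(3)[OF assms(1,2)]
    nth_length_takeWhile[of "\<lambda>y. y \<noteq> x" "P i @ [i]"]
  by (auto simp: rank_def)

lemma rank_nth:
  assumes "sr_instance A P" "i \<in> A" "q < card A"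
  shows "(P i @ [i]) ! q \<in> A" "rank P i ((P i @ [i]) ! q) = q"
proof -
  show *: "(P i @ [i]) ! q \<in> A" using full_list[OF assms(1,2)] assms(3) nth_mem by metis
  show "rank P i ((P i @ [i]) ! q) = q"
    using nth_eq_iff_index_eq full_list[OF assms(1,2)] nth_rank[OF assms(1,2) *]
      rank_less_card[OF assms(1,2) *] assms(3) by metis
qed

lemma prefers_iff_rank:
  assumes "sr_instance A P" "i \<in> A" "x \<in> A" "y \<in> A"
  shows "prefers P i x y \<longleftrightarrow> rank P i x < rank P i y"
proof
  assume "prefers P i x y"
  then obtain p q where "p < q" "q < card A" "(P i @ [i]) ! p = x" "(P i @ [i]) ! q = y"
    using full_list(3)[OF assms(1,2)] unfolding prefers_def Let_def by metis
  then show "rank P i x < rank P i y"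
    using rank_nth(2)[OF assms(1,2)] by (metis order_less_trans)
next
  assume "rank P i x < rank P i y"
  then show "prefers P i x y"
    using nth_rank[OF assms(1,2)] rank_less_card[OF assms(1,2)] full_list(3)[OF assms(1,2)] assms(3,4)
    unfolding prefers_def Let_def by metis
qed

lemma preferences_rank:
  assumes "sr_instance A P"
  shows "preferences A (rank P)"
proof
  show "finite A" using assms by (simp add: sr_instance_def)
  show "x = y" if "i \<in> A" "x \<in> A" "y \<in> A" "rank P i x = rank P i y" for i x y
    using nth_rank[OF assms that(1)] that by metis
  show "rank P i x \<le> rank P i i" if "i \<in> A" "x \<in> A" for i x
  proof -
    have "card A - 1 = length (P i)" using full_list(3)[OF assms that(1)] by simp
    then have "(P i @ [i]) ! (card A - 1) = i" by simp
    then have "rank P i i = card A - 1"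
      using rank_nth(2)[OF assms that(1), of "card A - 1"] rank_less_card[OF assms that]
      by simp
    then show ?thesis using rank_less_card[OF assms that] by simp
  qed
qed

text \<open>Injective ranks merge "equal or preferred" into one comparison. The restriction to
  distinct agents in (T2) agrees with \<open>unblocked\<close>, which has none, because an agent
  ranks itself last and so never blocks with itself.\<close>

lemma stable_partition_iff:
  assumes "sr_instance A P"
  shows "stable_partition A P s \<longleftrightarrow> preferences.stable A (rank P) s"
proof (cases "s permutes A")
  case True
  interpret preferences A "rank P" by (rule preferences_rank) fact
  note [simp] = permutes_in_image[OF True] permutes_in_image[OF permutes_inv[OF True]]
  have "(\<forall>i\<in>A. s i = inv s i \<or> prefers P i (s i) (inv s i)) \<longleftrightarrow> ordered s"
    unfolding ordered_def
    using rank_inj by (auto simp: prefers_iff_rank[OF assms] le_less)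
  moreover have "\<not> rank P i i < rank P i (inv s i)" if "i \<in> A" for i
    using self_last that by (simp add: not_less)
  then have "\<not> (\<exists>i\<in>A. \<exists>j\<in>A. i \<noteq> j \<and> prefers P i j (inv s i) \<and> prefers P j i (inv s j))
    \<longleftrightarrow> unblocked s"
    unfolding unblocked_def
    by (simp add: prefers_iff_rank[OF assms] not_less[symmetric]) metis
  ultimately show ?thesis using True by (simp add: stable_partition_def stable_def)
next
  case False
  then show ?thesis
    by (simp add: stable_partition_def preferences.stable_def[OF preferences_rank[OF assms]])
qed

section \<open>Cycles as lists, and uniqueness of the completion\<close>

lemma cycle_funpow:
  assumes "is_cycle_of s C"
  shows "(s ^^ k) (C ! 0) = C ! (k mod length C)"
proof (induction k)
  case (Suc k)
  have "k mod length C < length C" using assms by (simp add: is_cycle_of_def)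
  then have "s (C ! (k mod length C)) = C ! (Suc (k mod length C) mod length C)"
    using assms by (simp add: is_cycle_of_def)
  then show ?case using Suc by (simp add: mod_Suc_eq)
qed simp

text \<open>The length of a cycle is its least period: a longer list would repeat its first agent at
  the index where the shorter list closes.\<close>

lemma cycle_eqI:
  assumes C: "is_cycle_of s C" and D: "is_cycle_of t D"
    and eq: "\<And>k. (s ^^ k) (C ! 0) = (t ^^ k) (D ! 0)"
  shows "C = D"
proof -
  have *: "length B \<le> length C" if "is_cycle_of s C" "is_cycle_of t B"
    "\<And>k. (s ^^ k) (C ! 0) = (t ^^ k) (B ! 0)" for s t and B C :: "'a list"
  proof (rule ccontr)
    assume less: "\<not> length B \<le> length C"
    then have "B ! length C = B ! 0"
      using cycle_funpow[OF that(1), of "length C"] cycle_funpow[OF that(2), of "length C"]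
        that(3)[of "length C"] that(3)[of 0] by simp
    moreover have "0 < length C" "distinct B" using that by (auto simp: is_cycle_of_def)
    ultimately show False using less nth_eq_iff_index_eq[of B "length C" 0] by fastforce
  qed
  have len: "length C = length D" using *[OF C D eq] *[OF D C] eq by (metis le_antisym)
  show ?thesis
  proof (rule nth_equalityI[OF len])
    fix k assume "k < length C"
    then show "C ! k = D ! k"
      using cycle_funpow[OF C, of k] cycle_funpow[OF D, of k] eq[of k] len by simp
  qed
qed

lemma cycle_funpow_length:
  assumes "is_cycle_of s C" "x \<in> set C"
  shows "(s ^^ length C) x = x"
proof -
  obtain k where "k < length C" "x = C ! k" using assms(2) by (metis in_set_conv_nth)
  then have "x = (s ^^ k) (C ! 0)" using cycle_funpow[OF assms(1), of k] by simp
  then have "(s ^^ length C) x = (s ^^ (length C + k)) (C ! 0)" by (simp add: funpow_add)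
  then show ?thesis using cycle_funpow[OF assms(1)] \<open>k < length C\<close> \<open>x = C ! k\<close> by simp
qed

text \<open>This separates successor from predecessor on the cycle, which turns the weak preference
  in (T1) into a strict one.\<close>

lemma long_cycle:
  assumes C: "is_cycle_of s C" and "length C > 2" and x: "x \<in> set C"
  shows "s (s x) \<noteq> x"
proof -
  obtain k where k: "k < length C" "x = C ! k" using x by (metis in_set_conv_nth)
  have s: "s (C ! j) = C ! (Suc j mod length C)" if "j < length C" for j
    using C that by (simp add: is_cycle_of_def)
  have pos: "0 < length C" using assms(2) by linarith
  have "s (s x) = C ! (Suc (Suc k mod length C) mod length C)"
    using s k pos by simp
  also have "Suc (Suc k mod length C) mod length C = (k + 2) mod length C"
    by (simp add: mod_Suc_eq)
  finally have "s (s x) = C ! ((k + 2) mod length C)" .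
  moreover have "(k + 2) mod length C \<noteq> k"
    using k(1) assms(2)
    by (cases "k + 2 < length C") (use mod_less_divisor[OF pos, of "k + 2"] in \<open>auto simp: mod_if\<close>)
  ultimately show ?thesis
    using k C pos nth_eq_iff_index_eq[of C] by (auto simp: is_cycle_of_def)
qed

text \<open>The partition is kept as an argument, unlike in \<open>completes\<close>, because the
  arguments follow its inverse.\<close>

definition completion :: "'a set \<Rightarrow> ('a \<Rightarrow> 'a list) \<Rightarrow> 'a \<Rightarrow> 'a \<Rightarrow> ('a \<Rightarrow> 'a) \<Rightarrow> 'a list \<Rightarrow> bool" where
  "completion A P a b s C \<longleftrightarrow> preferences.stable A (rank P) s \<and> is_cycle_of s C \<and> set C \<subseteq> A \<and>
     even (length C) \<and> 2 < length C \<and> C ! 0 = a \<and> C ! 1 = b"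

lemma completes_iff:
  assumes "sr_instance A P"
  shows "completes A P a b C \<longleftrightarrow> (\<exists>s. completion A P a b s C)"
proof -
  have "(\<exists>D. C = a # b # D) \<longleftrightarrow> C ! 0 = a \<and> C ! 1 = b" if "2 < length C"
    using that by (cases C; cases "tl C") auto
  then show ?thesis
    using stable_partition_iff[OF assms]
    by (auto simp: completes_def completion_def stable_even_cycle_def)
qed

lemma completion_start:
  assumes "completion A P a b s C"
  shows "s a = b" "s b \<noteq> a" "a \<in> A" "b \<in> A"
proof -
  have C: "is_cycle_of s C" "2 < length C" "C ! 0 = a" "C ! 1 = b" "set C \<subseteq> A"
    using assms by (auto simp: completion_def)
  have "0 < length C" using C by linarith
  then have "s a = C ! (Suc 0 mod length C)" using C(1,3) unfolding is_cycle_of_def by metis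
  then show *: "s a = b" using C by simp
  have "C ! 0 \<in> set C" "C ! 1 \<in> set C" using C(2) by (intro nth_mem; linarith)+
  then show "s b \<noteq> a" "a \<in> A" "b \<in> A" using C long_cycle[OF C(1,2), of a] * by auto
qed

text \<open>Agreement spreads backwards: equal successors at \<open>x\<close> give equal
  predecessors by \<open>predecessor_unique\<close>, and that predecessor again has the same
  successor \<open>x\<close> in both partitions.\<close>

lemma completion_unique:
  assumes inst: "sr_instance A P"
    and C: "completion A P a b s C" and D: "completion A P a b t D"
  shows "C = D"
proof -
  interpret preferences A "rank P" by (rule preferences_rank) fact
  have s: "stable s" "is_cycle_of s C" "2 < length C" "set C \<subseteq> A" "C ! 0 = a"
    and t: "stable t" "is_cycle_of t D" "2 < length D" "set D \<subseteq> A" "D ! 0 = a"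
    using C D by (auto simp: completion_def)
  have ps: "s permutes A" and pt: "t permutes A" using s t by (auto simp: stable_def)
  note [simp] = permutes_inverses[OF ps] permutes_inverses[OF pt]
  have backwards: "(inv s ^^ k) a = (inv t ^^ k) a \<and> (inv s ^^ k) a \<in> set C \<inter> set D \<and>
      s ((inv s ^^ k) a) = t ((inv s ^^ k) a)" for k
  proof (induction k)
    case 0
    have "C ! 0 \<in> set C" "D ! 0 \<in> set D" using s(3) t(3) by (intro nth_mem; linarith)+
    then have "a \<in> set C" "a \<in> set D" using s(5) t(5) by auto
    then show ?case using completion_start(1)[OF C] completion_start(1)[OF D] by simp
  next
    case (Suc k)
    define x where "x = (inv s ^^ k) a"
    have x: "x = (inv t ^^ k) a" "x \<in> set C" "x \<in> set D" "s x = t x"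
      using Suc by (auto simp: x_def)
    have "s x \<noteq> inv s x" "t x \<noteq> inv t x"
      using long_cycle[OF s(2,3) x(2)] long_cycle[OF t(2,3) x(3)]
        permutes_inverses(1)[OF ps, of x] permutes_inverses(1)[OF pt, of x] by metis+
    then have eq: "inv s x = inv t x"
      using predecessor_unique[OF s(1) t(1)] x s(4) by blast
    have pred: "inv u x \<in> set E" if "is_cycle_of u E" "x \<in> set E" "u permutes A" for u E
    proof -
      have "(u ^^ length E) x = x" using cycle_funpow_length that by metis
      moreover have "length E \<noteq> 0" using that by (auto simp: is_cycle_of_def)
      then obtain l where l: "length E = Suc l" by (cases "length E") auto
      ultimately have "inv u x = (u ^^ l) x"
        using permutes_inverses(2)[OF that(3)] by (metis comp_apply funpow.simps(2))
      moreover have "(u ^^ l) x \<in> set E"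
      proof (induction l)
        case (Suc l)
        define y where "y = (u ^^ l) x"
        obtain j where "j < length E" "y = E ! j"
          using Suc by (metis in_set_conv_nth y_def)
        then have "u y = E ! (Suc j mod length E)" "Suc j mod length E < length E"
          using that(1) by (auto simp: is_cycle_of_def)
        then show ?case by (simp add: y_def[symmetric])
      qed (use that in simp)
      ultimately show ?thesis by simp
    qed
    show ?case
      using eq pred[OF s(2) x(2) ps] pred[OF t(2) x(3) pt] x(1)
      by (simp add: x_def[symmetric]) (metis permutes_inverses(1)[OF ps] permutes_inverses(1)[OF pt])
  qed
  have "(s ^^ k) (C ! 0) = (t ^^ k) (D ! 0)" for k
  proof (induction k)
    case (Suc k)
    define x where "x = (s ^^ k) a"
    \<comment> \<open>On a cycle of length \<open>length C\<close>, \<open>k\<close> steps forward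
      are \<open>k * (length C - 1)\<close> steps back, so backward agreement covers the whole
      cycle.\<close>
    define N where "N = k * (length C - 1)"
    have "x = (inv s ^^ N) a"
    proof -
      have "(s ^^ (k * length C)) a = a"
        using cycle_funpow[OF s(2), of "k * length C"] s(5) by simp
      moreover have "k * length C = N + k" using s(3) by (simp add: N_def algebra_simps)
      ultimately have "(s ^^ N) x = a" by (simp add: funpow_add x_def)
      moreover have "(inv s ^^ N) ((s ^^ N) x) = x" for x
        using inv_f_f[of "s ^^ N"] by (metis bij_is_inj inj_fn inv_fn permutes_bij ps inv_f_f)
      ultimately show ?thesis by metis
    qed
    then have "s x = t x" using backwards by metis
    then show ?case using Suc s(5) t(5) by (simp add: x_def)
  qed (use s t in simp)
  then show ?thesis by (rule cycle_eqI[OF s(2) t(2)])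
qed

section \<open>Deferred acceptance\<close>

locale numbered_instance =
  fixes n :: nat and P :: "nat \<Rightarrow> nat list"
  assumes inst: "sr_instance {..<n} P"
begin

abbreviation r :: "nat \<Rightarrow> nat \<Rightarrow> nat" where "r \<equiv> rank P"

definition choice :: "nat \<Rightarrow> nat \<Rightarrow> nat" where "choice i q = (P i @ [i]) ! q"

sublocale preferences "{..<n}" r by (rule preferences_rank) (rule inst)

lemma rank_less_n [simp]: "i < n \<Longrightarrow> x < n \<Longrightarrow> r i x < n"
  using rank_less_card[OF inst, of i x] by simp

lemma choice_rank [simp]: "i < n \<Longrightarrow> x < n \<Longrightarrow> choice i (r i x) = x"
  using nth_rank[OF inst, of i x] by (simp add: choice_def)

lemma choice_less [simp]: "i < n \<Longrightarrow> q < n \<Longrightarrow> choice i q < n"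
  using rank_nth(1)[OF inst, of i q] by (simp add: choice_def)

lemma rank_choice [simp]: "i < n \<Longrightarrow> q < n \<Longrightarrow> r i (choice i q) = q"
  using rank_nth(2)[OF inst, of i q] by (simp add: choice_def)

lemma rank_eq_iff: "\<lbrakk>i < n; x < n; y < n\<rbrakk> \<Longrightarrow> r i x = r i y \<longleftrightarrow> x = y"
  using rank_inj[of i x y] by auto

lemma bistableD:
  "\<lbrakk>bistable m; i < n; j < n; r i j < r i (m i)\<rbrakk> \<Longrightarrow> r j (inv m j) \<le> r j i"
  by (auto simp: bistable_def)

text \<open>
  Agent \<open>i\<close> proposes from position \<open>p0 i\<close> of its list on, and agent \<open>y\<close> only accepts
  proposals from agents of rank less than \<open>t0 y\<close>.
\<close>

definition feasible :: "(nat \<Rightarrow> nat) \<Rightarrow> (nat \<Rightarrow> nat) \<Rightarrow> (nat \<Rightarrow> nat) \<Rightarrow> bool" where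
  "feasible p0 t0 m \<longleftrightarrow> bistable m \<and> (\<forall>i<n. p0 i \<le> r i (m i) \<and> r i (inv m i) < t0 i)"

text \<open>
  \<open>p i\<close> is the current position of proposer \<open>i\<close>, \<open>h y\<close> the proposer held by \<open>y\<close>
  (\<open>n\<close> if there is none), and \<open>t y\<close> the rank below which \<open>y\<close> accepts. The proposers up to
  \<open>k\<close> other than the current proposer \<open>c\<close> are held.
\<close>

definition da_inv where
  "da_inv p0 t0 p h t k c \<longleftrightarrow>
     k \<le> n \<and> c \<le> k \<and> (k = n \<longrightarrow> c = n) \<and>
     (\<forall>i<n. p0 i \<le> p i \<and> p i \<le> n) \<and>
     (\<forall>y<n. h y \<le> n \<and> (h y = n \<longrightarrow> t y = t0 y) \<and>
        (h y < n \<longrightarrow> h y \<le> k \<and> h y \<noteq> c \<and> p (h y) = r (h y) y \<and> t y = r y (h y) \<and> t y < t0 y)) \<and>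
     (\<forall>i\<le>k. i \<noteq> c \<longrightarrow> (\<exists>y<n. h y = i)) \<and>
     (\<forall>i<n. \<forall>q. p0 i \<le> q \<and> q < p i \<longrightarrow> t (choice i q) \<le> r (choice i q) i) \<and>
     (\<forall>m. feasible p0 t0 m \<longrightarrow> (\<forall>i<n. p i \<le> r i (m i)))"

lemma da_invI:
  assumes "k \<le> n" "c \<le> k" "k = n \<Longrightarrow> c = n"
    and "\<And>i. i < n \<Longrightarrow> p0 i \<le> p i \<and> p i \<le> n"
    and "\<And>y. y < n \<Longrightarrow> h y \<le> n" "\<And>y. \<lbrakk>y < n; h y = n\<rbrakk> \<Longrightarrow> t y = t0 y"
    and "\<And>y. \<lbrakk>y < n; h y < n\<rbrakk> \<Longrightarrow> h y \<le> k \<and> h y \<noteq> c \<and> p (h y) = r (h y) y \<and> t y = r y (h y) \<and> t y < t0 y"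
    and "\<And>i. \<lbrakk>i \<le> k; i \<noteq> c\<rbrakk> \<Longrightarrow> \<exists>y<n. h y = i"
    and "\<And>i q. \<lbrakk>i < n; p0 i \<le> q; q < p i\<rbrakk> \<Longrightarrow> t (choice i q) \<le> r (choice i q) i"
    and "\<And>m i. \<lbrakk>feasible p0 t0 m; i < n\<rbrakk> \<Longrightarrow> p i \<le> r i (m i)"
  shows "da_inv p0 t0 p h t k c"
  using assms unfolding da_inv_def by blast

lemma da_invD:
  assumes "da_inv p0 t0 p h t k c"
  shows "k \<le> n" "c \<le> k" "k = n \<Longrightarrow> c = n"
    and "\<And>i. i < n \<Longrightarrow> p0 i \<le> p i" "\<And>i. i < n \<Longrightarrow> p i \<le> n"
    and "\<And>y. y < n \<Longrightarrow> h y \<le> n" "\<And>y. \<lbrakk>y < n; h y = n\<rbrakk> \<Longrightarrow> t y = t0 y"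
    and "\<And>y. \<lbrakk>y < n; h y < n\<rbrakk> \<Longrightarrow> h y \<le> k" "\<And>y. \<lbrakk>y < n; h y < n\<rbrakk> \<Longrightarrow> h y \<noteq> c"
    and "\<And>y. \<lbrakk>y < n; h y < n\<rbrakk> \<Longrightarrow> p (h y) = r (h y) y"
    and "\<And>y. \<lbrakk>y < n; h y < n\<rbrakk> \<Longrightarrow> t y = r y (h y)"
    and "\<And>y. \<lbrakk>y < n; h y < n\<rbrakk> \<Longrightarrow> t y < t0 y"
    and "\<And>i. \<lbrakk>i \<le> k; i \<noteq> c\<rbrakk> \<Longrightarrow> \<exists>y<n. h y = i"
    and "\<And>i q. \<lbrakk>i < n; p0 i \<le> q; q < p i\<rbrakk> \<Longrightarrow> t (choice i q) \<le> r (choice i q) i"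
    and "\<And>m i. \<lbrakk>feasible p0 t0 m; i < n\<rbrakk> \<Longrightarrow> p i \<le> r i (m i)"
  using assms unfolding da_inv_def by blast+

text \<open>Blocking is excluded only for positions from \<open>p0 i\<close> on, since earlier
  entries never receive a proposal from \<open>i\<close>. Whether \<open>m\<close> is bistable thus
  depends on \<open>p0\<close> and \<open>t0\<close>. The last clause is proposer-optimality against
  all feasible matchings.\<close>

definition da_result where
  "da_result p0 t0 p h m \<longleftrightarrow>
     m permutes {..<n} \<and>
     (\<forall>i<n. p i = r i (m i) \<and> h i = inv m i \<and> p0 i \<le> r i (m i) \<and> r i (inv m i) < t0 i) \<and>
     (\<forall>i<n. \<forall>j<n. p0 i \<le> r i j \<and> r i j < r i (m i) \<longrightarrow> r j (inv m j) \<le> r j i) \<and>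
     (\<forall>m'. feasible p0 t0 m' \<longrightarrow> (\<forall>i<n. r i (m i) \<le> r i (m' i)))"

lemma feasible_range: "feasible p0 t0 m \<Longrightarrow> i < n \<Longrightarrow> m i < n" "feasible p0 t0 m \<Longrightarrow> i < n \<Longrightarrow> inv m i < n"
  using permutes_in_image[of m "{..<n}" i] permutes_in_image[OF permutes_inv, of m "{..<n}" i]
  by (auto simp: feasible_def bistable_def)

lemma da_init:
  assumes "n > 0" "\<And>i. i < n \<Longrightarrow> p0 i \<le> n \<and> h i = n"
  shows "da_inv p0 t0 p0 h t0 0 0"
  using assms by (intro da_invI) (auto simp: feasible_def)

text \<open>The invariant places the partner of \<open>c\<close> in any feasible matching at
  position \<open>p c\<close> or later, and no agent has rank \<open>n\<close>.\<close>

lemma da_fail: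
  assumes "da_inv p0 t0 p h t k c" "k < n" "p c = n"
  shows "\<not> feasible p0 t0 m"
proof
  assume m: "feasible p0 t0 m"
  have "c < n" using assms by (auto simp: da_inv_def)
  then have "n \<le> r c (m c)" using assms m by (auto simp: da_inv_def)
  then show False using rank_less_n[OF \<open>c < n\<close> feasible_range(1)[OF m \<open>c < n\<close>]] by simp
qed

text \<open>Proposers enter in numerical order. Since nobody is displaced, the next one enters and
  \<open>Suc k\<close> becomes both the bound and the current proposer; at \<open>Suc k = n\<close>
  the value \<open>n\<close> stands for "no proposer left".\<close>

lemma da_accept_free:
  assumes inv: "da_inv p0 t0 p h t k c" and k: "k < n" and pc: "p c < n"
    and y: "y = choice c (p c)" and acc: "r y c < t y" and free: "h y = n"
  shows "da_inv p0 t0 p (h(y := c)) (t(y := r y c)) (Suc k) (Suc k)"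
proof -
  have c: "c < n" "c \<le> k" using inv k by (auto simp: da_inv_def)
  have yn: "y < n" using y c pc by simp
  have t0: "t y = t0 y" using inv yn free by (auto simp: da_inv_def)
  have "\<exists>z<n. (h(y := c)) z = i" if i: "i \<le> k" for i
  proof (cases "i = c")
    case True
    then show ?thesis using yn by auto
  next
    case False
    then obtain z where z: "z < n" "h z = i" using inv i by (auto simp: da_inv_def)
    then have "z \<noteq> y" using free i k by auto
    then show ?thesis using z by auto
  qed
  then have held: "\<exists>z<n. (h(y := c)) z = i" if "i \<le> Suc k" "i \<noteq> Suc k" for i
    using that by simp
  have t_le: "(t(y := r y c)) z \<le> t z" for z using acc by auto
  note D = da_invD[OF inv]
  show ?thesis
  proof (rule da_invI)
    show "(h(y := c)) z \<le> Suc k \<and> (h(y := c)) z \<noteq> Suc k \<and>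
        p ((h(y := c)) z) = r ((h(y := c)) z) z \<and>
        (t(y := r y c)) z = r z ((h(y := c)) z) \<and> (t(y := r y c)) z < t0 z"
      if "z < n" "(h(y := c)) z < n" for z
      using that D(8-12)[of z] c pc acc y t0 by auto
    show "(t(y := r y c)) (choice i q) \<le> r (choice i q) i" if "i < n" "p0 i \<le> q" "q < p i" for i q
      using D(14)[OF that] t_le le_trans by blast
    show "\<exists>z<n. (h(y := c)) z = i" if "i \<le> Suc k" "i \<noteq> Suc k" for i
      using held that .
  qed (use k c D in auto)
qed

lemma da_accept_swap:
  assumes inv: "da_inv p0 t0 p h t k c" and k: "k < n" and pc: "p c < n"
    and y: "y = choice c (p c)" and acc: "r y c < t y" and d: "h y = d" "d < n"
  shows "da_inv p0 t0 (p(d := Suc (p d))) (h(y := c)) (t(y := r y c)) k d"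
proof -
  have c: "c < n" "c \<le> k" using inv k by (auto simp: da_inv_def)
  have yn: "y < n" using y c pc by simp
  have pcy: "p c = r c y" using y c pc by simp
  note D = da_invD[OF inv]
  have hold: "d \<le> k" "d \<noteq> c" "p d = r d y" "t y = r y d" "t y < t0 y"
    using D(8-12)[OF yn] d by auto
  have only: "z = y" if "z < n" "h z = d" for z
    using D(10)[of z] that yn d hold(3) rank_eq_iff[of d z y] by auto
  have held: "\<exists>z<n. (h(y := c)) z = i" if i: "i \<le> k" "i \<noteq> d" for i
  proof (cases "i = c")
    case True
    then show ?thesis using yn by auto
  next
    case False
    then obtain z where z: "z < n" "h z = i" using inv i by (auto simp: da_inv_def)
    then have "z \<noteq> y" using d i by auto
    then show ?thesis using z by auto
  qed
  have t_le: "(t(y := r y c)) z \<le> t z" for z using acc by auto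
  have rejected: "(t(y := r y c)) (choice i q) \<le> r (choice i q) i"
    if i: "i < n" "p0 i \<le> q" "q < (p(d := Suc (p d))) i" for i q
  proof (cases "q < p i")
    case True
    then show ?thesis using D(14)[OF i(1,2)] t_le[of "choice i q"] by (meson le_trans)
  next
    case False
    then have "i = d" "q = r d y" using i hold(3) by (auto split: if_splits)
    then show ?thesis using acc hold(4) d yn by simp
  qed
  have best: "(p(d := Suc (p d))) i \<le> r i (m i)" if m: "feasible p0 t0 m" and i: "i < n" for m i
  proof (cases "i = d")
    case True
    note le = D(15)[OF m]
    have pm: "m permutes {..<n}" using m by (simp add: feasible_def bistable_def)
    \<comment> \<open>If \<open>d\<close> had \<open>y\<close> in a feasible matching, then
      \<open>c\<close>, whom \<open>y\<close> prefers to \<open>d\<close>, could not prefer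
      \<open>y\<close> to its own partner. But \<open>c\<close> has no feasible partner before
      \<open>y\<close>, so its partner would be \<open>y\<close> as well.\<close>
    have "m d \<noteq> y"
    proof
      assume md: "m d = y"
      then have "inv m y = d" using permutes_inverses(2)[OF pm] by auto
      then have "\<not> r y (inv m y) \<le> r y c" using acc hold by simp
      then have "\<not> r c y < r c (m c)" using m c yn bistableD[of m c y] by (auto simp: feasible_def)
      then have "m c = y"
        using le[OF c(1)] pcy rank_eq_iff[OF c(1) feasible_range(1)[OF m c(1)] yn] by linarith
      then show False using md permutes_inj[OF pm] hold(2) by (auto dest: injD)
    qed
    then show ?thesis
      using le[OF d(2)] hold(3) rank_eq_iff[OF d(2) feasible_range(1)[OF m d(2)] yn]
      by (simp only: True fun_upd_same) (metis Suc_leI le_neq_implies_less)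
  next
    case False
    then show ?thesis using D(15)[OF m i] by simp
  qed
  have "p d < n" using hold(3) d yn by simp
  show ?thesis
  proof (rule da_invI)
    show "(h(y := c)) z \<le> k \<and> (h(y := c)) z \<noteq> d \<and>
        (p(d := Suc (p d))) ((h(y := c)) z) = r ((h(y := c)) z) z \<and>
        (t(y := r y c)) z = r z ((h(y := c)) z) \<and> (t(y := r y c)) z < t0 z"
      if "z < n" "(h(y := c)) z < n" for z
      using that D(8-12)[of z] only[of z] c hold acc pcy by auto
    show "p0 i \<le> (p(d := Suc (p d))) i \<and> (p(d := Suc (p d))) i \<le> n" if "i < n" for i
      using that D(4,5)[of i] \<open>p d < n\<close> by auto
    show "(h(y := c)) z \<le> n" if "z < n" for z using D(6)[OF that] c by auto
    show "(t(y := r y c)) z = t0 z" if "z < n" "(h(y := c)) z = n" for z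
      using that D(7)[of z] c by (auto split: if_splits)
  qed (use k hold(1) held rejected best in \<open>simp_all del: fun_upd_apply\<close>)
qed

lemma da_reject:
  assumes inv: "da_inv p0 t0 p h t k c" and k: "k < n" and pc: "p c < n"
    and y: "y = choice c (p c)" and rej: "\<not> r y c < t y"
  shows "da_inv p0 t0 (p(c := Suc (p c))) h t k c"
proof -
  have c: "c < n" "c \<le> k" using inv k by (auto simp: da_inv_def)
  have yn: "y < n" using y c pc by simp
  have pcy: "p c = r c y" using y c pc by simp
  note D = da_invD[OF inv]
  have rejected: "t (choice i q) \<le> r (choice i q) i"
    if i: "i < n" "p0 i \<le> q" "q < (p(c := Suc (p c))) i" for i q
    using D(14)[OF i(1,2)] i(3) rej y by (cases "q < p i") (auto simp: less_Suc_eq split: if_splits)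
  have best: "(p(c := Suc (p c))) i \<le> r i (m i)" if m: "feasible p0 t0 m" and i: "i < n" for m i
  proof (cases "i = c")
    case True
    note le = D(15)[OF m]
    have pm: "m permutes {..<n}" using m by (simp add: feasible_def bistable_def)
    have "m c \<noteq> y"
    proof
      assume mc: "m c = y"
      then have invy: "inv m y = c" using permutes_inverses(2)[OF pm] by auto
      \<comment> \<open>Feasibility keeps \<open>c\<close> within the initial limit of
        \<open>y\<close>, so the rejection must be due to a proposer that \<open>y\<close> already
        holds. The argument used for a displaced proposer then applies to that one.\<close>
      have "r y (inv m y) < t0 y" using m yn by (auto simp: feasible_def)
      then have "h y \<noteq> n" using D(7)[OF yn] rej invy by auto
      then have h: "h y < n" "h y \<noteq> c" "p (h y) = r (h y) y" "t y = r y (h y)"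
        using D(6,9-11)[OF yn] by auto
      have "r y (h y) < r y c" using rej h rank_eq_iff[OF yn h(1) c(1)] by force
      then have "\<not> r (h y) y < r (h y) (m (h y))"
        using m bistableD[of m "h y" y] h(1) yn invy by (auto simp: feasible_def)
      then have "m (h y) = y"
        using le[OF h(1)] h(3) rank_eq_iff[OF h(1) feasible_range(1)[OF m h(1)] yn] by linarith
      then show False using mc permutes_inj[OF pm] h(2) by (auto dest: injD)
    qed
    then show ?thesis
      using le[OF c(1)] pcy rank_eq_iff[OF c(1) feasible_range(1)[OF m c(1)] yn]
      by (simp only: True fun_upd_same) (metis Suc_leI le_neq_implies_less)
  next
    case False
    then show ?thesis using D(15)[OF m i] by simp
  qed
  show ?thesis
  proof (rule da_invI)
    show "h z \<le> k \<and> h z \<noteq> c \<and> (p(c := Suc (p c))) (h z) = r (h z) z \<and>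
        t z = r z (h z) \<and> t z < t0 z" if "z < n" "h z < n" for z
      using D(8-12)[OF that] by auto
    show "p0 i \<le> (p(c := Suc (p c))) i \<and> (p(c := Suc (p c))) i \<le> n" if "i < n" for i
      using that D(4,5)[of i] pc by auto
  qed (use D(1-3,6,7,13) rejected best in \<open>simp_all del: fun_upd_apply\<close>)
qed

text \<open>With no current proposer left, every agent is held by somebody, so \<open>h\<close> is
  onto and by finiteness a bijection between receivers and proposers.\<close>

lemma da_done:
  assumes inv: "da_inv p0 t0 p h t n c"
  shows "\<exists>m. da_result p0 t0 p h m"
proof -
  have cn: "c = n" using inv by (auto simp: da_inv_def)
  have "{..<n} \<subseteq> h ` {..<n}"
  proof
    fix i assume "i \<in> {..<n}"
    then have "i \<le> n" "i \<noteq> c" using cn by auto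
    then show "i \<in> h ` {..<n}" using da_invD(13)[OF inv, of i] by blast
  qed
  then have h_eq: "h ` {..<n} = {..<n}"
    by (metis card_image_le card_seteq finite_imageI finite_lessThan)
  then have h_n: "h y < n" if "y < n" for y using that by blast
  have p_h: "p (h y) = r (h y) y" "t y = r y (h y)" "t y < t0 y" if "y < n" for y
    using da_invD(10-12)[OF inv that h_n[OF that]] by auto
  have "bij_betw h {..<n} {..<n}"
    using h_eq by (simp add: bij_betw_def eq_card_imp_inj_on)
  \<comment> \<open>The array \<open>h\<close> is arbitrary beyond \<open>n\<close>; a permutation
    must be the identity there.\<close>
  define g where "g y = (if y < n then h y else y)" for y
  have g: "g permutes {..<n}"
  proof (rule bij_imp_permutes)
    show "bij_betw g {..<n} {..<n}"
      using \<open>bij_betw h {..<n} {..<n}\<close> bij_betw_cong[of "{..<n}" g h] by (simp add: g_def)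
  qed (simp add: g_def)
  define m where "m = inv g"
  have pm: "m permutes {..<n}" and inv_m: "inv m = g"
    using permutes_inv[OF g] permutes_inv_inv[OF g] by (auto simp: m_def)
  have m_n: "m i < n" if "i < n" for i using permutes_in_image[OF pm, of i] that by simp
  have h_m: "h (m i) = i" if "i < n" for i
    using permutes_inverses(1)[OF g, of i] m_n[OF that] by (simp add: m_def g_def)
  have p_m: "p i = r i (m i)" if "i < n" for i using p_h(1)[OF m_n[OF that]] h_m[OF that] by simp
  have "r j (inv m j) \<le> r j i" if "i < n" "j < n" "p0 i \<le> r i j" "r i j < r i (m i)" for i j
  proof -
    have "t (choice i (r i j)) \<le> r (choice i (r i j)) i"
      using da_invD(14)[OF inv, of i "r i j"] that p_m[of i] by simp
    then show ?thesis using that p_h(2)[of j] by (simp add: inv_m g_def)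
  qed
  moreover have "p0 i \<le> r i (m i)" if "i < n" for i
    using da_invD(4)[OF inv that] p_m[OF that] by simp
  moreover have "r i (m i) \<le> r i (m' i)" if "feasible p0 t0 m'" "i < n" for m' i
    using da_invD(15)[OF inv that] p_m[OF that(2)] by simp
  ultimately have "da_result p0 t0 p h m"
    using pm p_m p_h(2,3) unfolding da_result_def inv_m by (auto simp: g_def)
  then show ?thesis by blast
qed

section \<open>Finding the candidate\<close>

definition search_start :: "nat \<Rightarrow> nat \<Rightarrow> nat \<Rightarrow> nat" where
  "search_start x y i = (if i = x then Suc (r x y) else 0)"

text \<open>This compensates for the proposals that \<open>x\<close> skips: an agent
  \<open>z\<close> at or above \<open>y\<close> in the list of \<open>x\<close> accepts only
  proposers it prefers to \<open>x\<close>, so \<open>x\<close> and \<open>z\<close> cannot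
  block.\<close>

definition search_limit :: "nat \<Rightarrow> nat \<Rightarrow> nat \<Rightarrow> nat" where
  "search_limit x y z = (if r x z \<le> r x y then r z x else n)"

text \<open>The statement ranges over all stable partitions with the edge from \<open>x\<close> to
  \<open>y\<close> on a cycle longer than 2, because the run has to serve every one of them without
  knowing any.\<close>

definition traces :: "nat \<Rightarrow> nat \<Rightarrow> (nat \<Rightarrow> nat) \<Rightarrow> bool" where
  "traces x y m \<longleftrightarrow> (\<forall>s k. stable s \<longrightarrow> s x = y \<longrightarrow> s y \<noteq> x \<longrightarrow>
     m ((inv s ^^ (2 * k)) x) = inv s ((inv s ^^ (2 * k)) x))"

lemma stable_range:
  assumes "stable s" "i < n"
  shows "s i < n" "inv s i < n"
  using assms permutes_in_image[of s "{..<n}" i] permutes_in_image[OF permutes_inv, of s "{..<n}" i]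
  by (auto simp: stable_def)

text \<open>An agent \<open>z\<close> at or above \<open>y\<close> is better for \<open>x\<close>
  than its predecessor, so by (T2) \<open>z\<close> likes its own predecessor at least as much as
  \<open>x\<close>. Under \<open>inv s\<close> the receiver \<open>z\<close> gets its successor,
  which is no worse and differs from \<open>x\<close>; so it respects the strict limit.\<close>

lemma search_feasible:
  assumes s: "stable s" and xy: "x < n" "y < n" "s x = y" "s y \<noteq> x"
  shows "feasible (search_start x y) (search_limit x y) (inv s)"
  unfolding feasible_def
proof (intro conjI allI impI)
  have ps: "s permutes {..<n}" using s by (simp add: stable_def)
  have invs [simp]: "inv (inv s) = s" by (rule permutes_inv_inv) (rule ps)
  note range = stable_range[OF s]
  show "bistable (inv s)" by (rule stable_imp_bistable_inv) (rule s)
  have pred: "inv s x \<noteq> y" using xy permutes_inverses(1)[OF ps, of x] by auto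
  then have less: "r x y < r x (inv s x)"
    using s xy range(2)[OF xy(1)] rank_less[of x y "inv s x"] by (auto simp: stable_def ordered_def)
  show "search_start x y i \<le> r i (inv s i)" for i
    using less by (simp add: search_start_def)
  fix z assume z: "z < n"
  show "r z (inv (inv s) z) < search_limit x y z"
  proof (cases "r x z \<le> r x y")
    case True
    then have "r z (inv s z) \<le> r z x"
      using less s xy(1) z by (auto simp: stable_def unblocked_def)
    moreover have "r z (s z) \<le> r z (inv s z)" using s z by (auto simp: stable_def ordered_def)
    moreover have "s z \<noteq> x"
      using True less permutes_inverses(2)[OF ps, of z] by auto
    ultimately show ?thesis
      using True rank_less[of z "s z" x] z xy(1) range(1)[OF z] by (auto simp: search_limit_def)
  next
    case False
    then show ?thesis using range(1)[OF z] z by (simp add: search_limit_def)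
  qed
qed

text \<open>The limits make \<open>m\<close> bistable despite the skipped positions. Optimality
  against \<open>inv s\<close> gives \<open>above\<close>, and the starting position of
  \<open>x\<close> gives \<open>below\<close>, as \<open>alternate_predecessors\<close>
  requires.\<close>

lemma search_traces:
  assumes xy: "x < n" "y < n"
    and m: "da_result (search_start x y) (search_limit x y) p h m"
  shows "traces x y m"
proof -
  have pm: "m permutes {..<n}" using m by (simp add: da_result_def)
  have "bistable m"
    unfolding bistable_def
  proof (intro conjI ballI impI pm)
    fix i j assume ij: "i \<in> {..<n}" "j \<in> {..<n}" "r i j < r i (m i)"
    show "r j (inv m j) \<le> r j i"
    proof (cases "search_start x y i \<le> r i j")
      case True
      then show ?thesis using m ij by (auto simp: da_result_def)
    next
      case False
      then have "i = x" "r x j \<le> r x y" by (auto simp: search_start_def split: if_splits)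
      moreover have "r j (inv m j) < search_limit x y j" using m ij by (auto simp: da_result_def)
      ultimately show ?thesis by (simp add: search_limit_def)
    qed
  qed
  moreover have "r x y < r x (m x)"
    using m xy by (force simp: da_result_def search_start_def)
  moreover have "r i (m i) \<le> r i (inv s i)" if "stable s" "s x = y" "s y \<noteq> x" "i < n" for s i
    using m search_feasible[OF that(1) xy that(2,3)] that(4) by (auto simp: da_result_def)
  ultimately show ?thesis
    unfolding traces_def using xy alternate_predecessors[of _ m x] by auto
qed

text \<open>This translates positions counted forwards along the list into the backward steps of
  \<open>traces\<close>; the factor \<open>L - 1\<close> keeps an even \<open>j\<close>
  even.\<close>

lemma inv_funpow_cycle:
  assumes s: "s permutes (A :: 'a set)" and L: "(s ^^ L) a = a" "L > 0"
  shows "(inv s ^^ (j * (L - 1))) a = (s ^^ j) a"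
proof -
  have cancel: "(inv s ^^ k) ((s ^^ k) x) = x" for k x
    by (induction k arbitrary: x) (simp_all add: funpow_swap1 permutes_inverses[OF s])
  have "(s ^^ (j * L)) a = a"
  proof (induction j)
    case (Suc j)
    then show ?case using L(1) by (simp add: funpow_add)
  qed simp
  moreover have "j * L = j * (L - 1) + j" using L(2) by (cases L) simp_all
  ultimately have "(s ^^ (j * (L - 1))) ((s ^^ j) a) = a" by (simp add: funpow_add)
  then show ?thesis using cancel[of "j * (L - 1)" "(s ^^ j) a"] by simp
qed

text \<open>The first run knows the predecessors at even positions, the second, started one place
  before \<open>a\<close>, those at odd positions. Stated in this form, the inverse matchings, which
  the arrays of held proposers contain, give the successors needed for walking forwards.\<close>

lemma walk_completion:
  assumes C: "completion {..<n} P a b s C" and k: "k < length C"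
    and m1: "traces a b m1"
    and m2: "traces (m1 a) a m2"
  shows "(if odd k then m1 else m2) (C ! (Suc k mod length C)) = C ! k"
proof -
  define L where "L = length C"
  have s: "stable s" "is_cycle_of s C" "C ! 0 = a" "even L" "2 < L"
    using C by (auto simp: completion_def L_def)
  have ps: "s permutes {..<n}" using s by (simp add: stable_def)
  note inv = permutes_inverses[OF ps]
  note ab = completion_start[OF C]
  have pow: "(s ^^ j) a = C ! (j mod L)" for j
    using cycle_funpow[OF s(2), of j] s(3) by (simp add: L_def)
  have cyc: "(s ^^ L) a = a" using pow[of L] s(3) by simp
  have T1: "m1 ((s ^^ j) a) = inv s ((s ^^ j) a)" if j: "even j" for j
  proof -
    obtain i where "j = 2 * i" using j by blast
    then have "(s ^^ j) a = (inv s ^^ (2 * (i * (L - 1)))) a"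
      using inv_funpow_cycle[OF ps cyc, of j] s(5) by (simp add: mult.assoc)
    then show ?thesis using m1 s(1) ab(1,2) unfolding traces_def by metis
  qed
  define y where "y = m1 a"
  have y: "y = inv s a" using T1[of 0] by (simp add: y_def)
  have sy: "s y = a" "s a \<noteq> y" using y ab inv by auto
  have cyc_y: "(s ^^ L) y = y"
    using cyc sy(1) inv(2) by (metis funpow_swap1)
  have T2: "m2 ((s ^^ j) y) = inv s ((s ^^ j) y)" if j: "even j" for j
  proof -
    obtain i where "j = 2 * i" using j by blast
    then have "(s ^^ j) y = (inv s ^^ (2 * (i * (L - 1)))) y"
      using inv_funpow_cycle[OF ps cyc_y, of j] s(5) by (simp add: mult.assoc)
    then show ?thesis using m2 s(1) sy unfolding traces_def y_def by metis
  qed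
  have Ck: "C ! k = (s ^^ k) a" "C ! (Suc k mod length C) = (s ^^ Suc k) a"
    using pow[of k] pow[of "Suc k"] k by (simp_all add: L_def)
  show ?thesis
  proof (cases "odd k")
    case True
    then show ?thesis using T1[of "Suc k"] Ck inv by simp
  next
    case False
    \<comment> \<open>Since \<open>y\<close> is one place before \<open>a\<close>, position
      \<open>k + 1\<close> from \<open>a\<close> is \<open>k + 2\<close> from \<open>y\<close>,
      which is even together with \<open>k\<close>.\<close>
    have "(s ^^ Suc (Suc k)) y = (s ^^ Suc k) a" using sy(1) by (simp add: funpow_swap1)
    then show ?thesis using T2[of "Suc (Suc k)"] False Ck inv by simp
  qed
qed

section \<open>Testing the candidate\<close>

text \<open>
  A candidate is an array \<open>c\<close> in which the cycle of length \<open>L\<close> is followed by its first two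
  entries, so that the neighbours of \<open>c (k + 1)\<close> are \<open>c k\<close> and \<open>c (k + 2)\<close>.
\<close>

definition cycle_limit :: "(nat \<Rightarrow> nat) \<Rightarrow> nat \<Rightarrow> nat \<Rightarrow> nat" where
  "cycle_limit c k y = r y (c (Suc k)) + of_bool (y = c (Suc (Suc k)))"

text \<open>Here \<open>t0 y\<close> is the minimum of \<open>n\<close> and the limits imposed by
  cycle agents that prefer \<open>y\<close> to their predecessor; such an agent
  \<open>c (k + 1)\<close> must not be better for \<open>y\<close> than the predecessor of
  \<open>y\<close>. The limit is strict unless \<open>y\<close> is \<open>c (k + 2)\<close>, whose
  predecessor is \<open>c (k + 1)\<close> itself: hence the extra 1 in
  \<open>cycle_limit\<close>.\<close>

definition cycle_bounds :: "(nat \<Rightarrow> nat) \<Rightarrow> nat \<Rightarrow> (nat \<Rightarrow> nat) \<Rightarrow> bool" where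
  "cycle_bounds c L t0 \<longleftrightarrow>
     (\<forall>k<L. \<forall>y<n. r (c (Suc k)) y < r (c (Suc k)) (c k) \<longrightarrow> t0 y \<le> cycle_limit c k y) \<and>
     (\<forall>y<n. t0 y = n \<or>
        (\<exists>k<L. r (c (Suc k)) y < r (c (Suc k)) (c k) \<and> t0 y = cycle_limit c k y))"

text \<open>No stable partition is assumed. The final positions show that \<open>m\<close> follows
  the candidate, the limits exclude blocking pairs that meet it, and starting at 0 off the cycle
  excludes bipartite blocking there, so \<open>glue_cycle\<close> applies.\<close>

lemma candidate_completes:
  assumes L: "even L" "2 < L" "c L = c 0" "c (Suc L) = c 1"
    and range: "\<And>k. k < L \<Longrightarrow> c k < n" and inj: "inj_on c {1..L}"
    and m: "da_result p0 t0 p h m"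
    and p0: "\<And>i. \<lbrakk>i < n; i \<notin> c ` {1..L}\<rbrakk> \<Longrightarrow> p0 i = 0"
    and t0: "cycle_bounds c L t0"
    and cyc: "\<And>k. k < L \<Longrightarrow> p (c (Suc k)) = r (c (Suc k)) (c (Suc (Suc k)))"
    and ord: "\<And>i. i < n \<Longrightarrow> p i \<le> r i (h i)"
  shows "completes {..<n} P (c 0) (c 1) (map c [0..<L])"
proof -
  have pm: "m permutes {..<n}" using m by (simp add: da_result_def)
  note inv = permutes_inverses[OF pm]
  have m_n: "i < n \<Longrightarrow> m i < n" for i using permutes_in_image[OF pm, of i] by simp
  have res: "p i = r i (m i)" "h i = inv m i" "r i (inv m i) < t0 i" if "i < n" for i
    using m that by (auto simp: da_result_def)
  have range': "c k < n" if "k \<le> Suc L" for k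
    using range[of k] range[of 0] range[of 1] L that by (cases "k < L") (auto simp: le_Suc_eq not_less)
  have m_c': "m (c (Suc k)) = c (Suc (Suc k))" if "k < L" for k
    using cyc[OF that] res(1)[of "c (Suc k)"] range'[of "Suc k"] range'[of "Suc (Suc k)"] that
      rank_eq_iff[of "c (Suc k)" "m (c (Suc k))" "c (Suc (Suc k))"] m_n[of "c (Suc k)"] by simp
  have m_c: "m (c k) = c (Suc k)" if "k \<le> L" for k
  proof (cases k)
    case 0
    then show ?thesis using m_c'[of "L - 1"] L by simp
  next
    case (Suc j)
    then show ?thesis using m_c'[of j] that by simp
  qed
  have inv_c: "inv m (c (Suc k)) = c k" if "k \<le> L" for k
    using m_c[OF that] inv(2)[of "c k"] by simp
  \<comment> \<open>The indices \<open>1..L\<close> are those whose two neighbours are both stored;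
    as \<open>c L = c 0\<close>, they show the same agents as the indices below
    \<open>L\<close>.\<close>
  define S where "S = c ` {1..L}"
  have S: "S = c ` {..<L}"
  proof -
    have "{1..L} = insert L {1..<L}" "{..<L} = insert 0 {1..<L}" using L by auto
    then show ?thesis by (simp add: S_def L(3))
  qed
  have "m ` S = c ` Suc ` {..<L}"
    unfolding S image_image using m_c by (intro image_cong) auto
  also have "Suc ` {..<L} = {1..L}" by (auto simp: image_iff) (metis Suc_le_D Suc_le_lessD lessThan_iff)
  finally have mS: "m ` S = S" by (simp add: S_def)
  have "ordered m" using ord res by (auto simp: ordered_def)
  have "\<exists>t. stable t \<and> (\<forall>x\<in>S. t x = m x)"
  proof (rule glue_cycle[OF pm _ mS \<open>ordered m\<close>])
    show "S \<subseteq> {..<n}" using range by (auto simp: S)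
    show "r y (inv m y) \<le> r y x" if x: "x \<in> S" "y \<in> {..<n}" "r x y < r x (inv m x)" for x y
    proof -
      obtain k where k: "k < L" "x = c (Suc k)" using x(1) by (auto simp: S_def) (metis Suc_le_D Suc_le_lessD)
      then have "t0 y \<le> cycle_limit c k y"
        using t0 x inv_c[of k] by (auto simp: cycle_bounds_def)
      then show ?thesis using res(3)[of y] x k by (auto simp: cycle_limit_def of_bool_def split: if_splits)
    qed
    show "r j (inv m j) \<le> r j i"
      if "i \<in> {..<n} - S" "j \<in> {..<n} - S" "r i j < r i (m i)" for i j
      using m p0[of i] that by (auto simp: da_result_def S_def)
  qed
  then obtain t where t: "stable t" "\<And>x. x \<in> S \<Longrightarrow> t x = m x" by blast
  define C where "C = map c [0..<L]"
  have C: "length C = L" "\<And>k. k < L \<Longrightarrow> C ! k = c k" "set C = S"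
    by (auto simp: C_def S)
  have "card S = L" unfolding S_def using card_image[OF inj] by simp
  then have "distinct C" using C by (intro card_distinct) simp
  have "t (C ! k) = C ! (Suc k mod L)" if "k < L" for k
    using t(2)[of "c k"] m_c[of k] that C(2) L by (cases "Suc k < L") (auto simp: S not_less le_Suc_eq)
  then have "is_cycle_of t C"
    using C L(2) \<open>distinct C\<close> by (auto simp: is_cycle_of_def)
  then have "completion {..<n} P (c 0) (c 1) t C"
    using C L t(1) range by (auto simp: completion_def S)
  then show ?thesis using completes_iff[OF inst] by (auto simp: C_def)
qed

text \<open>This is the converse of the test. The partition itself is feasible, so the run cannot
  fail, and on the cycle the position of \<open>m\<close> is squeezed between the starting position
  and optimality against \<open>s\<close>.\<close>

lemma completion_passes:
  assumes C: "completion {..<n} P a b s C"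
    and L: "L = length C" and c: "\<And>k. k < L \<Longrightarrow> c k = C ! k" "c L = a" "c (Suc L) = b"
    and p0: "\<And>k. k < L \<Longrightarrow> p0 (c (Suc k)) = r (c (Suc k)) (c (Suc (Suc k)))"
      "\<And>i. \<lbrakk>i < n; i \<notin> c ` {1..L}\<rbrakk> \<Longrightarrow> p0 i = 0"
    and t0: "cycle_bounds c L t0"
  shows "feasible p0 t0 s"
    and "da_result p0 t0 p h m \<Longrightarrow> k < L \<Longrightarrow> p (c (Suc k)) = r (c (Suc k)) (c (Suc (Suc k)))"
    and "da_result p0 t0 p h m \<Longrightarrow> i < n \<Longrightarrow> p i \<le> r i (h i)"
proof -
  have s: "stable s" "is_cycle_of s C" "C ! 0 = a" "C ! 1 = b" "even L" "2 < L" "set C \<subseteq> {..<n}"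
    using C by (auto simp: completion_def L)
  have ps: "s permutes {..<n}" using s by (simp add: stable_def)
  note inv = permutes_inverses[OF ps]
  note range = stable_range[OF s(1)]
  have s_c: "s (c k) = c (Suc k)" if "k \<le> L" for k
  proof (cases "k = L")
    case True
    then show ?thesis using completion_start(1)[OF C] c by simp
  next
    case False
    then have "s (C ! k) = C ! (Suc k mod L)" using s(2) that by (simp add: is_cycle_of_def L)
    then show ?thesis using False that c s(3) by (cases "Suc k = L") auto
  qed
  have c_n: "c (Suc k) < n" if "k < L" for k
  proof (cases "Suc k = L")
    case True
    then show ?thesis using c(2) completion_start(3)[OF C] by simp
  next
    case False
    then have "c (Suc k) \<in> set C" using that c(1)[of "Suc k"] L by simp
    then show ?thesis using s(7) by auto
  qed
  have inv_c: "inv s (c (Suc k)) = c k" if "k \<le> L" for k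
    using s_c[OF that] inv(2)[of "c k"] by simp
  have p0_le: "p0 i \<le> r i (s i)" if "i < n" for i
  proof (cases "i \<in> c ` {1..L}")
    case True
    then obtain k where "k < L" "i = c (Suc k)" by (auto) (metis Suc_le_D Suc_le_lessD)
    then show ?thesis using p0(1)[of k] s_c[of "Suc k"] by simp
  qed (use p0(2) that in simp)
  show feas: "feasible p0 t0 s"
    unfolding feasible_def
  proof (intro conjI allI impI p0_le)
    show "bistable s" by (rule stable_imp_bistable) (rule s)
    fix y assume y: "y < n"
    consider "t0 y = n" | k where "k < L" "r (c (Suc k)) y < r (c (Suc k)) (c k)" "t0 y = cycle_limit c k y"
      using t0 y by (auto simp: cycle_bounds_def)
    then show "r y (inv s y) < t0 y"
    proof cases
      case 1
      then show ?thesis using y range(2)[OF y] by simp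
    next
      case (2 k)
      define x where "x = c (Suc k)"
      have x: "x < n" "inv s x = c k" "s x = c (Suc (Suc k))"
        using c_n[OF 2(1)] inv_c[of k] s_c[of "Suc k"] 2(1) by (auto simp: x_def)
      then have le: "r y (inv s y) \<le> r y x"
        using s(1) y 2(2) by (auto simp: stable_def unblocked_def x_def)
      show ?thesis
      proof (cases "y = s x")
        case True
        then show ?thesis using 2(3) le x by (simp add: cycle_limit_def x_def)
      next
        case False
        then have "inv s y \<noteq> x" using inv(1)[of y] by auto
        then show ?thesis
          using le rank_less[of y "inv s y" x] y x range(2)[OF y] False 2(3)
          by (simp add: cycle_limit_def x_def)
      qed
    qed
  qed
  assume m: "da_result p0 t0 p h m"
  have pm: "m permutes {..<n}" using m by (simp add: da_result_def)
  have res: "p i = r i (m i)" "h i = inv m i" "p0 i \<le> r i (m i)" "r i (m i) \<le> r i (s i)" if "i < n" for i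
    using m feas that by (auto simp: da_result_def)
  have inv_n: "inv m i < n" if "i < n" for i
    using permutes_in_image[OF permutes_inv[OF pm], of i] that by simp
  show "p (c (Suc k)) = r (c (Suc k)) (c (Suc (Suc k)))" if "k < L"
    using res[OF c_n[OF that]] p0(1)[OF that] s_c[of "Suc k"] that by simp
  show "p i \<le> r i (h i)" if i: "i < n"
  proof (rule ccontr)
    assume "\<not> ?thesis"
    moreover have "r i (s i) \<le> r i (inv s i)" using s(1) i by (auto simp: stable_def ordered_def)
    ultimately have less: "r i (inv m i) < r i (inv s i)" using res[OF i] by simp
    \<comment> \<open>By optimality \<open>q\<close>, which gets \<open>i\<close> under
      \<open>m\<close>, prefers \<open>i\<close> to its successor, while \<open>i\<close> prefers
      \<open>q\<close> to its predecessor. Together they would block \<open>s\<close> as a bipartite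
      matching.\<close>
    define q where "q = inv m i"
    have q: "q < n" "m q = i" using inv_n[OF i] permutes_inverses(1)[OF pm] by (auto simp: q_def)
    have "s q \<noteq> i" using less inv(2)[of q] by (auto simp: q_def)
    then have "r q i < r q (s q)" using res(4)[OF q(1)] q rank_less[of q i "s q"] i range(1) by auto
    then have "r i (inv s i) \<le> r i q"
      using bistableD[OF stable_imp_bistable[OF s(1)] q(1) i] by simp
    then show False using less by (simp add: q_def)
  qed
qed

end

section \<open>Time-bounded program verification\<close>

definition runs :: "nat \<Rightarrow> prog \<Rightarrow> state \<Rightarrow> nat \<Rightarrow> (state \<Rightarrow> bool) \<Rightarrow> bool" where
  "runs W c s t Q \<longleftrightarrow> (\<exists>t' s'. exec W c s t' s' \<and> t' \<le> t \<and> Q s')"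

text \<open>Loop-free code is reduced to its postcondition by simplification. Loops get the value
  \<open>False\<close> and are handled by \<open>runs_While\<close> and \<open>runs_For\<close>;
  accordingly \<open>steps\<close> bounds loop-free programs.\<close>

primrec wp :: "nat \<Rightarrow> prog \<Rightarrow> (state \<Rightarrow> bool) \<Rightarrow> state \<Rightarrow> bool" where
  "wp W Skip Q s \<longleftrightarrow> Q s"
| "wp W (Assign x e) Q s \<longleftrightarrow> fits W e s \<and> Q (s\<lparr>var := (var s)(x := val e s)\<rparr>)"
| "wp W (Store x e1 e2) Q s \<longleftrightarrow> fits W e1 s \<and> fits W e2 s \<and>
     Q (s\<lparr>arr := (arr s)(x := (arr s x)(val e1 s := val e2 s))\<rparr>)"
| "wp W (Seq c1 c2) Q s \<longleftrightarrow> wp W c1 (wp W c2 Q) s"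
| "wp W (If e c1 c2) Q s \<longleftrightarrow> fits W e s \<and> (if val e s \<noteq> 0 then wp W c1 Q s else wp W c2 Q s)"
| "wp W (While e c) Q s \<longleftrightarrow> False"

primrec steps :: "prog \<Rightarrow> nat" where
  "steps Skip = 1"
| "steps (Assign x e) = cost e + 1"
| "steps (Store x e1 e2) = cost e1 + cost e2 + 1"
| "steps (Seq c1 c2) = steps c1 + steps c2"
| "steps (If e c1 c2) = cost e + 1 + max (steps c1) (steps c2)"
| "steps (While e c) = 0"

lemma wp_sound: "wp W c Q s \<Longrightarrow> \<exists>t s'. exec W c s t s' \<and> t \<le> steps c \<and> Q s'"
proof (induction c arbitrary: s Q)
  case (Seq c1 c2)
  from Seq.prems obtain t1 s1 where 1: "exec W c1 s t1 s1" "t1 \<le> steps c1" "wp W c2 Q s1"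
    using Seq.IH(1)[of "wp W c2 Q" s] by auto
  then obtain t2 s2 where "exec W c2 s1 t2 s2" "t2 \<le> steps c2" "Q s2"
    using Seq.IH(2)[of Q s1] by auto
  with 1 show ?case by (intro exI[of _ "t1 + t2"] exI[of _ s2]) (auto intro: exec.Seq)
next
  case (If e c1 c2)
  show ?case
  proof (cases "val e s \<noteq> 0")
    case True
    then obtain t s' where "exec W c1 s t s'" "t \<le> steps c1" "Q s'"
      using If.IH(1)[of Q s] If.prems by (auto split: if_splits)
    then show ?thesis
      using If.prems True exec.IfTrue[of W e s c1 t s' c2]
      by (intro exI[of _ "cost e + 1 + t"] exI[of _ s']) auto
  next
    case False
    then obtain t s' where "exec W c2 s t s'" "t \<le> steps c2" "Q s'"
      using If.IH(2)[of Q s] If.prems by (auto split: if_splits)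
    then show ?thesis
      using If.prems False exec.IfFalse[of W e s c2 t s' c1]
      by (intro exI[of _ "cost e + 1 + t"] exI[of _ s']) auto
  qed
qed (fastforce intro: exec.intros)+

lemma runs_wp: "wp W c Q s \<Longrightarrow> runs W c s (steps c) Q"
  using wp_sound by (auto simp: runs_def)

lemma runs_mono: "\<lbrakk>runs W c s t Q; t \<le> t'; \<And>s'. Q s' \<Longrightarrow> Q' s'\<rbrakk> \<Longrightarrow> runs W c s t' Q'"
  unfolding runs_def by (meson order_trans)

lemma runs_Seq:
  assumes "runs W c1 s t1 Q1" "\<And>s'. Q1 s' \<Longrightarrow> runs W c2 s' t2 Q"
  shows "runs W (Seq c1 c2) s (t1 + t2) Q"
  using assms unfolding runs_def by (meson exec.Seq add_mono)

lemma runs_If: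
  assumes "fits W e s"
    and "val e s \<noteq> 0 \<Longrightarrow> runs W c1 s t1 Q" "val e s = 0 \<Longrightarrow> runs W c2 s t2 Q"
  shows "runs W (If e c1 c2) s (cost e + 1 + (t1 + t2)) Q"
proof (cases "val e s = 0")
  case True
  then obtain t' s' where "exec W c2 s t' s'" "t' \<le> t2" "Q s'"
    using assms(3) by (auto simp: runs_def)
  then show ?thesis
    using exec.IfFalse[OF assms(1) True] unfolding runs_def
    by (intro exI[of _ "cost e + 1 + t'"] exI[of _ s']) auto
next
  case False
  then obtain t' s' where "exec W c1 s t' s'" "t' \<le> t1" "Q s'"
    using assms(2) by (auto simp: runs_def)
  then show ?thesis
    using exec.IfTrue[OF assms(1) False] unfolding runs_def
    by (intro exI[of _ "cost e + 1 + t'"] exI[of _ s']) auto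
qed

text \<open>At most \<open>N\<close> iterations are possible, each charged the same bound
  \<open>t\<close>; the extra 1 pays for the final test.\<close>

lemma runs_While:
  assumes "I s" "f s \<le> N"
    and fit: "\<And>s. I s \<Longrightarrow> fits W e s"
    and step: "\<And>s. \<lbrakk>I s; val e s \<noteq> 0\<rbrakk> \<Longrightarrow> runs W c s t (\<lambda>s'. I s' \<and> f s' < (f s :: nat))"
  shows "runs W (While e c) s ((cost e + 1 + t) * (N + 1)) (\<lambda>s'. I s' \<and> val e s' = 0)"
  using assms(1,2)
proof (induction N arbitrary: s rule: less_induct)
  case (less N)
  show ?case
  proof (cases "val e s = 0")
    case True
    then have "exec W (While e c) s (cost e + 1) s" using fit less.prems by (blast intro: exec.intros)
    moreover have "cost e + 1 \<le> (cost e + 1 + t) * (N + 1)" by simp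
    ultimately show ?thesis using True less.prems unfolding runs_def by blast
  next
    case False
    then obtain t1 s1 where 1: "exec W c s t1 s1" "t1 \<le> t" "I s1" "f s1 < f s"
      using step[OF less.prems(1) False] unfolding runs_def by blast
    then have "f s1 < N" using less.prems by simp
    then obtain t2 s2 where 2: "exec W (While e c) s1 t2 s2"
      "t2 \<le> (cost e + 1 + t) * (f s1 + 1)" "I s2" "val e s2 = 0"
      using less.IH[of "f s1" s1] 1 by (auto simp: runs_def)
    have "exec W (While e c) s (cost e + 1 + t1 + t2) s2"
      using False fit less.prems 1(1) 2(1) by (blast intro: exec.intros)
    moreover have "(cost e + 1 + t) * (f s1 + 1) \<le> (cost e + 1 + t) * N"
      using \<open>f s1 < N\<close> by (intro mult_le_mono) auto
    then have "cost e + 1 + t1 + t2 \<le> (cost e + 1 + t) * (N + 1)"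
      using 1(2) 2(2) by (simp add: algebra_simps)
    ultimately show ?thesis using 2 unfolding runs_def by blast
  qed
qed

definition For :: "string \<Rightarrow> string \<Rightarrow> prog \<Rightarrow> prog" where
  "For x m c = Seq (Assign x (Const 0))
     (While (Op Less (Var x) (Var m)) (Seq c (Assign x (Op Add (Var x) (Const 1)))))"

text \<open>Each round costs \<open>t\<close> plus 4 for the test and 4 for the increment; the
  initial assignment costs 2. Charging 2 more per round gives \<open>t + 10\<close>. The invariant
  is required after the increment has been anticipated.\<close>

lemma runs_For:
  assumes ne: "x \<noteq> m" and N: "var s m = N" "N < W" "1 < W"
    and init: "I 0 (s\<lparr>var := (var s)(x := 0)\<rparr>)"
    and step: "\<And>i s'. \<lbrakk>i < N; I i s'; var s' x = i; var s' m = N\<rbrakk> \<Longrightarrow>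
      runs W c s' t (\<lambda>s''. var s'' x = i \<and> var s'' m = N \<and> I (Suc i) (s''\<lparr>var := (var s'')(x := Suc i)\<rparr>))"
    and final: "\<And>s'. \<lbrakk>I N s'; var s' m = N\<rbrakk> \<Longrightarrow> Q s'"
  shows "runs W (For x m c) s ((t + 10) * (N + 1)) Q"
proof -
  define J where "J s' \<longleftrightarrow> var s' m = N \<and> var s' x \<le> N \<and> I (var s' x) s'" for s'
  have "runs W (Assign x (Const 0)) s 2 J"
    using runs_wp[of W "Assign x (Const 0)" J s] N init ne by (simp add: J_def numeral_2_eq_2)
  moreover have "runs W (While (Op Less (Var x) (Var m)) (Seq c (Assign x (Op Add (Var x) (Const 1))))) s'
      ((3 + 1 + (t + 4)) * (N + 1)) Q" if "J s'" for s'
  proof -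
    have "runs W (While (Op Less (Var x) (Var m)) (Seq c (Assign x (Op Add (Var x) (Const 1))))) s'
      ((cost (Op Less (Var x) (Var m)) + 1 + (t + 4)) * (N + 1))
      (\<lambda>s''. J s'' \<and> val (Op Less (Var x) (Var m)) s'' = 0)"
    proof (rule runs_While[where f = "\<lambda>s'. N - var s' x"])
      fix s1 assume J: "J s1"
      then show "fits W (Op Less (Var x) (Var m)) s1" using N by (auto simp: J_def of_bool_def)
      assume "val (Op Less (Var x) (Var m)) s1 \<noteq> 0"
      then have less: "var s1 x < N" using J by (auto simp: J_def)
      have "runs W (Seq c (Assign x (Op Add (Var x) (Const 1)))) s1
        (t + steps (Assign x (Op Add (Var x) (Const 1)))) (\<lambda>s'. J s' \<and> N - var s' x < N - var s1 x)"
      proof (rule runs_Seq)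
        show "runs W c s1 t (\<lambda>s''. var s'' x = var s1 x \<and> var s'' m = N \<and>
            I (Suc (var s1 x)) (s''\<lparr>var := (var s'')(x := Suc (var s1 x))\<rparr>))"
          using step[of "var s1 x" s1] J less by (simp add: J_def)
        fix s2 assume "var s2 x = var s1 x \<and> var s2 m = N \<and>
            I (Suc (var s1 x)) (s2\<lparr>var := (var s2)(x := Suc (var s1 x))\<rparr>)"
        then show "runs W (Assign x (Op Add (Var x) (Const 1))) s2 (steps (Assign x (Op Add (Var x) (Const 1))))
            (\<lambda>s'. J s' \<and> N - var s' x < N - var s1 x)"
          using less N ne by (intro runs_wp) (auto simp: J_def)
      qed
      then show "runs W (Seq c (Assign x (Op Add (Var x) (Const 1)))) s1 (t + 4)
        (\<lambda>s'. J s' \<and> N - var s' x < N - var s1 x)"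
        by (simp add: eval_nat_numeral)
    qed (use that in \<open>auto simp: J_def\<close>)
    then show ?thesis
      by (rule runs_mono) (auto simp: J_def intro: final split: if_splits)
  qed
  ultimately have "runs W (For x m c) s (2 + (3 + 1 + (t + 4)) * (N + 1)) Q"
    unfolding For_def by (rule runs_Seq)
  then show ?thesis by (rule runs_mono) (auto simp: algebra_simps)
qed

lemma runs_For_wp:
  assumes "x \<noteq> m" "var s m = N" "N < W" "1 < W"
    and "I 0 (s\<lparr>var := (var s)(x := 0)\<rparr>)"
    and "\<And>i s'. \<lbrakk>i < N; I i s'; var s' x = i; var s' m = N\<rbrakk> \<Longrightarrow>
      wp W c (\<lambda>s''. var s'' x = i \<and> var s'' m = N \<and> I (Suc i) (s''\<lparr>var := (var s'')(x := Suc i)\<rparr>)) s'"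
    and "\<And>s'. \<lbrakk>I N s'; var s' m = N\<rbrakk> \<Longrightarrow> Q s'"
  shows "runs W (For x m c) s ((steps c + 10) * (N + 1)) Q"
  by (rule runs_For[where I = I, OF assms(1-5) runs_wp assms(7)]) (rule assms(6))

primrec written_vars :: "prog \<Rightarrow> string set" where
  "written_vars Skip = {}"
| "written_vars (Assign x e) = {x}"
| "written_vars (Store x e1 e2) = {}"
| "written_vars (Seq c1 c2) = written_vars c1 \<union> written_vars c2"
| "written_vars (If e c1 c2) = written_vars c1 \<union> written_vars c2"
| "written_vars (While e c) = written_vars c"

primrec written_arrs :: "prog \<Rightarrow> string set" where
  "written_arrs Skip = {}"
| "written_arrs (Assign x e) = {}"
| "written_arrs (Store x e1 e2) = {x}"
| "written_arrs (Seq c1 c2) = written_arrs c1 \<union> written_arrs c2"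
| "written_arrs (If e c1 c2) = written_arrs c1 \<union> written_arrs c2"
| "written_arrs (While e c) = written_arrs c"

text \<open>A syntactic criterion that carries the agents, flags and arrays of earlier runs through
  later code without mentioning them in every invariant.\<close>

lemma exec_frame:
  "exec W c s t s' \<Longrightarrow>
    (\<forall>x. x \<notin> written_vars c \<longrightarrow> var s' x = var s x) \<and> (\<forall>x. x \<notin> written_arrs c \<longrightarrow> arr s' x = arr s x)"
  by (induction rule: exec.induct) auto

lemma runs_frame:
  "runs W c s t Q \<Longrightarrow> runs W c s t (\<lambda>s'. Q s' \<and>
    (\<forall>x. x \<notin> written_vars c \<longrightarrow> var s' x = var s x) \<and> (\<forall>x. x \<notin> written_arrs c \<longrightarrow> arr s' x = arr s x))"
  unfolding runs_def using exec_frame by blast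

lemma written_For [simp]:
  "written_vars (For x m c) = insert x (written_vars c)"
  "written_arrs (For x m c) = written_arrs c"
  by (auto simp: For_def)

section \<open>The program\<close>

abbreviation add_expr (infixl \<open>\<oplus>\<close> 65) where "e1 \<oplus> e2 \<equiv> Op Add e1 e2"

abbreviation table :: "string \<Rightarrow> expr \<Rightarrow> expr \<Rightarrow> expr" where
  "table X i j \<equiv> Cell X (Op Mul i (Var ''n'') \<oplus> j)"

text \<open>Each agent is written into the free last column of its own row, which realises the list
  \<open>P i @ [i]\<close>; the ranks are obtained by inverting the rows.\<close>

definition setup_prog :: prog where
  "setup_prog =
     Seq (For ''i'' ''n''
           (Store ''pref'' (Op Mul (Var ''i'') (Var ''n'') \<oplus> Op Sub (Var ''n'') (Const 1)) (Var ''i'')))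
         (For ''i'' ''n'' (For ''q'' ''n''
           (Store ''rank'' (Op Mul (Var ''i'') (Var ''n'') \<oplus> table ''pref'' (Var ''i'') (Var ''q'')) (Var ''q''))))"

text \<open>One iteration makes one proposal or discovers an exhausted list. The array of held
  proposers is a parameter because those of the first two runs must survive for the walk.\<close>

definition da_step :: "string \<Rightarrow> prog" where
  "da_step H =
     If (Op Equal (Cell ''ptr'' (Var ''cur'')) (Var ''n''))
       (Assign ''m'' (Var ''n'' \<oplus> Const 1))
       (Seq (Assign ''y'' (table ''pref'' (Var ''cur'') (Cell ''ptr'' (Var ''cur''))))
       (Seq (Assign ''v'' (table ''rank'' (Var ''y'') (Var ''cur'')))
         (If (Op Less (Var ''v'') (Cell ''thr'' (Var ''y'')))
           (Seq (Assign ''d'' (Cell H (Var ''y'')))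
           (Seq (Store H (Var ''y'') (Var ''cur''))
           (Seq (Store ''thr'' (Var ''y'') (Var ''v''))
             (If (Op Equal (Var ''d'') (Var ''n''))
               (Seq (Assign ''m'' (Var ''m'' \<oplus> Const 1)) (Assign ''cur'' (Var ''m'')))
               (Seq (Store ''ptr'' (Var ''d'') (Cell ''ptr'' (Var ''d'') \<oplus> Const 1))
                 (Assign ''cur'' (Var ''d'')))))))
           (Store ''ptr'' (Var ''cur'') (Cell ''ptr'' (Var ''cur'') \<oplus> Const 1)))))"

text \<open>The loop ends with \<open>m = n\<close> if it succeeds, and with \<open>m = n + 1\<close> if it fails.\<close>

definition da_prog :: "string \<Rightarrow> prog" where
  "da_prog H = Seq (Assign ''m'' (Const 0)) (Seq (Assign ''cur'' (Const 0))
     (While (Op Less (Var ''m'') (Var ''n'')) (da_step H)))"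

definition search_prog :: "string \<Rightarrow> string \<Rightarrow> string \<Rightarrow> prog" where
  "search_prog H x y =
     Seq (For ''i'' ''n''
       (Seq (Store ''ptr'' (Var ''i'') (Const 0))
       (Seq (Store H (Var ''i'') (Var ''n''))
         (If (Op Less (table ''rank'' (Var x) (Var y)) (table ''rank'' (Var x) (Var ''i'')))
           (Store ''thr'' (Var ''i'') (Var ''n''))
           (Store ''thr'' (Var ''i'') (table ''rank'' (Var ''i'') (Var x)))))))
     (Seq (Store ''ptr'' (Var x) (table ''rank'' (Var x) (Var y) \<oplus> Const 1))
       (da_prog H))"

text \<open>Each round appends two agents, one found by each run, so the length stays even. The
  bound by \<open>n\<close> stops a walk that never returns to \<open>a\<close>. Product and
  subtraction from 1 encode conjunction and negation.\<close>

definition walk_prog :: prog where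
  "walk_prog =
     Seq (Seq (Store ''cycle'' (Const 0) (Var ''a''))
         (Seq (Store ''cycle'' (Const 1) (Var ''b''))
         (Seq (Assign ''cur'' (Cell ''h1'' (Var ''b'')))
           (Assign ''len'' (Const 2)))))
       (While (Op Mul (Op Less (Var ''len'') (Var ''n'')) (Op Sub (Const 1) (Op Equal (Var ''cur'') (Var ''a''))))
         (Seq (Store ''cycle'' (Var ''len'') (Var ''cur''))
         (Seq (Assign ''cur'' (Cell ''h2'' (Var ''cur'')))
         (Seq (Store ''cycle'' (Var ''len'' \<oplus> Const 1) (Var ''cur''))
         (Seq (Assign ''cur'' (Cell ''h1'' (Var ''cur'')))
           (Assign ''len'' (Var ''len'' \<oplus> Const 2)))))))"

text \<open>Every entry of the candidate scans one list, only down to its predecessor, which keeps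
  the total quadratic. Repeated agents are detected through \<open>pos\<close>: a later occurrence
  overwrites the index stored by an earlier one.\<close>

definition limits_prog :: prog where
  "limits_prog =
     Seq (Seq (Store ''cycle'' (Var ''len'') (Var ''a''))
           (Store ''cycle'' (Var ''len'' \<oplus> Const 1) (Var ''b'')))
    (Seq (For ''i'' ''n''
       (Seq (Store ''ptr'' (Var ''i'') (Const 0))
       (Seq (Store ''h3'' (Var ''i'') (Var ''n'')) (Store ''thr'' (Var ''i'') (Var ''n'')))))
      (For ''k'' ''len''
        (Seq
          (Seq (Assign ''c'' (Cell ''cycle'' (Var ''k'' \<oplus> Const 1)))
          (Seq (Assign ''z'' (Cell ''cycle'' (Var ''k'' \<oplus> Const 2)))
          (Seq (Store ''ptr'' (Var ''c'') (table ''rank'' (Var ''c'') (Var ''z'')))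
          (Seq (Store ''pos'' (Var ''c'') (Var ''k''))
            (Assign ''top'' (table ''rank'' (Var ''c'') (Cell ''cycle'' (Var ''k''))))))))
          (For ''q'' ''top''
            (Seq (Assign ''y'' (table ''pref'' (Var ''c'') (Var ''q'')))
            (Seq (Assign ''v'' (table ''rank'' (Var ''y'') (Var ''c'') \<oplus> Op Equal (Var ''y'') (Var ''z'')))
              (If (Op Less (Var ''v'') (Cell ''thr'' (Var ''y'')))
                (Store ''thr'' (Var ''y'') (Var ''v''))
                Skip)))))))"

definition verify_prog :: prog where
  "verify_prog =
     Seq (Assign ''bad'' (Const 0))
    (Seq (For ''k'' ''len''
        (Seq (Assign ''c'' (Cell ''cycle'' (Var ''k'' \<oplus> Const 1)))
        (Seq (Assign ''z'' (Cell ''cycle'' (Var ''k'' \<oplus> Const 2)))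
          (If (Op Mul (Op Equal (Cell ''pos'' (Var ''c'')) (Var ''k''))
                (Op Equal (Cell ''ptr'' (Var ''c'')) (table ''rank'' (Var ''c'') (Var ''z''))))
            Skip (Assign ''bad'' (Const 1))))))
    (Seq (For ''i'' ''n''
        (If (Op Less (table ''rank'' (Var ''i'') (Cell ''h3'' (Var ''i''))) (Cell ''ptr'' (Var ''i'')))
          (Assign ''bad'' (Const 1)) Skip))
      (If (Var ''bad'') Skip
        (Seq (Assign ''found'' (Const 1)) (Assign ''length'' (Var ''len''))))))"

definition when_complete :: "prog \<Rightarrow> prog" where
  "when_complete c = If (Op Equal (Var ''m'') (Var ''n'')) c Skip"

definition completion_prog :: prog where
  "completion_prog =
     Seq setup_prog (Seq (search_prog ''h1'' ''a'' ''b'') (when_complete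
       (Seq (Assign ''y1'' (table ''pref'' (Var ''a'') (Cell ''ptr'' (Var ''a''))))
       (Seq (search_prog ''h2'' ''y1'' ''a'') (when_complete
         (Seq walk_prog
           (If (Op Mul (Op Equal (Var ''cur'') (Var ''a'')) (Op Less (Const 2) (Var ''len'')))
             (Seq limits_prog (Seq (da_prog ''h3'') (when_complete verify_prog)))
             Skip)))))))"

section \<open>Word size, memory layout and the parts of the program\<close>

locale ram_instance = numbered_instance n P for n :: nat and P :: "nat \<Rightarrow> nat list" +
  fixes W :: nat
  assumes two: "2 \<le> n" and W: "4 * (n * n) \<le> W"
begin

lemma small: "x \<le> 2 * n + 2 \<Longrightarrow> x < W"
proof -
  assume "x \<le> 2 * n + 2"
  moreover have "2 * n \<le> n * n" using two by simp
  ultimately show ?thesis using W two by linarith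
qed

lemma index_less: "\<lbrakk>i < n; q < n\<rbrakk> \<Longrightarrow> i * n + q < n * n"
proof -
  assume "i < n" "q < n"
  then have "i * n + q < Suc i * n" by simp
  also have "\<dots> \<le> n * n" using \<open>i < n\<close> by (intro mult_le_mono1) simp
  finally show ?thesis .
qed

lemma index_W: "\<lbrakk>i < n; q < n\<rbrakk> \<Longrightarrow> i * n + q < W"
  using index_less[of i q] W by linarith

lemma row_W: "i < n \<Longrightarrow> i * n < W"
  using index_W[of i 0] two by simp

lemma index_eq_iff: "\<lbrakk>q < n; q' < n\<rbrakk> \<Longrightarrow> i * n + q = i' * n + q' \<longleftrightarrow> i = i' \<and> q = q'"
proof -
  assume q: "q < n" "q' < n"
  then have "(i * n + q) div n = i" "(i' * n + q') div n = i'" by auto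
  then show ?thesis by (metis add_left_cancel)
qed

definition env :: "state \<Rightarrow> bool" where
  "env s \<longleftrightarrow> var s ''n'' = n \<and>
     (\<forall>i<n. \<forall>q<n. arr s ''pref'' (i * n + q) = choice i q \<and> arr s ''rank'' (i * n + q) = r i q)"

lemma n_W [simp]: "n < W" "Suc n < W" "0 < W" "Suc 0 < W" "1 < W" "2 < W"
  using small[of n] small[of "Suc n"] small[of 0] small[of 1] small[of 2] by simp_all

lemma less_W [simp]: "x < n \<Longrightarrow> x < W" "x < n \<Longrightarrow> Suc x < W"
  using small[of x] small[of "Suc x"] by simp_all

lemma rank_W [simp]: "i < n \<Longrightarrow> x < n \<Longrightarrow> r i x < W" "i < n \<Longrightarrow> x < n \<Longrightarrow> Suc (r i x) < W"
  using rank_less_n[of i x] less_W by blast+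

lemma setup_correct:
  assumes "var s ''n'' = n"
    and pref: "\<And>i q. \<lbrakk>i < n; q < n - 1\<rbrakk> \<Longrightarrow> arr s ''pref'' (i * n + q) = P i ! q"
  shows "runs W setup_prog s (40 * (n + 1) * (n + 1)) env"
proof -
  have ch: "choice i q = (if q < n - 1 then P i ! q else i)" if "i < n" "q < n" for i q
    using full_list(3)[OF inst, of i] that by (auto simp: choice_def nth_append)
  define I1 where "I1 i (s :: state) \<longleftrightarrow> var s ''n'' = n \<and>
    (\<forall>j<n. \<forall>q<n. q < n - 1 \<or> j < i \<longrightarrow> arr s ''pref'' (j * n + q) = choice j q)" for i s
  define I2 where "I2 i (s :: state) \<longleftrightarrow> var s ''n'' = n \<and>
    (\<forall>j<n. \<forall>q<n. arr s ''pref'' (j * n + q) = choice j q) \<and>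
    (\<forall>j<i. \<forall>x<n. arr s ''rank'' (j * n + x) = r j x)" for i s
  define I3 where "I3 i q (s :: state) \<longleftrightarrow> I2 i s \<and> var s ''i'' = i \<and>
    (\<forall>q'<q. arr s ''rank'' (i * n + choice i q') = q')" for i q s
  have two': "n - Suc 0 < n" using two by simp
  have 1: "runs W (For ''i'' ''n'' (Store ''pref'' (Op Mul (Var ''i'') (Var ''n'') \<oplus> Op Sub (Var ''n'') (Const 1)) (Var ''i''))) s
     ((steps (Store ''pref'' (Op Mul (Var ''i'') (Var ''n'') \<oplus> Op Sub (Var ''n'') (Const 1)) (Var ''i'')) + 10) * (n + 1)) (I1 n)"
  proof (rule runs_For_wp[where I = I1])
    fix i s' assume "i < n" "I1 i s'" "var s' ''i'' = i" "var s' ''n'' = n"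
    then show "wp W (Store ''pref'' (Op Mul (Var ''i'') (Var ''n'') \<oplus> Op Sub (Var ''n'') (Const 1)) (Var ''i''))
      (\<lambda>s''. var s'' ''i'' = i \<and> var s'' ''n'' = n \<and> I1 (Suc i) (s''\<lparr>var := (var s'')(''i'' := Suc i)\<rparr>)) s'"
      using two' by (auto simp: I1_def ch index_eq_iff index_W row_W less_Suc_eq simp del: add_diff_assoc)
  qed (auto simp: I1_def assms ch)
  have 2: "runs W (For ''q'' ''n'' (Store ''rank'' (Op Mul (Var ''i'') (Var ''n'') \<oplus> table ''pref'' (Var ''i'') (Var ''q'')) (Var ''q''))) s'
     ((steps (Store ''rank'' (Op Mul (Var ''i'') (Var ''n'') \<oplus> table ''pref'' (Var ''i'') (Var ''q'')) (Var ''q'')) + 10) * (n + 1))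
     (\<lambda>s'. var s' ''i'' = i \<and> var s' ''n'' = n \<and> I2 (Suc i) (s'\<lparr>var := (var s')(''i'' := Suc i)\<rparr>))"
    if i: "i < n" "I2 i s'" "var s' ''i'' = i" for i s'
  proof (rule runs_For_wp[where I = "I3 i"])
    show "I3 i 0 (s'\<lparr>var := (var s')(''q'' := 0)\<rparr>)" using i by (simp add: I3_def I2_def)
    show "var s' ''n'' = n" using i by (simp add: I2_def)
    fix q s1 assume q: "q < n" "I3 i q s1" "var s1 ''q'' = q" "var s1 ''n'' = n"
    \<comment> \<open>Entries of a list are distinct, so storing one rank does not overwrite those
      already stored.\<close>
    have ne: "choice i q' \<noteq> choice i q" if "q' < q" for q'
      using that q(1) i(1) rank_choice[of i q] rank_choice[of i q'] by (metis less_imp_neq order_less_trans)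
    show "wp W (Store ''rank'' (Op Mul (Var ''i'') (Var ''n'') \<oplus> table ''pref'' (Var ''i'') (Var ''q'')) (Var ''q''))
      (\<lambda>s''. var s'' ''q'' = q \<and> var s'' ''n'' = n \<and> I3 i (Suc q) (s''\<lparr>var := (var s'')(''q'' := Suc q)\<rparr>)) s1"
      using q i(1) ne by (auto simp: I3_def I2_def index_W row_W index_eq_iff less_Suc_eq)
  next
    fix s1 assume s1: "I3 i n s1" "var s1 ''n'' = n"
    have "arr s1 ''rank'' (i * n + x) = r i x" if "x < n" for x
    proof -
      have "arr s1 ''rank'' (i * n + choice i (r i x)) = r i x"
        using s1 i(1) that by (auto simp: I3_def simp del: choice_rank)
      then show ?thesis using i(1) that by simp
    qed
    then show "var s1 ''i'' = i \<and> var s1 ''n'' = n \<and> I2 (Suc i) (s1\<lparr>var := (var s1)(''i'' := Suc i)\<rparr>)"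
      using s1 by (auto simp: I3_def I2_def less_Suc_eq)
  qed auto
  have "runs W setup_prog s (20 * (n + 1) + (25 * (n + 1) + 10) * (n + 1)) env"
    unfolding setup_prog_def
  proof (rule runs_Seq)
    show "runs W (For ''i'' ''n'' (Store ''pref'' (Op Mul (Var ''i'') (Var ''n'') \<oplus> Op Sub (Var ''n'') (Const 1)) (Var ''i''))) s
      (20 * (n + 1)) (I1 n)"
      by (rule runs_mono[OF 1]) auto
    fix s1 assume "I1 n s1"
    then show "runs W (For ''i'' ''n'' (For ''q'' ''n'' (Store ''rank'' (Op Mul (Var ''i'') (Var ''n'') \<oplus> table ''pref'' (Var ''i'') (Var ''q'')) (Var ''q'')))) s1
       ((25 * (n + 1) + 10) * (n + 1)) env"
      by (intro runs_For[where I = I2] runs_mono[OF 2]) (auto simp: I1_def I2_def env_def)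
  qed
  then show ?thesis by (rule runs_mono) (use two in \<open>auto simp: algebra_simps\<close>)
qed

definition da_ok :: "(nat \<Rightarrow> nat) \<Rightarrow> (nat \<Rightarrow> nat) \<Rightarrow> string \<Rightarrow> state \<Rightarrow> bool" where
  "da_ok p0 t0 H s \<longleftrightarrow> env s \<and>
     (var s ''m'' \<le> n \<and> da_inv p0 t0 (arr s ''ptr'') (arr s H) (arr s ''thr'') (var s ''m'') (var s ''cur'') \<or>
      var s ''m'' = Suc n \<and> (\<forall>m. \<not> feasible p0 t0 m))"

text \<open>Every iteration raises \<open>m\<close> or advances a pointer, and pointers of live runs
  stay at most \<open>n\<close>. The initial value is at most \<open>n + 1 + n * n\<close>, which is
  the source of the quadratic bound.\<close>

definition da_measure :: "state \<Rightarrow> nat" where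
  "da_measure s = (Suc n - var s ''m'') + (\<Sum>i<n. n - arr s ''ptr'' i)"

lemma sum_upd_less:
  assumes "d < n" "p d < n"
  shows "(\<Sum>i<n. n - (p(d := Suc (p d))) i) < (\<Sum>i<n. n - p i)"
  using assms by (intro sum_strict_mono_ex1) auto

lemma da_step_wp:
  assumes H: "H \<notin> {''pref'', ''rank'', ''ptr'', ''thr''}"
    and ok: "da_ok p0 t0 H s" and k: "var s ''m'' < n" and t0: "\<And>y. y < n \<Longrightarrow> t0 y \<le> n"
  shows "wp W (da_step H) (\<lambda>s'. da_ok p0 t0 H s' \<and> da_measure s' < da_measure s) s"
proof -
  define c p h t where "c = var s ''cur''" and "p = arr s ''ptr''" and "h = arr s H" and "t = arr s ''thr''"
  have inv: "da_inv p0 t0 p h t (var s ''m'') c"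
    using ok k by (auto simp: da_ok_def c_def p_def h_def t_def)
  note D = da_invD[OF inv]
  note folds = c_def[symmetric] p_def[symmetric] h_def[symmetric] t_def[symmetric]
  have env: "env s" using ok by (simp add: da_ok_def)
  then have n: "var s ''n'' = n" by (simp add: env_def)
  have c: "c < n" using D(2) k by simp
  have H': "H \<noteq> ''pref''" "H \<noteq> ''rank''" "H \<noteq> ''ptr''" "H \<noteq> ''thr''"
    "''pref'' \<noteq> H" "''rank'' \<noteq> H" "''ptr'' \<noteq> H" "''thr'' \<noteq> H"
    using H by auto
  show ?thesis
  proof (cases "p c = n")
    case True
    then show ?thesis
      using da_fail[OF inv k True] c env k
      by (auto simp: da_step_def folds n da_ok_def da_measure_def env_def)
  next
    case False
    then have pc: "p c < n" using D(5)[OF c] by simp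
    define y where "y = choice c (p c)"
    have y: "y < n" using c pc by (simp add: y_def)
    have look: "arr s ''pref'' (c * n + p c) = y" "arr s ''rank'' (y * n + c) = r y c"
      using env c pc y by (auto simp: env_def y_def)
    have ty: "t y < W" "h y < W" using D(7,11)[OF y] D(6)[OF y] t0[OF y] y c
      by (cases "h y = n"; auto intro: small)+
    have fit: "c < W" "c * n < W" "c * n + p c < W" "y < W" "y * n < W" "y * n + c < W" "r y c < W"
      "p c < W" "Suc (p c) < W" "var s ''m'' < W" "Suc (var s ''m'') < W"
      using c pc y k by (auto intro: index_W row_W)
    show ?thesis
    proof (cases "r y c < t y")
      case acc: True
      show ?thesis
      proof (cases "h y = n")
        case free: True
        have "da_inv p0 t0 p (h(y := c)) (t(y := r y c)) (Suc (var s ''m'')) (Suc (var s ''m''))"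
          by (rule da_accept_free[OF inv k pc y_def acc free])
        then show ?thesis
          using env k False acc free fit ty H'
          by (simp add: da_step_def folds n look da_ok_def da_measure_def env_def)
      next
        case False
        then have d: "h y < n" using D(6)[OF y] by simp
        have pd: "p (h y) < n" using D(10)[OF y d] d y by simp
        have "da_inv p0 t0 (p(h y := Suc (p (h y)))) (h(y := c)) (t(y := r y c)) (var s ''m'') (h y)"
          by (rule da_accept_swap[OF inv k pc y_def acc refl d])
        then show ?thesis
          using env k \<open>p c \<noteq> n\<close> acc False fit ty H' d pd sum_upd_less[of "h y" p, OF d pd]
          by (simp add: da_step_def folds n look da_ok_def da_measure_def env_def)
      qed
    next
      case rej: False
      have "da_inv p0 t0 (p(c := Suc (p c))) h t (var s ''m'') c"
        by (rule da_reject[OF inv k pc y_def rej])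
      then show ?thesis
        using env k False rej fit ty H' sum_upd_less[of c p, OF c pc]
        by (simp add: da_step_def folds n look da_ok_def da_measure_def env_def)
    qed
  qed
qed

lemma da_correct:
  assumes H: "H \<notin> {''pref'', ''rank'', ''ptr'', ''thr''}" and env: "env s"
    and init: "\<And>i. i < n \<Longrightarrow> arr s ''ptr'' i \<le> n" "\<And>i. i < n \<Longrightarrow> arr s ''thr'' i \<le> n"
      "\<And>i. i < n \<Longrightarrow> arr s H i = n"
  shows "runs W (da_prog H) s (100 * (n + 1) * (n + 1))
    (\<lambda>s'. env s' \<and> (var s' ''m'' = n \<and> (\<exists>m. da_result (arr s ''ptr'') (arr s ''thr'') (arr s' ''ptr'') (arr s' H) m) \<or>
       var s' ''m'' = Suc n \<and> (\<forall>m. \<not> feasible (arr s ''ptr'') (arr s ''thr'') m)))"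
proof -
  let ?p = "arr s ''ptr''" and ?t = "arr s ''thr''"
  have steps: "steps (da_step H) \<le> 60" by (simp add: da_step_def)
  have loop: "runs W (While (Op Less (Var ''m'') (Var ''n'')) (da_step H)) s'
     ((cost (Op Less (Var ''m'') (Var ''n'')) + 1 + steps (da_step H)) * ((n + 1 + n * n) + 1))
     (\<lambda>s'. da_ok ?p ?t H s' \<and> val (Op Less (Var ''m'') (Var ''n'')) s' = 0)"
    if "da_ok ?p ?t H s'" for s'
  proof (rule runs_While[where f = da_measure])
    show "da_ok ?p ?t H s'" by fact
    have "(\<Sum>i<n. n - arr s' ''ptr'' i) \<le> (\<Sum>i<n. n)" by (intro sum_mono) simp
    then show "da_measure s' \<le> n + 1 + n * n" by (simp add: da_measure_def)
    fix s1 assume ok: "da_ok ?p ?t H s1"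
    then show "fits W (Op Less (Var ''m'') (Var ''n'')) s1"
      by (auto simp: da_ok_def env_def intro: small)
    assume "val (Op Less (Var ''m'') (Var ''n'')) s1 \<noteq> 0"
    then have "var s1 ''m'' < n" using ok by (auto simp: da_ok_def env_def)
    then show "runs W (da_step H) s1 (steps (da_step H)) (\<lambda>s'. da_ok ?p ?t H s' \<and> da_measure s' < da_measure s1)"
      using init(2) by (intro runs_wp da_step_wp[OF H ok]) auto
  qed
  have ok0: "da_ok ?p ?t H (s\<lparr>var := (var s)(''m'' := 0, ''cur'' := 0)\<rparr>)"
    using da_init[of ?p "arr s H" ?t] init env two by (auto simp: da_ok_def env_def)
  have a1: "runs W (Assign ''m'' (Const 0)) s (steps (Assign ''m'' (Const 0)))
      (\<lambda>s'. s' = s\<lparr>var := (var s)(''m'' := 0)\<rparr>)"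
    by (rule runs_wp) simp
  have a2: "runs W (Assign ''cur'' (Const 0)) (s\<lparr>var := (var s)(''m'' := 0)\<rparr>)
      (steps (Assign ''cur'' (Const 0))) (\<lambda>s'. s' = s\<lparr>var := (var s)(''m'' := 0, ''cur'' := 0)\<rparr>)"
    by (rule runs_wp) simp
  have run: "runs W (da_prog H) s
     (steps (Assign ''m'' (Const 0)) + (steps (Assign ''cur'' (Const 0)) +
       (cost (Op Less (Var ''m'') (Var ''n'')) + 1 + steps (da_step H)) * ((n + 1 + n * n) + 1)))
     (\<lambda>s'. da_ok ?p ?t H s' \<and> val (Op Less (Var ''m'') (Var ''n'')) s' = 0)"
    unfolding da_prog_def
    by (rule runs_Seq[OF a1], simp only:, rule runs_Seq[OF a2], simp only:, rule loop[OF ok0])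
  show ?thesis
  proof (rule runs_mono[OF run])
    \<comment> \<open>The factor 64 consists of 4 for the loop test and at most 60 for the
      body.\<close>
    have "(4 + steps (da_step H)) * ((n + 1 + n * n) + 1) \<le> 64 * ((n + 1 + n * n) + 1)"
      using steps by (intro mult_le_mono1) simp
    then show "steps (Assign ''m'' (Const 0)) + (steps (Assign ''cur'' (Const 0)) +
       (cost (Op Less (Var ''m'') (Var ''n'')) + 1 + steps (da_step H)) * ((n + 1 + n * n) + 1))
       \<le> 100 * (n + 1) * (n + 1)"
      using two by (simp add: algebra_simps)
    fix s' assume "da_ok ?p ?t H s' \<and> val (Op Less (Var ''m'') (Var ''n'')) s' = 0"
    then show "env s' \<and> (var s' ''m'' = n \<and> (\<exists>m. da_result ?p ?t (arr s' ''ptr'') (arr s' H) m) \<or>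
       var s' ''m'' = Suc n \<and> (\<forall>m. \<not> feasible ?p ?t m))"
      using da_done[of ?p ?t "arr s' ''ptr''" "arr s' H" "arr s' ''thr''" "var s' ''cur''"]
      by (auto simp: da_ok_def env_def)
  qed
qed

text \<open>Arrays have arbitrary contents beyond the agents, so they can be identified with
  functions such as \<open>search_start\<close> only below \<open>n\<close>.\<close>

lemma feasible_cong:
  assumes "\<And>i. i < n \<Longrightarrow> p i = p' i" "\<And>i. i < n \<Longrightarrow> t i = t' i"
  shows "feasible p t m \<longleftrightarrow> feasible p' t' m"
  using assms by (auto simp: feasible_def)

lemma da_result_cong:
  assumes "\<And>i. i < n \<Longrightarrow> p i = p' i" "\<And>i. i < n \<Longrightarrow> t i = t' i"
  shows "da_result p t q h m \<longleftrightarrow> da_result p' t' q h m"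
  using assms feasible_cong[OF assms] by (simp add: da_result_def)

lemma da_result_less: "da_result p t q h m \<Longrightarrow> i < n \<Longrightarrow> m i < n \<and> h i < n"
  using permutes_in_image[of m "{..<n}" i] permutes_in_image[OF permutes_inv, of m "{..<n}" i]
  by (auto simp: da_result_def)

lemma search_correct:
  assumes H: "H \<notin> {''pref'', ''rank'', ''ptr'', ''thr''}" and env: "env s"
    and xy: "x \<noteq> ''i''" "y \<noteq> ''i''" "var s x = u" "var s y = w" "u < n" "w < n"
  shows "runs W (search_prog H x y) s (160 * (n + 1) * (n + 1)) (\<lambda>s'. env s' \<and>
    (var s' ''m'' = n \<and> (\<exists>m. traces u w m \<and> m permutes {..<n} \<and>
        (\<forall>i<n. arr s' ''ptr'' i = r i (m i) \<and> arr s' H i = inv m i)) \<or>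
     var s' ''m'' = Suc n \<and> (\<forall>s. stable s \<longrightarrow> s u = w \<longrightarrow> s w = u)))"
proof -
  have H': "H \<noteq> ''pref''" "H \<noteq> ''rank''" "H \<noteq> ''ptr''" "H \<noteq> ''thr''"
    "''pref'' \<noteq> H" "''rank'' \<noteq> H" "''ptr'' \<noteq> H" "''thr'' \<noteq> H"
    using H by auto
  define body where "body = Seq (Store ''ptr'' (Var ''i'') (Const 0))
       (Seq (Store H (Var ''i'') (Var ''n''))
         (If (Op Less (table ''rank'' (Var x) (Var y)) (table ''rank'' (Var x) (Var ''i'')))
           (Store ''thr'' (Var ''i'') (Var ''n''))
           (Store ''thr'' (Var ''i'') (table ''rank'' (Var ''i'') (Var x)))))"
  define I where "I i s' \<longleftrightarrow> env s' \<and> var s' x = u \<and> var s' y = w \<and>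
    (\<forall>j<i. arr s' ''ptr'' j = 0 \<and> arr s' H j = n \<and> arr s' ''thr'' j = search_limit u w j)"
    for i and s' :: state
  define upd where "upd = Store ''ptr'' (Var x) (table ''rank'' (Var x) (Var y) \<oplus> Const 1)"
  define Q where "Q s' \<longleftrightarrow> env s' \<and> (\<forall>j<n. arr s' ''ptr'' j = search_start u w j \<and>
    arr s' H j = n \<and> arr s' ''thr'' j = search_limit u w j)" for s' :: state
  have body_W: "steps body \<le> 30" "steps upd \<le> 12" by (simp_all add: body_def upd_def)
  have loop: "runs W (For ''i'' ''n'' body) s ((steps body + 10) * (n + 1)) (I n)"
  proof (rule runs_For_wp[where I = I])
    fix i s' assume i: "i < n" "I i s'" "var s' ''i'' = i" "var s' ''n'' = n"
    then have look: "arr s' ''rank'' (u * n + w) = r u w" "arr s' ''rank'' (u * n + i) = r u i"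
      "arr s' ''rank'' (i * n + u) = r i u"
      using xy by (auto simp: I_def env_def)
    show "wp W body (\<lambda>s''. var s'' ''i'' = i \<and> var s'' ''n'' = n \<and> I (Suc i) (s''\<lparr>var := (var s'')(''i'' := Suc i)\<rparr>)) s'"
      using i look xy H' index_W[of u w] index_W[of u i] index_W[of i u] row_W[of u] row_W[of i]
      by (simp add: I_def body_def env_def search_limit_def of_bool_def less_Suc_eq)
  qed (use env xy in \<open>auto simp: I_def env_def\<close>)
  have upd: "runs W upd s' (steps upd) Q" if s': "I n s'" for s'
  proof (rule runs_wp)
    have "var s' ''n'' = n" "arr s' ''rank'' (u * n + w) = r u w"
      using s' xy by (auto simp: I_def env_def)
    then show "wp W upd Q s'"
      using s' xy H' index_W[of u w] row_W[of u]
      by (auto simp: I_def upd_def Q_def env_def search_start_def)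
  qed
  have da: "runs W (da_prog H) s' (100 * (n + 1) * (n + 1)) (\<lambda>s'. env s' \<and>
    (var s' ''m'' = n \<and> (\<exists>m. traces u w m \<and> m permutes {..<n} \<and>
        (\<forall>i<n. arr s' ''ptr'' i = r i (m i) \<and> arr s' H i = inv m i)) \<or>
     var s' ''m'' = Suc n \<and> (\<forall>s. stable s \<longrightarrow> s u = w \<longrightarrow> s w = u)))" if s': "Q s'" for s'
  proof -
    let ?p = "arr s' ''ptr''" and ?t = "arr s' ''thr''"
    have eq: "?p i = search_start u w i" "?t i = search_limit u w i" if "i < n" for i
      using s' that by (auto simp: Q_def)
    \<comment> \<open>The starting position reaches \<open>n\<close> when \<open>w\<close> is last
      in the list of \<open>u\<close>; such a run fails unless it has already failed before the turn
      of \<open>u\<close>.\<close>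
    have "search_start u w i \<le> n" "search_limit u w i \<le> n" if "i < n" for i
      using that xy by (simp_all add: search_start_def search_limit_def Suc_le_eq less_imp_le)
    then have "runs W (da_prog H) s' (100 * (n + 1) * (n + 1)) (\<lambda>s''. env s'' \<and>
       (var s'' ''m'' = n \<and> (\<exists>m. da_result ?p ?t (arr s'' ''ptr'') (arr s'' H) m) \<or>
       var s'' ''m'' = Suc n \<and> (\<forall>m. \<not> feasible ?p ?t m)))"
      using s' eq by (intro da_correct[OF H]) (auto simp: Q_def)
    then show ?thesis
    proof (rule runs_mono)
      fix s''
      assume "env s'' \<and> (var s'' ''m'' = n \<and> (\<exists>m. da_result ?p ?t (arr s'' ''ptr'') (arr s'' H) m) \<or>
       var s'' ''m'' = Suc n \<and> (\<forall>m. \<not> feasible ?p ?t m))"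
      moreover have "traces u w m \<and> m permutes {..<n} \<and>
        (\<forall>i<n. arr s'' ''ptr'' i = r i (m i) \<and> arr s'' H i = inv m i)"
        if "da_result ?p ?t (arr s'' ''ptr'') (arr s'' H) m" for m
      proof -
        have "da_result (search_start u w) (search_limit u w) (arr s'' ''ptr'') (arr s'' H) m"
          using that da_result_cong[of ?p "search_start u w" ?t "search_limit u w"] eq by simp
        then show ?thesis using search_traces[OF xy(5,6)] by (auto simp: da_result_def)
      qed
      moreover have "s w = u" if "\<forall>m. \<not> feasible ?p ?t m" "stable s" "s u = w" for s
        using that search_feasible[OF that(2) xy(5,6) that(3)]
          feasible_cong[of ?p "search_start u w" ?t "search_limit u w"] eq by auto
      ultimately show "env s'' \<and>
        (var s'' ''m'' = n \<and> (\<exists>m. traces u w m \<and> m permutes {..<n} \<and>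
          (\<forall>i<n. arr s'' ''ptr'' i = r i (m i) \<and> arr s'' H i = inv m i)) \<or>
        var s'' ''m'' = Suc n \<and> (\<forall>s. stable s \<longrightarrow> s u = w \<longrightarrow> s w = u))"
        by blast
    qed simp
  qed
  show ?thesis
    unfolding search_prog_def body_def[symmetric] upd_def[symmetric]
  proof (rule runs_mono[OF runs_Seq[OF loop runs_Seq[OF upd da]]])
    have "(steps body + 10) * (n + 1) \<le> 40 * (n + 1)" using body_W by (intro mult_le_mono1) simp
    then show "(steps body + 10) * (n + 1) + (steps upd + 100 * (n + 1) * (n + 1)) \<le> 160 * (n + 1) * (n + 1)"
      using body_W by (simp add: algebra_simps)
  qed auto
qed

lemma walk_correct:
  assumes env: "env s" and ab: "var s ''a'' = a" "var s ''b'' = b" "a < n" "b < n"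
    and range: "\<And>i. i < n \<Longrightarrow> arr s ''h1'' i < n" "\<And>i. i < n \<Longrightarrow> arr s ''h2'' i < n"
    and follow: "\<And>C t k. \<lbrakk>completion {..<n} P a b t C; k < length C\<rbrakk> \<Longrightarrow>
      (if odd k then arr s ''h1'' else arr s ''h2'') (C ! k) = C ! (Suc k mod length C)"
  shows "runs W walk_prog s (60 * (n + 1)) (\<lambda>s'. env s' \<and> even (var s' ''len'') \<and>
    2 \<le> var s' ''len'' \<and> var s' ''len'' \<le> n \<and> var s' ''cur'' < n \<and>
    (\<forall>k < var s' ''len''. arr s' ''cycle'' k < n) \<and> arr s' ''cycle'' 0 = a \<and> arr s' ''cycle'' 1 = b \<and>
    (\<forall>C t. completion {..<n} P a b t C \<longrightarrow> var s' ''cur'' = a \<and> var s' ''len'' = length C \<and>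
      (\<forall>k < length C. arr s' ''cycle'' k = C ! k)))"
proof -
  define h1 h2 where "h1 = arr s ''h1''" and "h2 = arr s ''h2''"
  have even_n: "even n" using inst by (simp add: sr_instance_def)
  \<comment> \<open>The bounds hold for any contents of the arrays; agreement with a cycle is
    claimed only for completions that exist, and then for the prefix written so far.\<close>
  define J where "J s' \<longleftrightarrow> env s' \<and> var s' ''a'' = a \<and> arr s' ''h1'' = h1 \<and> arr s' ''h2'' = h2 \<and>
    even (var s' ''len'') \<and> 2 \<le> var s' ''len'' \<and> var s' ''len'' \<le> n \<and> var s' ''cur'' < n \<and>
    (\<forall>k < var s' ''len''. arr s' ''cycle'' k < n) \<and> arr s' ''cycle'' 0 = a \<and> arr s' ''cycle'' 1 = b \<and>
    (\<forall>C t. completion {..<n} P a b t C \<longrightarrow> var s' ''len'' \<le> length C \<and>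
      (\<forall>k < var s' ''len''. arr s' ''cycle'' k = C ! k) \<and>
      var s' ''cur'' = C ! (var s' ''len'' mod length C))" for s' :: state
  define test where "test = Op Mul (Op Less (Var ''len'') (Var ''n'')) (Op Sub (Const 1) (Op Equal (Var ''cur'') (Var ''a'')))"
  define body where "body = Seq (Store ''cycle'' (Var ''len'') (Var ''cur''))
        (Seq (Assign ''cur'' (Cell ''h2'' (Var ''cur'')))
        (Seq (Store ''cycle'' (Var ''len'' \<oplus> Const 1) (Var ''cur''))
        (Seq (Assign ''cur'' (Cell ''h1'' (Var ''cur'')))
          (Assign ''len'' (Var ''len'' \<oplus> Const 2)))))"
  define pre where "pre = Seq (Store ''cycle'' (Const 0) (Var ''a''))
    (Seq (Store ''cycle'' (Const 1) (Var ''b''))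
    (Seq (Assign ''cur'' (Cell ''h1'' (Var ''b'')))
      (Assign ''len'' (Const 2))))"
  have comp: "even (length C)" "2 < length C" "C ! 0 = a" "C ! Suc 0 = b" if "completion {..<n} P a b t C" for C t
    using that by (auto simp: completion_def)
  have h_n: "h1 i < n" "h2 i < n" if "i < n" for i using range that by (auto simp: h1_def h2_def)
  have body: "runs W body s' (steps body) (\<lambda>s''. J s'' \<and> n - var s'' ''len'' < n - var s' ''len'')"
    if s': "J s'" "val test s' \<noteq> 0" for s'
  proof (rule runs_wp)
    define l c where "l = var s' ''len''" and "c = var s' ''cur''"
    have n: "var s' ''n'' = n" using s' by (simp add: J_def env_def)
    have l: "l < n" "c \<noteq> a" "even l" "2 \<le> l" "c < n"
      using s' n by (auto simp: J_def test_def l_def c_def)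
    \<comment> \<open>Both \<open>l\<close> and \<open>n\<close> are even, so \<open>l < n\<close>
      leaves room for two more entries.\<close>
    then have l2: "Suc (Suc l) \<le> n" using even_n by presburger
    have "Suc (Suc l) \<le> length C \<and> c = C ! l \<and> h2 c = C ! Suc l \<and>
        h1 (h2 c) = C ! (Suc (Suc l) mod length C)" if C: "completion {..<n} P a b t C" for C t
    proof -
      have c: "l \<le> length C" "c = C ! (l mod length C)"
        using s'(1) C by (auto simp: J_def l_def c_def)
      have "l \<noteq> length C" using c comp(3)[OF C] l(2) by auto
      then have less: "l < length C" using c by simp
      then have "Suc l < length C" using l(3) comp(1)[OF C] by presburger
      then show ?thesis
        using follow[OF C less] follow[OF C \<open>Suc l < length C\<close>] c less l(3)
        by (simp add: h1_def h2_def)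
    qed
    then have compl: "\<forall>C t. completion {..<n} P a b t C \<longrightarrow> Suc (Suc l) \<le> length C \<and> c = C ! l \<and> h2 c = C ! Suc l \<and>
        h1 (h2 c) = C ! (Suc (Suc l) mod length C)" by blast
    have W: "l < W" "Suc l < W" "Suc (Suc l) < W" "c < W" "h2 c < W" "h1 (h2 c) < W" "h1 (h2 c) < n" "h2 c < n"
      using l l2 h_n[of c] h_n[of "h2 c"] by (auto intro: small)
    show "wp W body (\<lambda>s''. J s'' \<and> n - var s'' ''len'' < n - var s' ''len'') s'"
      using s'(1) compl W l l2
      by (auto simp: J_def body_def l_def[symmetric] c_def[symmetric] less_Suc_eq env_def)
  qed
  have loop: "runs W (While test body) s' ((cost test + 1 + steps body) * (n + 1)) (\<lambda>s''. J s'' \<and> val test s'' = 0)"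
    if "J s'" for s'
  proof (rule runs_While[where f = "\<lambda>s'. n - var s' ''len''"])
    show "fits W test s1" if "J s1" for s1
    proof -
      have "var s1 ''n'' = n" "var s1 ''len'' < W" "var s1 ''cur'' < W" "var s1 ''a'' < W"
        using that ab by (auto simp: J_def env_def intro: small)
      then show ?thesis by (simp add: test_def of_bool_def)
    qed
  qed (use that body in auto)
  have init: "runs W pre s (steps pre) J"
  proof (rule runs_wp)
    have "2 \<le> length C \<and> C ! 0 = a \<and> C ! Suc 0 = b \<and> h1 b = C ! (2 mod length C)" if "completion {..<n} P a b t C" for C t
      using comp[OF that] follow[OF that, of 1] by (simp add: h1_def numeral_2_eq_2)
    then have compl: "\<forall>C t. completion {..<n} P a b t C \<longrightarrow> 2 \<le> length C \<and> C ! 0 = a \<and> C ! Suc 0 = b \<and> h1 b = C ! (2 mod length C)"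
      by blast
    show "wp W pre J s"
      using env ab two compl h_n[OF ab(4)] less_W
      by (auto simp: pre_def J_def env_def h1_def[symmetric] h2_def[symmetric] less_2_cases_iff)
  qed
  have exec: "runs W walk_prog s (steps pre + (cost test + 1 + steps body) * (n + 1)) (\<lambda>s''. J s'' \<and> val test s'' = 0)"
    using runs_Seq[OF init loop] unfolding walk_prog_def pre_def test_def body_def .
  show ?thesis
  proof (rule runs_mono[OF exec])
    show "steps pre + (cost test + 1 + steps body) * (n + 1) \<le> 60 * (n + 1)"
      by (simp add: pre_def test_def body_def)
    fix s' assume s': "J s' \<and> val test s' = 0"
    have "var s' ''cur'' = a \<and> var s' ''len'' = length C \<and> (\<forall>k < length C. arr s' ''cycle'' k = C ! k)"
      if C: "completion {..<n} P a b t C" for C t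
    proof -
      have J: "var s' ''len'' \<le> length C" "\<forall>k < var s' ''len''. arr s' ''cycle'' k = C ! k"
        "var s' ''cur'' = C ! (var s' ''len'' mod length C)" "2 \<le> var s' ''len''"
        using s' C by (auto simp: J_def)
      \<comment> \<open>Stopping early is impossible: before the end of \<open>C\<close> the current
        agent differs from \<open>a\<close> by distinctness, and the length is still below
        \<open>n\<close>.\<close>
      have "var s' ''len'' = length C"
      proof (rule ccontr)
        assume "\<not> ?thesis"
        then have less: "var s' ''len'' < length C" using J(1) by simp
        have C': "distinct C" "set C \<subseteq> {..<n}" "C ! 0 = a"
          using C by (auto simp: completion_def is_cycle_of_def)
        have "length C \<le> n" using C'(1,2) card_mono[of "{..<n}" "set C"] by (simp add: distinct_card)
        moreover have "var s' ''cur'' \<noteq> a"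
        proof
          assume "var s' ''cur'' = a"
          then have "C ! var s' ''len'' = C ! 0" using J(3) less C'(3) by simp
          moreover have "0 < length C" using less by linarith
          ultimately have "var s' ''len'' = 0" using nth_eq_iff_index_eq[OF C'(1) less] by blast
          then show False using J(4) by simp
        qed
        ultimately show False using s' less by (auto simp: test_def J_def env_def)
      qed
      then show ?thesis using J(2,3) comp(3)[OF C] by simp
    qed
    then show "env s' \<and> even (var s' ''len'') \<and>
      2 \<le> var s' ''len'' \<and> var s' ''len'' \<le> n \<and> var s' ''cur'' < n \<and>
      (\<forall>k < var s' ''len''. arr s' ''cycle'' k < n) \<and> arr s' ''cycle'' 0 = a \<and> arr s' ''cycle'' 1 = b \<and>
      (\<forall>C t. completion {..<n} P a b t C \<longrightarrow> var s' ''cur'' = a \<and> var s' ''len'' = length C \<and>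
        (\<forall>k < length C. arr s' ''cycle'' k = C ! k))"
      using s' by (auto simp: J_def)
  qed
qed

lemma limits_correct:
  assumes env: "env s" and ab: "var s ''a'' = a" "var s ''b'' = b" "a < n" "b < n"
    and L: "var s ''len'' = L" "2 < L" "L \<le> n"
    and range: "\<And>k. k < L \<Longrightarrow> arr s ''cycle'' k < n" and c01: "arr s ''cycle'' 0 = a" "arr s ''cycle'' 1 = b"
  defines "c \<equiv> (arr s ''cycle'')(L := a, Suc L := b)"
  shows "runs W limits_prog s (400 * (n + 1) * (n + 1)) (\<lambda>s'. env s' \<and> var s' ''len'' = L \<and>
    arr s' ''cycle'' = c \<and>
    (\<forall>i<n. arr s' ''ptr'' i \<le> n \<and> arr s' ''thr'' i \<le> n \<and> arr s' ''h3'' i = n) \<and>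
    (\<forall>i<n. i \<notin> c ` {1..L} \<longrightarrow> arr s' ''ptr'' i = 0) \<and>
    (\<forall>k<L. arr s' ''pos'' (c (Suc k)) < n) \<and>
    (inj_on c {1..L} \<longrightarrow> (\<forall>k<L. arr s' ''pos'' (c (Suc k)) = k \<and>
       arr s' ''ptr'' (c (Suc k)) = r (c (Suc k)) (c (Suc (Suc k))))) \<and>
    cycle_bounds c L (arr s' ''thr''))"
proof -
  have c_n: "c k < n" if "k \<le> Suc L" for k
    using that range[of k] ab by (auto simp: c_def)
  define init where "init = Seq (Store ''ptr'' (Var ''i'') (Const 0))
       (Seq (Store ''h3'' (Var ''i'') (Var ''n'')) (Store ''thr'' (Var ''i'') (Var ''n'')))"
  define inner where "inner = Seq (Assign ''y'' (table ''pref'' (Var ''c'') (Var ''q'')))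
            (Seq (Assign ''v'' (table ''rank'' (Var ''y'') (Var ''c'') \<oplus> Op Equal (Var ''y'') (Var ''z'')))
              (If (Op Less (Var ''v'') (Cell ''thr'' (Var ''y'')))
                (Store ''thr'' (Var ''y'') (Var ''v''))
                Skip))"
  define base where "base s' \<longleftrightarrow> env s' \<and> var s' ''len'' = L \<and> arr s' ''cycle'' = c" for s' :: state
  define I where "I i s' \<longleftrightarrow> base s' \<and> (\<forall>j<i. arr s' ''ptr'' j = 0 \<and> arr s' ''thr'' j = n \<and> arr s' ''h3'' j = n)"
    for i and s' :: state
  \<comment> \<open>\<open>lower\<close> and \<open>upper\<close> are the two halves of
    \<open>cycle_bounds\<close>, separated because during the scan of a list the stored values may
    already come from the new agent, while its constraints are not yet all enforced.\<close>
  define lower where "lower k t \<longleftrightarrow>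
    (\<forall>j<k. \<forall>y<n. r (c (Suc j)) y < r (c (Suc j)) (c j) \<longrightarrow> t y \<le> cycle_limit c j y)" for k and t :: "nat \<Rightarrow> nat"
  define upper where "upper k t \<longleftrightarrow> (\<forall>y<n. t y \<le> n \<and> (t y = n \<or>
    (\<exists>j<k. r (c (Suc j)) y < r (c (Suc j)) (c j) \<and> t y = cycle_limit c j y)))" for k and t :: "nat \<Rightarrow> nat"
  define rest where "rest k s' \<longleftrightarrow> base s' \<and>
    (\<forall>i<n. arr s' ''ptr'' i \<le> n \<and> arr s' ''h3'' i = n) \<and>
    (\<forall>i<n. i \<notin> c ` {1..L} \<longrightarrow> arr s' ''ptr'' i = 0) \<and>
    (\<forall>j<k. arr s' ''pos'' (c (Suc j)) < n) \<and>
    (inj_on c {1..L} \<longrightarrow> (\<forall>j<k. arr s' ''pos'' (c (Suc j)) = j \<and>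
       arr s' ''ptr'' (c (Suc j)) = r (c (Suc j)) (c (Suc (Suc j)))))" for k and s' :: state
  define J where "J k s' \<longleftrightarrow> rest k s' \<and> lower k (arr s' ''thr'') \<and> upper k (arr s' ''thr'')" for k and s' :: state
  define JJ where "JJ k q s' \<longleftrightarrow> rest (Suc k) s' \<and> lower k (arr s' ''thr'') \<and> upper (Suc k) (arr s' ''thr'') \<and>
    var s' ''k'' = k \<and> var s' ''c'' = c (Suc k) \<and> var s' ''z'' = c (Suc (Suc k)) \<and>
    (\<forall>q'<q. arr s' ''thr'' (choice (c (Suc k)) q') \<le> cycle_limit c k (choice (c (Suc k)) q'))"
    for k q and s' :: state
  define head where "head = Seq (Assign ''c'' (Cell ''cycle'' (Var ''k'' \<oplus> Const 1)))
        (Seq (Assign ''z'' (Cell ''cycle'' (Var ''k'' \<oplus> Const 2)))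
        (Seq (Store ''ptr'' (Var ''c'') (table ''rank'' (Var ''c'') (Var ''z'')))
        (Seq (Store ''pos'' (Var ''c'') (Var ''k''))
          (Assign ''top'' (table ''rank'' (Var ''c'') (Cell ''cycle'' (Var ''k'')))))))"
  define stores where "stores = Seq (Store ''cycle'' (Var ''len'') (Var ''a''))
           (Store ''cycle'' (Var ''len'' \<oplus> Const 1) (Var ''b''))"
  have steps: "steps stores = 8" "steps init = 9" "steps inner \<le> 40" "steps head \<le> 40"
    by (simp_all add: stores_def init_def inner_def head_def)

  have 1: "runs W stores s (steps stores) base"
    using env ab L by (intro runs_wp) (auto simp: stores_def base_def env_def c_def intro: small)
  have 2: "runs W (For ''i'' ''n'' init) s' ((steps init + 10) * (n + 1)) (J 0)" if s': "base s'" for s'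
  proof (rule runs_For_wp[where I = I])
    show "var s' ''n'' = n" using s' by (simp add: base_def env_def)
    fix i s1 assume "i < n" "I i s1" "var s1 ''i'' = i" "var s1 ''n'' = n"
    then show "wp W init (\<lambda>s''. var s'' ''i'' = i \<and> var s'' ''n'' = n \<and> I (Suc i) (s''\<lparr>var := (var s'')(''i'' := Suc i)\<rparr>)) s1"
      by (auto simp: init_def I_def base_def env_def less_Suc_eq)
  qed (use s' in \<open>auto simp: I_def J_def base_def env_def rest_def lower_def upper_def\<close>)

  have inner: "runs W (For ''q'' ''top'' inner) s' (50 * (n + 1))
      (\<lambda>s''. var s'' ''k'' = k \<and> var s'' ''len'' = L \<and> J (Suc k) (s''\<lparr>var := (var s'')(''k'' := Suc k)\<rparr>))"
    if k: "k < L" and s': "JJ k 0 s'" "var s' ''top'' = r (c (Suc k)) (c k)" for k s'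
  proof -
    define x top where "x = c (Suc k)" and "top = r (c (Suc k)) (c k)"
    have x: "x < n" "top < n" "c (Suc (Suc k)) < n"
      using c_n[of "Suc k"] c_n[of k] c_n[of "Suc (Suc k)"] k by (auto simp: x_def top_def)
    have "runs W (For ''q'' ''top'' inner) s' ((steps inner + 10) * (top + 1))
      (\<lambda>s''. var s'' ''k'' = k \<and> var s'' ''len'' = L \<and> J (Suc k) (s''\<lparr>var := (var s'')(''k'' := Suc k)\<rparr>))"
    proof (rule runs_For_wp[where I = "JJ k"])
      show "JJ k 0 (s'\<lparr>var := (var s')(''q'' := 0)\<rparr>)"
        using s'(1) by (simp add: JJ_def rest_def base_def env_def)
      fix q s1 assume q: "q < top" "JJ k q s1" "var s1 ''q'' = q" "var s1 ''top'' = top"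
      define y where "y = choice x q"
      have y: "y < n" "r x y = q" using q(1) x by (auto simp: y_def)
      have n: "var s1 ''n'' = n" and look: "arr s1 ''pref'' (x * n + q) = y" "arr s1 ''rank'' (y * n + x) = r y x"
        and var: "var s1 ''c'' = x" "var s1 ''z'' = c (Suc (Suc k))"
        using q x y by (auto simp: JJ_def rest_def base_def env_def y_def x_def)
      define v where "v = cycle_limit c k y"
      have v: "v = r y x + of_bool (y = c (Suc (Suc k)))" by (simp add: v_def cycle_limit_def x_def)
      have v_n: "v \<le> n" using rank_less_n[OF y(1) x(1)] v by auto
      define t where "t = arr s1 ''thr''"
      have t: "lower k t" "upper (Suc k) t" "\<And>q'. q' < q \<Longrightarrow> t (choice x q') \<le> cycle_limit c k (choice x q')"
        using q(2) by (auto simp: JJ_def t_def x_def)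
      have t_n: "t y \<le> n" using t(2) y by (auto simp: upper_def)
      have less: "r x y < r x (c k)" using y q(1) by (simp add: top_def x_def)
      have upd: "lower k (t(y := v))" "upper (Suc k) (t(y := v))"
        "\<And>q'. q' < Suc q \<Longrightarrow> (t(y := v)) (choice x q') \<le> cycle_limit c k (choice x q')" if "v < t y"
      proof -
        show "lower k (t(y := v))" using t(1) that unfolding lower_def by (auto intro: less_imp_le order_trans)
        show "upper (Suc k) (t(y := v))" using t(2) v_n less unfolding upper_def x_def by (auto simp: v_def)
        show "(t(y := v)) (choice x q') \<le> cycle_limit c k (choice x q')" if "q' < Suc q" for q'
          using t(3)[of q'] that by (auto simp: less_Suc_eq v_def y_def)
      qed
      have keep: "t (choice x q') \<le> cycle_limit c k (choice x q')" if "\<not> v < t y" "q' < Suc q" for q'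
        using t(3)[of q'] that by (auto simp: less_Suc_eq v_def y_def)
      have fit: "x < W" "q < W" "x * n < W" "x * n + q < W" "y < W" "y * n < W" "y * n + x < W" "r y x < W"
        "c (Suc (Suc k)) < W" "v < W" "t y < W"
        using x y q(1) v_n t_n by (auto intro: index_W row_W small)
      show "wp W inner (\<lambda>s''. var s'' ''q'' = q \<and> var s'' ''top'' = top \<and> JJ k (Suc q) (s''\<lparr>var := (var s'')(''q'' := Suc q)\<rparr>)) s1"
        using q(2-4) n look var fit t(1,2) upd keep x v
        by (simp add: inner_def JJ_def rest_def base_def env_def t_def[symmetric] x_def[symmetric])
    next
      fix s1 assume s1: "JJ k top s1" "var s1 ''top'' = top"
      have "arr s1 ''thr'' y \<le> cycle_limit c k y" if "y < n" "r x y < top" for y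
        using s1(1) that x choice_rank[OF x(1) that(1)] unfolding JJ_def x_def by metis
      then have "lower (Suc k) (arr s1 ''thr'')"
        using s1(1) by (auto simp: JJ_def lower_def less_Suc_eq x_def top_def)
      then show "var s1 ''k'' = k \<and> var s1 ''len'' = L \<and> J (Suc k) (s1\<lparr>var := (var s1)(''k'' := Suc k)\<rparr>)"
        using s1(1) by (simp add: JJ_def J_def rest_def base_def env_def)
    qed (use s' x in \<open>auto simp: top_def\<close>)
    then show ?thesis
    proof (rule runs_mono)
      show "(steps inner + 10) * (top + 1) \<le> 50 * (n + 1)" using steps(3) x(2) by (intro mult_le_mono) auto
    qed simp
  qed

  have head: "runs W head s' (steps head) (\<lambda>s''. JJ k 0 s'' \<and> var s'' ''top'' = r (c (Suc k)) (c k))"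
    if k: "k < L" and s': "J k s'" "var s' ''k'' = k" for k s'
  proof (rule runs_wp)
    define x z y where "x = c (Suc k)" and "z = c (Suc (Suc k))" and "y = c k"
    have x: "x < n" "z < n" "y < n"
      using c_n[of "Suc k"] c_n[of k] c_n[of "Suc (Suc k)"] k by (auto simp: x_def z_def y_def)
    have s'': "var s' ''n'' = n" "arr s' ''rank'' (x * n + z) = r x z" "arr s' ''rank'' (x * n + y) = r x y"
      "arr s' ''cycle'' = c"
      using s'(1) x by (auto simp: J_def rest_def base_def env_def)
    have fit: "k < W" "Suc k < W" "Suc (Suc k) < W" "k < n"
      using k L by (auto intro: small)
    \<comment> \<open>Without repetitions, the new writes to \<open>ptr\<close> and
      \<open>pos\<close> leave the entries of earlier cycle agents intact.\<close>
    have inj: "c (Suc j) \<noteq> x" if "inj_on c {1..L}" "j < k" for j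
      using inj_onD[OF that(1), of "Suc j" "Suc k"] that(2) k by (auto simp: x_def)
    have "upper (Suc k) (arr s' ''thr'')"
      using s'(1) unfolding J_def upper_def by (meson less_SucI)
    moreover have "rest (Suc k) (s'\<lparr>arr := (arr s')(''ptr'' := (arr s' ''ptr'')(x := r x z), ''pos'' := (arr s' ''pos'')(x := k))\<rparr>)"
      unfolding rest_def
    proof (intro conjI)
      show "base (s'\<lparr>arr := (arr s')(''ptr'' := (arr s' ''ptr'')(x := r x z), ''pos'' := (arr s' ''pos'')(x := k))\<rparr>)"
        using s'(1) by (simp add: J_def rest_def base_def env_def)
    qed (use s'(1) x fit inj k less_imp_le[OF rank_less_n[OF x(1,2)]] in
        \<open>auto simp: J_def rest_def less_Suc_eq x_def z_def\<close>)
    ultimately show "wp W head (\<lambda>s''. JJ k 0 s'' \<and> var s'' ''top'' = r (c (Suc k)) (c k)) s'"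
      using s' s'' x fit index_W[of x z] index_W[of x y] row_W[of x]
      by (simp add: head_def JJ_def J_def rest_def base_def env_def x_def[symmetric] y_def[symmetric] z_def[symmetric])
  qed
  have 3: "runs W (For ''k'' ''len'' (Seq head (For ''q'' ''top'' inner))) s' ((steps head + 50 * (n + 1) + 10) * (L + 1)) (J L)"
    if s': "J 0 s'" for s'
  proof (rule runs_For[where I = J])
    show "J 0 (s'\<lparr>var := (var s')(''k'' := 0)\<rparr>)" using s' by (simp add: J_def rest_def base_def env_def)
    show "var s' ''len'' = L" using s' by (simp add: J_def rest_def base_def)
    show "L < W" using L by (auto intro: small)
    fix k s1 assume k: "k < L" "J k s1" "var s1 ''k'' = k" "var s1 ''len'' = L"
    show "runs W (Seq head (For ''q'' ''top'' inner)) s1 (steps head + 50 * (n + 1))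
      (\<lambda>s''. var s'' ''k'' = k \<and> var s'' ''len'' = L \<and> J (Suc k) (s''\<lparr>var := (var s'')(''k'' := Suc k)\<rparr>))"
      by (rule runs_Seq[OF head[OF k(1,2,3)]]) (use inner[OF k(1)] in blast)
  qed auto
  have "runs W limits_prog s (steps stores + ((steps init + 10) * (n + 1) + (steps head + 50 * (n + 1) + 10) * (L + 1))) (J L)"
    unfolding limits_prog_def stores_def[symmetric] init_def[symmetric] inner_def[symmetric] head_def[symmetric]
    by (rule runs_Seq[OF 1 runs_Seq[OF 2 3]])
  then show ?thesis
  proof (rule runs_mono)
    have "(steps head + 50 * (n + 1) + 10) * (L + 1) \<le> (100 + 50 * n) * (n + 1)"
      using steps L by (intro mult_le_mono) auto
    then show "steps stores + ((steps init + 10) * (n + 1) + (steps head + 50 * (n + 1) + 10) * (L + 1)) \<le> 400 * (n + 1) * (n + 1)"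
      using steps by (simp add: algebra_simps)
  qed (auto simp: J_def rest_def base_def lower_def upper_def cycle_bounds_def)
qed

lemma verify_correct:
  assumes env: "env s" and L: "var s ''len'' = L" "L \<le> n" and found: "var s ''found'' = 0"
    and c: "\<And>k. k \<le> Suc L \<Longrightarrow> c k < n" "arr s ''cycle'' = c"
    and pos: "\<And>k. k < L \<Longrightarrow> arr s ''pos'' (c (Suc k)) < n"
    and ptr: "\<And>i. i < n \<Longrightarrow> arr s ''ptr'' i < n \<and> arr s ''h3'' i < n"
  defines "good \<equiv> (\<forall>k<L. arr s ''pos'' (c (Suc k)) = k \<and> arr s ''ptr'' (c (Suc k)) = r (c (Suc k)) (c (Suc (Suc k))))
      \<and> (\<forall>i<n. arr s ''ptr'' i \<le> r i (arr s ''h3'' i))"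
  shows "runs W verify_prog s (200 * (n + 1)) (\<lambda>s'. arr s' ''cycle'' = c \<and>
    (if good then var s' ''found'' = 1 \<and> var s' ''length'' = L else var s' ''found'' = 0))"
proof -
  define g1 where "g1 k \<longleftrightarrow> (\<forall>j<k. arr s ''pos'' (c (Suc j)) = j \<and> arr s ''ptr'' (c (Suc j)) = r (c (Suc j)) (c (Suc (Suc j))))" for k
  define g2 where "g2 i \<longleftrightarrow> (\<forall>j<i. arr s ''ptr'' j \<le> r j (arr s ''h3'' j))" for i
  define base where "base s' \<longleftrightarrow> env s' \<and> var s' ''len'' = L \<and> arr s' = arr s \<and> var s' ''found'' = 0 \<and> var s' ''bad'' \<le> 1" for s' :: state
  define I where "I k s' \<longleftrightarrow> base s' \<and> (var s' ''bad'' = 0 \<longleftrightarrow> g1 k)" for k and s' :: state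
  define J where "J i s' \<longleftrightarrow> base s' \<and> (var s' ''bad'' = 0 \<longleftrightarrow> g1 L \<and> g2 i)" for i and s' :: state
  define b1 where "b1 = Seq (Assign ''c'' (Cell ''cycle'' (Var ''k'' \<oplus> Const 1)))
        (Seq (Assign ''z'' (Cell ''cycle'' (Var ''k'' \<oplus> Const 2)))
          (If (Op Mul (Op Equal (Cell ''pos'' (Var ''c'')) (Var ''k''))
                (Op Equal (Cell ''ptr'' (Var ''c'')) (table ''rank'' (Var ''c'') (Var ''z''))))
            Skip (Assign ''bad'' (Const 1))))"
  define b2 where "b2 = If (Op Less (table ''rank'' (Var ''i'') (Cell ''h3'' (Var ''i''))) (Cell ''ptr'' (Var ''i'')))
          (Assign ''bad'' (Const 1)) Skip"
  define fin where "fin = If (Var ''bad'') Skip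
        (Seq (Assign ''found'' (Const 1)) (Assign ''length'' (Var ''len'')))"
  have 0: "runs W (Assign ''bad'' (Const 0)) s (steps (Assign ''bad'' (Const 0))) (I 0)"
    using env L found by (intro runs_wp) (auto simp: I_def base_def env_def g1_def)
  have 1: "runs W (For ''k'' ''len'' b1) s' ((steps b1 + 10) * (L + 1)) (J 0)" if s': "I 0 s'" for s'
  proof (rule runs_For_wp[where I = I])
    show "L < W" using L by (auto intro: small)
    fix k s1 assume k: "k < L" "I k s1" "var s1 ''k'' = k" "var s1 ''len'' = L"
    define x z where "x = c (Suc k)" and "z = c (Suc (Suc k))"
    have x: "x < n" "z < n" using c(1)[of "Suc k"] c(1)[of "Suc (Suc k)"] k(1) by (auto simp: x_def z_def)
    have s1: "var s1 ''n'' = n" "arr s1 = arr s" "arr s ''rank'' (x * n + z) = r x z"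
      using k(2) env x by (auto simp: I_def base_def env_def)
    have fit: "k < W" "Suc k < W" "Suc (Suc k) < W" "x < W" "z < W" "arr s ''pos'' x < W" "arr s ''ptr'' x < W"
      using k(1) L x pos[OF k(1)] ptr[of x] by (auto intro: small simp: x_def)
    have g1: "g1 (Suc k) \<longleftrightarrow> g1 k \<and> arr s ''pos'' x = k \<and> arr s ''ptr'' x = r x z"
      by (auto simp: g1_def less_Suc_eq x_def z_def)
    show "wp W b1 (\<lambda>s''. var s'' ''k'' = k \<and> var s'' ''len'' = L \<and> I (Suc k) (s''\<lparr>var := (var s'')(''k'' := Suc k)\<rparr>)) s1"
      using k s1 fit x index_W[of x z] row_W[of x] c(2)
      by (auto simp: b1_def I_def base_def env_def g1 x_def[symmetric] z_def[symmetric] of_bool_def)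
  qed (use s' in \<open>auto simp: I_def J_def base_def env_def g2_def\<close>)
  have 2: "runs W (For ''i'' ''n'' b2) s' ((steps b2 + 10) * (n + 1)) (J n)" if s': "J 0 s'" for s'
  proof (rule runs_For_wp[where I = J])
    show "var s' ''n'' = n" using s' by (auto simp: J_def base_def env_def)
    fix i s1 assume i: "i < n" "J i s1" "var s1 ''i'' = i" "var s1 ''n'' = n"
    have s1: "arr s1 = arr s" "arr s ''rank'' (i * n + arr s ''h3'' i) = r i (arr s ''h3'' i)"
      using i env ptr[OF i(1)] by (auto simp: J_def base_def env_def)
    show "wp W b2 (\<lambda>s''. var s'' ''i'' = i \<and> var s'' ''n'' = n \<and> J (Suc i) (s''\<lparr>var := (var s'')(''i'' := Suc i)\<rparr>)) s1"
      using i s1 ptr[OF i(1)] index_W[OF i(1), of "arr s ''h3'' i"] row_W[OF i(1)]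
      by (auto simp: b2_def J_def base_def env_def g2_def less_Suc_eq of_bool_def)
  qed (use s' in \<open>auto simp: J_def base_def env_def\<close>)
  have 3: "runs W fin s' (steps fin) (\<lambda>s'. arr s' ''cycle'' = c \<and>
    (if good then var s' ''found'' = 1 \<and> var s' ''length'' = L else var s' ''found'' = 0))" if "J n s'" for s'
  proof (rule runs_wp)
    have "L < W" using L by (auto intro: small)
    moreover have "good \<longleftrightarrow> g1 L \<and> g2 n" by (simp add: good_def g1_def g2_def)
    ultimately show "wp W fin (\<lambda>s'. arr s' ''cycle'' = c \<and>
      (if good then var s' ''found'' = 1 \<and> var s' ''length'' = L else var s' ''found'' = 0)) s'"
      using that c(2) by (auto simp: fin_def J_def base_def le_Suc_eq)
  qed
  have "(steps b1 + 10) * (L + 1) \<le> (steps b1 + 10) * (n + 1)" using L by (intro mult_le_mono2) simp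
  then show ?thesis
    unfolding verify_prog_def b1_def[symmetric] b2_def[symmetric] fin_def[symmetric]
    by (intro runs_mono[OF runs_Seq[OF 0 runs_Seq[OF 1 runs_Seq[OF 2 3]]]])
      (auto simp: b1_def b2_def fin_def)
qed

section \<open>Soundness and completeness of the answer, and the total running time\<close>

definition answers :: "nat \<Rightarrow> nat \<Rightarrow> state \<Rightarrow> bool" where
  "answers a b s \<longleftrightarrow> (case result s of
     Some C \<Rightarrow> completes {..<n} P a b C | None \<Rightarrow> \<not> (\<exists>C. completes {..<n} P a b C))"

lemma answers_None:
  "var s ''found'' = 0 \<Longrightarrow> (\<And>C t. \<not> completion {..<n} P a b t C) \<Longrightarrow> answers a b s"
  by (simp add: answers_def result_def completes_iff[OF inst])

lemma runs_when_complete: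
  assumes "var s ''n'' = n" "var s ''m'' = n \<or> var s ''m'' = Suc n"
    and "var s ''m'' = n \<Longrightarrow> runs W c s t Q" "var s ''m'' = Suc n \<Longrightarrow> Q s"
  shows "runs W (when_complete c) s (t + 5) Q"
proof -
  have "runs W Skip s (steps Skip) Q" if "var s ''m'' = Suc n"
    using assms(4) that by (intro runs_wp) simp
  then have "runs W (when_complete c) s (cost (Op Equal (Var ''m'') (Var ''n'')) + 1 + (t + steps Skip)) Q"
    unfolding when_complete_def using assms by (intro runs_If) (auto intro: small)
  then show ?thesis by (rule runs_mono) simp_all
qed

text \<open>By \<open>cand\<close>, the array contains the true cycle whenever there is one. So a
  failed run refutes a completion by feasibility, and a failed check by the other parts of
  \<open>completion_passes\<close>.\<close>

lemma test_correct:
  assumes env: "env s" and ab: "var s ''a'' = a" "var s ''b'' = b" "a < n" "b < n"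
    and found: "var s ''found'' = 0"
    and L: "var s ''len'' = L" "even L" "2 < L" "L \<le> n"
    and range: "\<And>k. k < L \<Longrightarrow> arr s ''cycle'' k < n" and c01: "arr s ''cycle'' 0 = a" "arr s ''cycle'' 1 = b"
    and cand: "\<And>C t. completion {..<n} P a b t C \<Longrightarrow> L = length C \<and> (\<forall>k<L. arr s ''cycle'' k = C ! k)"
  shows "runs W (Seq limits_prog (Seq (da_prog ''h3'') (when_complete verify_prog))) s
    (705 * (n + 1) * (n + 1)) (answers a b)"
proof -
  define c where "c = (arr s ''cycle'')(L := a, Suc L := b)"
  have c_n: "c k < n" if "k \<le> Suc L" for k using that range[of k] ab by (auto simp: c_def)
  have c_ends: "c L = c 0" "c (Suc L) = c 1" "c 0 = a" "c 1 = b" using c01 L by (auto simp: c_def)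
  have cC: "L = length C" "\<And>k. k < L \<Longrightarrow> c k = C ! k" "inj_on c {1..L}"
    if C: "completion {..<n} P a b t C" for C t
  proof -
    show "L = length C" using cand[OF C] by blast
    show *: "c k = C ! k" if "k < L" for k using cand[OF C] that by (simp add: c_def)
    have C': "distinct C" "C ! 0 = a" using C by (auto simp: completion_def is_cycle_of_def)
    show "inj_on c {1..L}"
    proof (rule inj_onI)
      fix j k assume jk: "j \<in> {1..L}" "k \<in> {1..L}" "c j = c k"
      have "c i = C ! (i mod L)" if "i \<in> {1..L}" for i
        using that *[of i] c_ends C' by (cases "i = L") auto
      then have "C ! (j mod L) = C ! (k mod L)" using jk by metis
      moreover have "j mod L < length C" "k mod L < length C" using L(3) cand[OF C] by (auto intro!: mod_less_divisor simp del: length_greater_0_conv)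
      ultimately have "j mod L = k mod L" using nth_eq_iff_index_eq[OF C'(1)] by blast
      then show "j = k" using jk by (cases "j = L"; cases "k = L") auto
    qed
  qed
  define lim where "lim s' \<longleftrightarrow> env s' \<and> var s' ''len'' = L \<and>
    arr s' ''cycle'' = c \<and>
    (\<forall>i<n. arr s' ''ptr'' i \<le> n \<and> arr s' ''thr'' i \<le> n \<and> arr s' ''h3'' i = n) \<and>
    (\<forall>i<n. i \<notin> c ` {1..L} \<longrightarrow> arr s' ''ptr'' i = 0) \<and>
    (\<forall>k<L. arr s' ''pos'' (c (Suc k)) < n) \<and>
    (inj_on c {1..L} \<longrightarrow> (\<forall>k<L. arr s' ''pos'' (c (Suc k)) = k \<and>
       arr s' ''ptr'' (c (Suc k)) = r (c (Suc k)) (c (Suc (Suc k))))) \<and>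
    cycle_bounds c L (arr s' ''thr'')" for s'
  have 1: "runs W limits_prog s (400 * (n + 1) * (n + 1)) (\<lambda>s'. lim s' \<and> var s' ''found'' = 0)"
    unfolding lim_def c_def
    by (rule runs_mono[OF runs_frame[OF limits_correct[OF env ab L(1,3,4) range c01]]])
      (use found in \<open>auto simp: limits_prog_def\<close>)
  have rest: "runs W (Seq (da_prog ''h3'') (when_complete verify_prog)) s1
      (100 * (n + 1) * (n + 1) + (200 * (n + 1) + 5)) (answers a b)"
    if s1: "lim s1 \<and> var s1 ''found'' = 0" for s1
  proof -
    let ?p = "arr s1 ''ptr''" and ?t = "arr s1 ''thr''"
    note passes = completion_passes[where c = c and L = L and ?p0.0 = ?p and ?t0.0 = ?t]
    have pre: "k < L \<Longrightarrow> ?p (c (Suc k)) = r (c (Suc k)) (c (Suc (Suc k)))"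
      "i < n \<Longrightarrow> i \<notin> c ` {1..L} \<Longrightarrow> ?p i = 0" "cycle_bounds c L ?t"
      if "completion {..<n} P a b t C" for C t i k
      using s1 cC(3)[OF that] by (auto simp: lim_def)
    have run_da: "runs W (da_prog ''h3'') s1 (100 * (n + 1) * (n + 1)) (\<lambda>s2. env s2 \<and>
       (var s2 ''m'' = n \<and> (\<exists>m. da_result ?p ?t (arr s2 ''ptr'') (arr s2 ''h3'') m) \<or>
        var s2 ''m'' = Suc n \<and> (\<forall>m. \<not> feasible ?p ?t m)) \<and>
       var s2 ''len'' = L \<and> arr s2 ''cycle'' = c \<and> arr s2 ''pos'' = arr s1 ''pos'' \<and> var s2 ''found'' = 0)"
      by (rule runs_mono[OF runs_frame[OF da_correct]])
        (use s1 in \<open>auto simp: lim_def da_prog_def da_step_def\<close>)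
    show ?thesis
    proof (rule runs_Seq[OF run_da])
      fix s2 assume s2: "env s2 \<and>
       (var s2 ''m'' = n \<and> (\<exists>m. da_result ?p ?t (arr s2 ''ptr'') (arr s2 ''h3'') m) \<or>
        var s2 ''m'' = Suc n \<and> (\<forall>m. \<not> feasible ?p ?t m)) \<and>
       var s2 ''len'' = L \<and> arr s2 ''cycle'' = c \<and> arr s2 ''pos'' = arr s1 ''pos'' \<and> var s2 ''found'' = 0"
      show "runs W (when_complete verify_prog) s2 (200 * (n + 1) + 5) (answers a b)"
      proof (rule runs_when_complete)
        assume "var s2 ''m'' = Suc n"
        then have "\<not> feasible ?p ?t m" for m using s2 by auto
        then have "\<not> completion {..<n} P a b t C" for C t
          using passes(1)[of a b t C] cC(1,2)[of t C] c_ends pre[of t C] by auto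
        then show "answers a b s2" using s2 by (intro answers_None) auto
      next
        assume "var s2 ''m'' = n"
        then obtain m where m: "da_result ?p ?t (arr s2 ''ptr'') (arr s2 ''h3'') m" using s2 by auto
        let ?good = "(\<forall>k<L. arr s2 ''pos'' (c (Suc k)) = k \<and> arr s2 ''ptr'' (c (Suc k)) = r (c (Suc k)) (c (Suc (Suc k))))
          \<and> (\<forall>i<n. arr s2 ''ptr'' i \<le> r i (arr s2 ''h3'' i))"
        have "arr s2 ''ptr'' i < n \<and> arr s2 ''h3'' i < n" if "i < n" for i
          using da_result_less[OF m that] m that rank_less_n by (auto simp: da_result_def)
        then have run: "runs W verify_prog s2 (200 * (n + 1)) (\<lambda>s'. arr s' ''cycle'' = c \<and>
          (if ?good then var s' ''found'' = 1 \<and> var s' ''length'' = L else var s' ''found'' = 0))"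
          using s2 L c_n s1 by (intro verify_correct) (auto simp: lim_def)
        show "runs W verify_prog s2 (200 * (n + 1)) (answers a b)"
        proof (rule runs_mono[OF run])
          fix s3 :: state assume s3: "arr s3 ''cycle'' = c \<and>
            (if ?good then var s3 ''found'' = 1 \<and> var s3 ''length'' = L else var s3 ''found'' = 0)"
          show "answers a b s3"
          proof (cases ?good)
            case True
            \<comment> \<open>A passed check means that \<open>pos\<close> recovers the index from
              the agent, so no agent occurs twice.\<close>
            have "inj_on c {1..L}"
            proof (rule inj_onI)
              fix j k assume jk: "j \<in> {1..L}" "k \<in> {1..L}" "c j = c k"
              then obtain j' k' where "j = Suc j'" "k = Suc k'" "j' < L" "k' < L"
                by (cases j; cases k) auto
              then show "j = k" using True jk(3) by metis
            qed
            then have "completes {..<n} P (c 0) (c 1) (map c [0..<L])"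
              using candidate_completes[OF L(2,3) c_ends(1,2) _ _ m] c_n True s1
              by (auto simp: lim_def)
            then show ?thesis using s3 True c_ends(3,4) by (simp add: answers_def result_def)
          next
            case False
            have "\<not> completion {..<n} P a b t C" for C t
            proof
              assume C: "completion {..<n} P a b t C"
              have "?good"
                using passes(2,3)[OF C cC(1,2)[OF C] _ _ pre[OF C] m] c_ends cC(3)[OF C] s1 s2
                by (auto simp: lim_def)
              then show False using False by blast
            qed
            then show ?thesis using s3 False by (intro answers_None) auto
          qed
        qed simp
      qed (use s2 in \<open>auto simp: env_def\<close>)
    qed
  qed
  show ?thesis
    by (rule runs_mono[OF runs_Seq[OF 1 rest]]) (use two in \<open>auto simp: algebra_simps\<close>)
qed

lemma completion_prog_correct:
  assumes ab: "a < n" "b < n" "a \<noteq> b"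
  shows "runs W completion_prog (input n P a b) (1300 * (n + 1) * (n + 1)) (answers a b)"
proof -
  define vars where "vars s \<longleftrightarrow> env s \<and> var s ''a'' = a \<and> var s ''b'' = b \<and> var s ''found'' = 0" for s :: state
  define done1 where "done1 s m1 \<longleftrightarrow> traces a b m1 \<and> m1 permutes {..<n} \<and>
     (\<forall>i<n. arr s ''h1'' i = inv m1 i)" for s :: state and m1
  define done2 where "done2 s m1 m2 \<longleftrightarrow> traces (m1 a) a m2 \<and> m2 permutes {..<n} \<and>
     (\<forall>i<n. arr s ''h2'' i = inv m2 i)" for s :: state and m1 m2
  let ?N = "(n + 1) * (n + 1)"

  have init: "runs W setup_prog (input n P a b) (40 * ?N) vars"
  proof (rule runs_mono[OF runs_frame[OF setup_correct]])
    fix i q assume iq: "i < n" "q < n - 1"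
    then have "length (P i) = n - 1" using full_list(3)[OF inst, of i] by simp
    moreover have "i * n + q < n * n" using iq by (intro index_less) auto
    ultimately show "arr (input n P a b) ''pref'' (i * n + q) = P i ! q"
      using iq by (simp add: input_def)
  qed (auto simp: input_def vars_def setup_prog_def algebra_simps)

  have search1: "runs W (search_prog ''h1'' ''a'' ''b'') s (160 * ?N) (\<lambda>s'. vars s' \<and>
      (var s' ''m'' = n \<and> (\<exists>m1. done1 s' m1 \<and> arr s' ''ptr'' a = r a (m1 a)) \<or>
       var s' ''m'' = Suc n \<and> (\<forall>C t. \<not> completion {..<n} P a b t C)))" if s: "vars s" for s
  proof (rule runs_mono[OF runs_frame[OF search_correct[where u = a and w = b]]])
    fix s' assume s': "(env s' \<and>
      (var s' ''m'' = n \<and> (\<exists>m. traces a b m \<and> m permutes {..<n} \<and>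
        (\<forall>i<n. arr s' ''ptr'' i = r i (m i) \<and> arr s' ''h1'' i = inv m i)) \<or>
      var s' ''m'' = Suc n \<and> (\<forall>s. stable s \<longrightarrow> s a = b \<longrightarrow> s b = a))) \<and>
      (\<forall>x. x \<notin> written_vars (search_prog ''h1'' ''a'' ''b'') \<longrightarrow> var s' x = var s x) \<and>
      (\<forall>x. x \<notin> written_arrs (search_prog ''h1'' ''a'' ''b'') \<longrightarrow> arr s' x = arr s x)"
    then have "vars s'" using s by (auto simp: vars_def search_prog_def da_prog_def da_step_def)
    moreover have "\<not> completion {..<n} P a b t C" if "\<forall>s. stable s \<longrightarrow> s a = b \<longrightarrow> s b = a" for C t
      using that completion_start[of "{..<n}" P a b t C] by (auto simp: completion_def)
    ultimately show "vars s' \<and> (var s' ''m'' = n \<and> (\<exists>m1. done1 s' m1 \<and> arr s' ''ptr'' a = r a (m1 a)) \<or>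
       var s' ''m'' = Suc n \<and> (\<forall>C t. \<not> completion {..<n} P a b t C))"
      using s' ab by (auto simp: done1_def)
  qed (use s ab in \<open>auto simp: vars_def algebra_simps\<close>)

  define get where "get = Assign ''y1'' (table ''pref'' (Var ''a'') (Cell ''ptr'' (Var ''a'')))"
  have get: "runs W get s (steps get) (\<lambda>s'. vars s' \<and> done1 s' m1 \<and> var s' ''y1'' = m1 a)"
    if s: "vars s" "done1 s m1" "arr s ''ptr'' a = r a (m1 a)" for s m1
  proof (rule runs_wp)
    have m: "m1 a < n" using s(2) permutes_in_image[of m1 "{..<n}" a] ab by (auto simp: done1_def)
    then have "arr s ''pref'' (a * n + r a (m1 a)) = m1 a"
      using s(1) ab by (auto simp: vars_def env_def)
    then show "wp W get (\<lambda>s'. vars s' \<and> done1 s' m1 \<and> var s' ''y1'' = m1 a) s"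
      using s ab m index_W[of a "r a (m1 a)"] row_W[of a]
      by (auto simp: get_def vars_def env_def done1_def)
  qed

  have search2: "runs W (search_prog ''h2'' ''y1'' ''a'') s (160 * ?N) (\<lambda>s'. vars s' \<and>
      (var s' ''m'' = n \<and> done1 s' m1 \<and> (\<exists>m2. done2 s' m1 m2) \<or>
       var s' ''m'' = Suc n \<and> (\<forall>C t. \<not> completion {..<n} P a b t C)))"
    if s: "vars s" "done1 s m1" "var s ''y1'' = m1 a" for s m1
  proof (rule runs_mono[OF runs_frame[OF search_correct[where u = "m1 a" and w = a]]])
    show "m1 a < n" using s(2) permutes_in_image[of m1 "{..<n}" a] ab by (auto simp: done1_def)
    fix s' assume s': "(env s' \<and>
      (var s' ''m'' = n \<and> (\<exists>m. traces (m1 a) a m \<and> m permutes {..<n} \<and>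
        (\<forall>i<n. arr s' ''ptr'' i = r i (m i) \<and> arr s' ''h2'' i = inv m i)) \<or>
      var s' ''m'' = Suc n \<and> (\<forall>s. stable s \<longrightarrow> s (m1 a) = a \<longrightarrow> s a = m1 a))) \<and>
      (\<forall>x. x \<notin> written_vars (search_prog ''h2'' ''y1'' ''a'') \<longrightarrow> var s' x = var s x) \<and>
      (\<forall>x. x \<notin> written_arrs (search_prog ''h2'' ''y1'' ''a'') \<longrightarrow> arr s' x = arr s x)"
    then have "vars s'" "done1 s' m1"
      using s by (auto simp: vars_def done1_def search_prog_def da_prog_def da_step_def)
    moreover have "\<not> completion {..<n} P a b t C"
      if *: "\<forall>s. stable s \<longrightarrow> s (m1 a) = a \<longrightarrow> s a = m1 a" for C t
    proof
      assume C: "completion {..<n} P a b t C"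
      then have t: "stable t" "t a = b" "t b \<noteq> a"
        using completion_start[OF C] by (auto simp: completion_def)
      \<comment> \<open>The case of zero steps back identifies \<open>m1 a\<close> as the
        predecessor of \<open>a\<close>, so the second search looks for the right edge.\<close>
      then have "m1 ((inv t ^^ (2 * 0)) a) = inv t ((inv t ^^ (2 * 0)) a)"
        using s(2) unfolding done1_def traces_def by blast
      then have "m1 a = inv t a" by simp
      then have "t (m1 a) = a" using t(1) permutes_inverses(1) by (metis stable_def)
      then show False using * t by auto
    qed
    ultimately show "vars s' \<and> (var s' ''m'' = n \<and> done1 s' m1 \<and> (\<exists>m2. done2 s' m1 m2) \<or>
       var s' ''m'' = Suc n \<and> (\<forall>C t. \<not> completion {..<n} P a b t C))"
      using s' by (auto simp: done2_def)
  qed (use s ab in \<open>auto simp: vars_def algebra_simps\<close>)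

  define found where "found s \<longleftrightarrow> vars s \<and> even (var s ''len'') \<and>
    2 \<le> var s ''len'' \<and> var s ''len'' \<le> n \<and> var s ''cur'' < n \<and>
    (\<forall>k < var s ''len''. arr s ''cycle'' k < n) \<and> arr s ''cycle'' 0 = a \<and> arr s ''cycle'' 1 = b \<and>
    (\<forall>C t. completion {..<n} P a b t C \<longrightarrow> var s ''cur'' = a \<and> var s ''len'' = length C \<and>
      (\<forall>k < length C. arr s ''cycle'' k = C ! k))" for s :: state
  have walk: "runs W walk_prog s (60 * (n + 1)) found"
    if s: "vars s" "done1 s m1" "done2 s m1 m2" for s m1 m2
  proof (rule runs_mono[OF runs_frame[OF walk_correct[where a = a and b = b]]])
    have p: "m1 permutes {..<n}" "m2 permutes {..<n}" using s by (auto simp: done1_def done2_def)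
    show "arr s ''h1'' i < n" "arr s ''h2'' i < n" if "i < n" for i
      using s that permutes_in_image[OF permutes_inv[OF p(1)], of i]
        permutes_in_image[OF permutes_inv[OF p(2)], of i] by (auto simp: done1_def done2_def)
    show "(if odd k then arr s ''h1'' else arr s ''h2'') (C ! k) = C ! (Suc k mod length C)"
      if C: "completion {..<n} P a b t C" "k < length C" for C t k
    proof -
      have "C ! k \<in> set C" using C(2) by simp
      then have "C ! k < n" using C(1) by (auto simp: completion_def)
      moreover have "(if odd k then m1 else m2) (C ! (Suc k mod length C)) = C ! k"
        using s by (intro walk_completion[OF C]) (auto simp: done1_def done2_def)
      ultimately show ?thesis
        using s permutes_inverses(2)[OF p(1), of "C ! (Suc k mod length C)"]
          permutes_inverses(2)[OF p(2), of "C ! (Suc k mod length C)"]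
        by (auto simp: done1_def done2_def split: if_splits)
    qed
  qed (use s ab in \<open>auto simp: vars_def found_def walk_prog_def\<close>)

  define test where "test = If (Op Mul (Op Equal (Var ''cur'') (Var ''a'')) (Op Less (Const 2) (Var ''len'')))
    (Seq limits_prog (Seq (da_prog ''h3'') (when_complete verify_prog))) Skip"
  have test: "runs W test s (8 + (705 * ?N + 1)) (answers a b)" if s: "found s" for s
  proof -
    let ?e = "Op Mul (Op Equal (Var ''cur'') (Var ''a'')) (Op Less (Const 2) (Var ''len''))"
    have val: "val ?e s \<noteq> 0 \<longleftrightarrow> var s ''cur'' = a \<and> 2 < var s ''len''"
      using s by (auto simp: found_def vars_def)
    have "runs W test s (cost ?e + 1 + (705 * (n + 1) * (n + 1) + steps Skip)) (answers a b)"
      unfolding test_def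
    proof (rule runs_If)
      show "fits W ?e s" using s ab by (auto simp: found_def vars_def of_bool_def intro: small)
      assume "val ?e s \<noteq> 0"
      then show "runs W (Seq limits_prog (Seq (da_prog ''h3'') (when_complete verify_prog))) s
          (705 * (n + 1) * (n + 1)) (answers a b)"
        using s ab val by (intro test_correct[where L = "var s ''len''"]) (auto simp: found_def vars_def)
    next
      assume "val ?e s = 0"
      then have *: "\<not> (var s ''cur'' = a \<and> 2 < var s ''len'')" using val by blast
      have "\<not> completion {..<n} P a b t C" for C t
      proof
        assume C: "completion {..<n} P a b t C"
        then have "var s ''cur'' = a" "var s ''len'' = length C" using s by (auto simp: found_def)
        then show False using * C by (simp add: completion_def)
      qed
      then have "answers a b s" using s by (intro answers_None) (auto simp: found_def vars_def)
      then show "runs W Skip s (steps Skip) (answers a b)" by (intro runs_wp) simp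
    qed
    then show ?thesis by (rule runs_mono) (simp_all add: algebra_simps)
  qed

  define c3 where "c3 = when_complete (Seq walk_prog test)"
  have c3: "runs W c3 s (60 * (n + 1) + (8 + (705 * ?N + 1)) + 5) (answers a b)"
    if s: "vars s" "var s ''m'' = n \<and> done1 s m1 \<and> (\<exists>m2. done2 s m1 m2) \<or>
       var s ''m'' = Suc n \<and> (\<forall>C t. \<not> completion {..<n} P a b t C)" for s m1
    unfolding c3_def
  proof (rule runs_when_complete)
    assume "var s ''m'' = n"
    then obtain m2 where "done1 s m1" "done2 s m1 m2" using s(2) by auto
    then show "runs W (Seq walk_prog test) s (60 * (n + 1) + (8 + (705 * ?N + 1))) (answers a b)"
      using s(1) by (intro runs_Seq[OF walk test])
  next
    assume "var s ''m'' = Suc n"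
    then show "answers a b s" using s by (intro answers_None) (auto simp: vars_def)
  qed (use s in \<open>auto simp: vars_def env_def\<close>)

  define c2 where "c2 = when_complete (Seq get (Seq (search_prog ''h2'' ''y1'' ''a'') c3))"
  have c2: "runs W c2 s (steps get + (160 * ?N + (60 * (n + 1) + (8 + (705 * ?N + 1)) + 5)) + 5) (answers a b)"
    if s: "vars s" "var s ''m'' = n \<and> (\<exists>m1. done1 s m1 \<and> arr s ''ptr'' a = r a (m1 a)) \<or>
       var s ''m'' = Suc n \<and> (\<forall>C t. \<not> completion {..<n} P a b t C)" for s
    unfolding c2_def
  proof (rule runs_when_complete)
    assume "var s ''m'' = n"
    then obtain m1 where m1: "done1 s m1" "arr s ''ptr'' a = r a (m1 a)" using s(2) by auto
    show "runs W (Seq get (Seq (search_prog ''h2'' ''y1'' ''a'') c3)) s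
      (steps get + (160 * ?N + (60 * (n + 1) + (8 + (705 * ?N + 1)) + 5))) (answers a b)"
    proof (rule runs_Seq[OF get[OF s(1) m1]])
      fix s1 assume s1: "vars s1 \<and> done1 s1 m1 \<and> var s1 ''y1'' = m1 a"
      show "runs W (Seq (search_prog ''h2'' ''y1'' ''a'') c3) s1
        (160 * ?N + (60 * (n + 1) + (8 + (705 * ?N + 1)) + 5)) (answers a b)"
      proof (rule runs_Seq[OF search2[of s1 m1]])
        fix s2 assume "vars s2 \<and> (var s2 ''m'' = n \<and> done1 s2 m1 \<and> (\<exists>m2. done2 s2 m1 m2) \<or>
           var s2 ''m'' = Suc n \<and> (\<forall>C t. \<not> completion {..<n} P a b t C))"
        then show "runs W c3 s2 (60 * (n + 1) + (8 + (705 * ?N + 1)) + 5) (answers a b)"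
          using c3[of s2 m1] by blast
      qed (use s1 in auto)
    qed
  next
    assume "var s ''m'' = Suc n"
    then show "answers a b s" using s by (intro answers_None) (auto simp: vars_def)
  qed (use s in \<open>auto simp: vars_def env_def\<close>)

  have "runs W completion_prog (input n P a b)
    (40 * ?N + (160 * ?N + (steps get + (160 * ?N + (60 * (n + 1) + (8 + (705 * ?N + 1)) + 5)) + 5)))
    (answers a b)"
    unfolding completion_prog_def get_def[symmetric] test_def[symmetric] c3_def[symmetric] c2_def[symmetric]
  proof (rule runs_Seq[OF init])
    fix s assume "vars s"
    show "runs W (Seq (search_prog ''h1'' ''a'' ''b'') c2) s
      (160 * ?N + (steps get + (160 * ?N + (60 * (n + 1) + (8 + (705 * ?N + 1)) + 5)) + 5)) (answers a b)"
      by (rule runs_Seq[OF search1[OF \<open>vars s\<close>]]) (use c2 in blast)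
  qed
  \<comment> \<open>The quadratic parts add up to 40 + 160 + 160 + 705 = 1065; the linear and
    constant rest fits into 1300.\<close>
  then show ?thesis by (rule runs_mono) (use two in \<open>simp_all add: get_def algebra_simps\<close>)
qed

end

theorem theorem29:
  shows "(\<exists>c. linear_time_completion c) \<and>
    (\<forall>(A :: 'a set) P a b C D.
       sr_instance A P \<longrightarrow> a \<in> A \<longrightarrow> b \<in> A \<longrightarrow> a \<noteq> b \<longrightarrow>
       completes A P a b C \<longrightarrow> completes A P a b D \<longrightarrow> C = D)"
proof (intro conjI allI impI)
  have "linear_time_completion completion_prog"
    unfolding linear_time_completion_def
  \<comment> \<open>As \<open>n + 1\<close> is at most \<open>2 * n\<close>, the factor is 4 * 1300.
    The exponent 4 suffices because \<open>n\<close> is at least 2, so \<open>n ^ 4\<close> reaches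
    the required \<open>4 * (n * n)\<close>.\<close>
  proof (rule exI[of _ 5200], rule exI[of _ 4], intro allI impI)
    fix n :: nat and P a b
    assume inst: "sr_instance {..<n} P" and ab: "a < n" "b < n" "a \<noteq> b"
    then have two: "2 \<le> n" by linarith
    have "2 * 2 \<le> n * n" using two by (intro mult_le_mono)
    then have "4 * (n * n) \<le> (n * n) * (n * n)" by (intro mult_le_mono1) simp
    then interpret ram_instance n P "n ^ 4"
      using inst two by unfold_locales (simp_all add: power4_eq_xxxx mult.assoc)
    obtain t s where "exec (n ^ 4) completion_prog (input n P a b) t s"
      "t \<le> 1300 * (n + 1) * (n + 1)" "answers a b s"
      using completion_prog_correct[OF ab] by (auto simp: runs_def)
    moreover have "(n + 1) * (n + 1) \<le> (2 * n) * (2 * n)" using two by (intro mult_le_mono) auto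
    then have "1300 * ((n + 1) * (n + 1)) \<le> 1300 * ((2 * n) * (2 * n))" by (rule mult_le_mono2)
    then have "1300 * (n + 1) * (n + 1) \<le> 5200 * n\<^sup>2" by (simp add: power2_eq_square algebra_simps)
    ultimately show "\<exists>t s. exec (n ^ 4) completion_prog (input n P a b) t s \<and> t \<le> 5200 * n\<^sup>2 \<and>
      (case result s of Some C \<Rightarrow> completes {..<n} P a b C | None \<Rightarrow> \<not> (\<exists>C. completes {..<n} P a b C))"
      unfolding answers_def by (meson order_trans)
  qed
  then show "\<exists>c. linear_time_completion c" by blast
next
  fix A :: "'a set" and P a b C D
  assume "sr_instance A P" "completes A P a b C" "completes A P a b D"
  then show "C = D" using completes_iff completion_unique by metis
qed

end
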